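(* Let $G/T$ be a flag manifold, where $T$ is a maximal torus of a compact semisimple Lie group $G$, with root decomposition $\mathfrak{g}^{\mathbb{C}}=\mathfrak{t}^{\mathbb{C}}\oplus\sum_{\alpha\in R}\mathfrak{g}^{\alpha}$, and let $g$ be the invariant Riemannian metric on $G/T$ given by positive constants $(c_\alpha)_{\alpha\in R^+}$. Let $U:\mathfrak{m}\times\mathfrak{m}\to\mathfrak{m}$ be the symmetric bilinear map determined by $$2g(U(X,Y),Z)=g(X,[Z,Y]_{\mathfrak{m}})+g([Z,X]_{\mathfrak{m}},Y)\quad (X,Y,Z\in\mathfrak{m}).$$ Then for any $X,Y\in\mathfrak{m}$ we have $$U(X,Y)=\sum_{\substack{\alpha,\beta,\alpha+\beta\in R^+\\ \alpha<\beta}}\frac{c_{\alpha}-c_{\beta}}{2c_{\alpha+\beta}}\,Z_{\alpha}^{\beta}+\sum_{\alpha,\beta,\beta-\alpha\in R^+}\frac{c_{\alpha}-c_{\beta}}{2c_{\beta-\alpha}}\,Z_{-\alpha}^{\beta},$$ where, for $\alpha,\beta\in R$, $$Z_{\alpha}^{\beta}=[Y_{\beta},X_{\alpha}]+[X_{\beta},Y_{\alpha}]+[Y_{-\beta},X_{-\alpha}]+[X_{-\beta},Y_{-\alpha}],$$ and $X=\sum_{\alpha\in R}X_\alpha$, $Y=\sum_{\alpha\in R}Y_\alpha$ with $X_\alpha,Y_\alpha\in\mathfrak{g}^\alpha$ are the decompositions into root components. The first sum runs over pairs $(\alpha,\beta)$ with $\alpha,\beta,\alpha+\beta\in R^+$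 and $\alpha<\beta$; the second over pairs $(\alpha,\beta)$ with $\alpha,\beta,\beta-\alpha\in R^+$.
   Context: $G$ is a compact semisimple Lie group, $T$ a maximal torus of $G$, with Lie algebras $\mathfrak{g}$ and $\mathfrak{t}$. Let $B$ be the Killing form of $\mathfrak{g}$ and let $(\cdot,\cdot)=-B$. The reductive decomposition is $\mathfrak{g}=\mathfrak{t}\oplus\mathfrak{m}$, where $\mathfrak{m}$ is the orthogonal complement of $\mathfrak{t}$ with respect to $B$; the subscript $\mathfrak{m}$ denotes projection onto $\mathfrak{m}$ along $\mathfrak{t}$. $R$ is the root system of $\mathfrak{g}^{\mathbb{C}}$ with respect to the Cartan subalgebra $\mathfrak{t}^{\mathbb{C}}$, with root spaces $\mathfrak{g}^\alpha$. Fix an (ordered) basis of simple roots $\Pi=\{\alpha_1,\dots,\alpha_l\}$ of $R$, with positive roots $R^+$ and negative roots $R^-$. Order on roots: $\gamma=\sum_i\gamma_i\alpha_i$ is greater than $\delta=\sum_i\delta_i\alpha_i$ (written $\gamma>\delta$) if the first nonzero coefficient $\gamma_k-\delta_k$ of $\gamma-\delta$ is positive. The space $\mathfrak{m}$ decomposes as $\mathfrak{m}=\sum_{\alpha\in R^+}\mathfrak{m}^\alpha$ where $\mathfrak{m}^\alpha=\mathfrak{g}^\alpha\oplus\mathfrak{g}^{-\alpha}$ (understood after complexification: the real module is $\mathfrak{m}\cap(\mathfrak{g}^\alpha\oplus\mathfrak{g}^{-\alpha})$). Elements of $\mathfrak{m}$ are viewed in $\mathfrak{m}^{\mathbb{C}}=\sum_{\alpha\in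 R}\mathfrak{g}^\alpha$, and the bracket, $(\cdot,\cdot)$, $g$ and $U$ are extended complex-bilinearly. Any invariant Riemannian metric on $G/T$ is of the form $$g=\sum_{\alpha\in R^+}c_\alpha(\cdot,\cdot)|_{\mathfrak{g}^\alpha\oplus\mathfrak{g}^{-\alpha}},\qquad c_\alpha>0,$$ the subspaces $\mathfrak{m}^\alpha$ being mutually orthogonal. The Levi-Civita connection of $g$ is $\nabla_XY=\tfrac12[X,Y]_{\mathfrak{m}}+U(X,Y)$ for $X,Y\in\mathfrak{m}$. *)

theory Defs
  imports
    "HOL-Analysis.Analysis"
    "HOL-Algebra.Group"
    "HOL-Library.Function_Algebras"
begin

section \<open>Smooth manifolds\<close>

text \<open>All sets \<open>S\<close> below are open wherever the predicate is used, so \<open>at x\<close> is the right filter.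
  Class \<open>C\<^sup>k\<close> is expressed by iterated directional derivatives.\<close>

primrec Ck_on :: "nat \<Rightarrow> 'a::euclidean_space set \<Rightarrow> ('a \<Rightarrow> 'b::euclidean_space) \<Rightarrow> bool" where
  "Ck_on 0 S f \<longleftrightarrow> continuous_on S f"
| "Ck_on (Suc k) S f \<longleftrightarrow>
     (\<forall>x\<in>S. f differentiable (at x)) \<and> (\<forall>v. Ck_on k S (\<lambda>x. frechet_derivative f (at x) v))"

definition smooth_on :: "'a::euclidean_space set \<Rightarrow> ('a \<Rightarrow> 'b::euclidean_space) \<Rightarrow> bool" where
  "smooth_on S f \<longleftrightarrow> (\<forall>k. Ck_on k S f)"

text \<open>A chart is a pair of a domain and a coordinate map. The manifold is a subset of a Hausdorff,
  second countable space, with the subspace topology; its dimension is the dimension of the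
  coordinate space.\<close>

type_synonym ('g, 'e) chart = "'g set \<times> ('g \<Rightarrow> 'e)"

definition smooth_manifold ::
  "'g::{t2_space,second_countable_topology} set \<Rightarrow> ('g, 'e::euclidean_space) chart set \<Rightarrow> bool" where
  "smooth_manifold M A \<longleftrightarrow>
     (\<Union>(D, \<phi>)\<in>A. D) = M \<and>
     (\<forall>(D, \<phi>)\<in>A. openin (top_of_set M) D \<and> open (\<phi> ` D) \<and>
        homeomorphism D (\<phi> ` D) \<phi> (inv_into D \<phi>)) \<and>
     (\<forall>(D, \<phi>)\<in>A. \<forall>(E, \<psi>)\<in>A. smooth_on (\<phi> ` (D \<inter> E)) (\<psi> \<circ> inv_into D \<phi>))"

definition product_atlas :: "('g, 'e) chart set \<Rightarrow> ('h, 'f) chart set \<Rightarrow> ('g \<times> 'h, 'e \<times> 'f) chart set" where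
  "product_atlas A B = {(D \<times> E, map_prod \<phi> \<psi>) | D \<phi> E \<psi>. (D, \<phi>) \<in> A \<and> (E, \<psi>) \<in> B}"

definition smooth_map ::
  "'g::topological_space set \<Rightarrow> ('g, 'e::euclidean_space) chart set \<Rightarrow>
   'h::topological_space set \<Rightarrow> ('h, 'f::euclidean_space) chart set \<Rightarrow> ('g \<Rightarrow> 'h) \<Rightarrow> bool" where
  "smooth_map M A N B f \<longleftrightarrow>
     continuous_on M f \<and> f ` M \<subseteq> N \<and>
     (\<forall>(D, \<phi>)\<in>A. \<forall>(E, \<psi>)\<in>B. smooth_on (\<phi> ` (D \<inter> f -` E)) (\<psi> \<circ> f \<circ> inv_into D \<phi>))"


section \<open>Lie groups and their Lie algebras\<close>

definition lie_group ::
  "('g::{t2_space,second_countable_topology}, 'm) monoid_scheme \<Rightarrow> ('g, 'e::euclidean_space) chart set \<Rightarrow> bool"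
  where
  "lie_group G A \<longleftrightarrow>
     group G \<and> smooth_manifold (carrier G) A \<and>
     smooth_map (carrier G \<times> carrier G) (product_atlas A A) (carrier G) A (\<lambda>(x, y). x \<otimes>\<^bsub>G\<^esub> y) \<and>
     smooth_map (carrier G) A (carrier G) A (\<lambda>x. inv\<^bsub>G\<^esub> x)"

text \<open>Given a chart \<open>(D, \<phi>)\<close> around the identity, the differential of \<open>\<phi>\<close> identifies the tangent
  space at the identity with the coordinate space \<open>'e\<close>. Under this identification \<open>Ad_chart\<close> is the
  adjoint representation (the differential at the identity of conjugation), and the Lie bracket is
  its differential, \<open>[X, Y] = ad X Y\<close> with \<open>ad = d Ad\<close>.\<close>

definition Ad_chart ::
  "('g, 'm) monoid_scheme \<Rightarrow> ('g, 'e::euclidean_space) chart \<Rightarrow> 'g \<Rightarrow> 'e \<Rightarrow> 'e" where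
  "Ad_chart G \<kappa> a = (case \<kappa> of (D, \<phi>) \<Rightarrow>
     frechet_derivative (\<lambda>x. \<phi> (a \<otimes>\<^bsub>G\<^esub> inv_into D \<phi> x \<otimes>\<^bsub>G\<^esub> inv\<^bsub>G\<^esub> a)) (at (\<phi> \<one>\<^bsub>G\<^esub>)))"

definition lie_bracket ::
  "('g, 'm) monoid_scheme \<Rightarrow> ('g, 'e::euclidean_space) chart \<Rightarrow> 'e \<Rightarrow> 'e \<Rightarrow> 'e" where
  "lie_bracket G \<kappa> X Y = (case \<kappa> of (D, \<phi>) \<Rightarrow>
     frechet_derivative (\<lambda>x. Ad_chart G \<kappa> (inv_into D \<phi> x) Y) (at (\<phi> \<one>\<^bsub>G\<^esub>)) X)"

text \<open>The Lie algebra of a closed subgroup \<open>T\<close>: velocities at the identity of the one-parameter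
  subgroups contained in \<open>T\<close>, that is, all \<open>X\<close> with \<open>exp (s X) \<in> T\<close> for all \<open>s\<close>.\<close>

definition subgroup_lie_algebra ::
  "('g::topological_space, 'm) monoid_scheme \<Rightarrow> ('g, 'e::euclidean_space) chart \<Rightarrow> 'g set \<Rightarrow> 'e set" where
  "subgroup_lie_algebra G \<kappa> T = (case \<kappa> of (D, \<phi>) \<Rightarrow>
     {X. \<exists>\<gamma>::real \<Rightarrow> 'g. continuous_on UNIV \<gamma> \<and> (\<forall>s. \<gamma> s \<in> T) \<and>
        (\<forall>s r. \<gamma> (s + r) = \<gamma> s \<otimes>\<^bsub>G\<^esub> \<gamma> r) \<and>
        ((\<lambda>s. \<phi> (\<gamma> s)) has_vector_derivative X) (at 0)})"

text \<open>A torus in \<open>G\<close> is a compact connected abelian subgroup.\<close>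

definition torus_in :: "('g::topological_space, 'm) monoid_scheme \<Rightarrow> 'g set \<Rightarrow> bool" where
  "torus_in G T \<longleftrightarrow>
     subgroup T G \<and> compact T \<and> connected T \<and> (\<forall>x\<in>T. \<forall>y\<in>T. x \<otimes>\<^bsub>G\<^esub> y = y \<otimes>\<^bsub>G\<^esub> x)"

definition maximal_torus :: "('g::topological_space, 'm) monoid_scheme \<Rightarrow> 'g set \<Rightarrow> bool" where
  "maximal_torus G T \<longleftrightarrow> torus_in G T \<and> (\<forall>T'. torus_in G T' \<and> T \<subseteq> T' \<longrightarrow> T' = T)"


section \<open>Semisimplicity and the Killing form\<close>

text \<open>From here on \<open>L\<close> is a Lie bracket on the real vector space \<open>'e\<close>. The inner product of \<open>'e\<close> is
  used only to compute traces with respect to \<open>Basis\<close>.\<close>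

definition lie_ideal :: "('e::euclidean_space \<Rightarrow> 'e \<Rightarrow> 'e) \<Rightarrow> 'e set \<Rightarrow> bool" where
  "lie_ideal L I \<longleftrightarrow> subspace I \<and> (\<forall>X. \<forall>Y\<in>I. L X Y \<in> I)"

primrec derived_series :: "('e::euclidean_space \<Rightarrow> 'e \<Rightarrow> 'e) \<Rightarrow> 'e set \<Rightarrow> nat \<Rightarrow> 'e set" where
  "derived_series L I 0 = I"
| "derived_series L I (Suc k) =
     span {L X Y | X Y. X \<in> derived_series L I k \<and> Y \<in> derived_series L I k}"

definition semisimple :: "('e::euclidean_space \<Rightarrow> 'e \<Rightarrow> 'e) \<Rightarrow> bool" where
  "semisimple L \<longleftrightarrow> (\<forall>I. lie_ideal L I \<and> (\<exists>k. derived_series L I k = {0}) \<longrightarrow> I = {0})"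

definition killing :: "('e::euclidean_space \<Rightarrow> 'e \<Rightarrow> 'e) \<Rightarrow> 'e \<Rightarrow> 'e \<Rightarrow> real" where
  "killing L X Y = (\<Sum>b\<in>Basis. L X (L Y b) \<bullet> b)"

definition m_space :: "('e::euclidean_space \<Rightarrow> 'e \<Rightarrow> 'e) \<Rightarrow> 'e set \<Rightarrow> 'e set" where
  "m_space L t = {X. \<forall>H\<in>t. killing L X H = 0}"

text \<open>The projection onto \<open>\<mm>\<close> along \<open>\<tt>\<close>.\<close>

definition m_proj :: "('e::euclidean_space \<Rightarrow> 'e \<Rightarrow> 'e) \<Rightarrow> 'e set \<Rightarrow> 'e \<Rightarrow> 'e" where
  "m_proj L t X = (THE Y. Y \<in> m_space L t \<and> X - Y \<in> t)"


section \<open>Complexification and roots\<close>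

text \<open>The pair \<open>(X, Y)\<close> stands for \<open>X + \<i> Y\<close>; a real element \<open>X\<close> is \<open>(X, 0)\<close>.\<close>

type_synonym 'e cplx = "'e \<times> 'e"

definition cscale :: "complex \<Rightarrow> 'e::real_vector cplx \<Rightarrow> 'e cplx" where
  "cscale z P = (Re z *\<^sub>R fst P - Im z *\<^sub>R snd P, Re z *\<^sub>R snd P + Im z *\<^sub>R fst P)"

definition cbracket :: "('e::real_vector \<Rightarrow> 'e \<Rightarrow> 'e) \<Rightarrow> 'e cplx \<Rightarrow> 'e cplx \<Rightarrow> 'e cplx" where
  "cbracket L P Q =
     (L (fst P) (fst Q) - L (snd P) (snd Q), L (fst P) (snd Q) + L (snd P) (fst Q))"

text \<open>A complex linear functional on \<open>\<tt>\<close>'s complexification \<open>t \<times> t\<close> is represented by its extension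
  by \<open>0\<close> to all of \<open>'e cplx\<close>. This makes functionals unique as functions and is compatible with the
  pointwise operations \<open>+\<close>, \<open>-\<close> and \<open>0\<close>.\<close>

type_synonym 'e functional = "'e cplx \<Rightarrow> complex"

definition cartan_dual :: "'e::real_vector set \<Rightarrow> 'e functional set" where
  "cartan_dual t = {\<alpha>.
     (\<forall>H\<in>t \<times> t. \<forall>K\<in>t \<times> t. \<alpha> (H + K) = \<alpha> H + \<alpha> K) \<and>
     (\<forall>z. \<forall>H\<in>t \<times> t. \<alpha> (cscale z H) = z * \<alpha> H) \<and>
     (\<forall>H. H \<notin> t \<times> t \<longrightarrow> \<alpha> H = 0)}"

definition root_space ::
  "('e::real_vector \<Rightarrow> 'e \<Rightarrow> 'e) \<Rightarrow> 'e set \<Rightarrow> 'e functional \<Rightarrow> 'e cplx set" where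
  "root_space L t \<alpha> = {P. \<forall>H\<in>t \<times> t. cbracket L H P = cscale (\<alpha> H) P}"

definition roots :: "('e::real_vector \<Rightarrow> 'e \<Rightarrow> 'e) \<Rightarrow> 'e set \<Rightarrow> 'e functional set" where
  "roots L t = {\<alpha> \<in> cartan_dual t. \<alpha> \<noteq> 0 \<and> root_space L t \<alpha> \<noteq> {0}}"

definition lin_comb :: "'e functional list \<Rightarrow> (nat \<Rightarrow> real) \<Rightarrow> 'e functional" where
  "lin_comb \<Delta> r = (\<lambda>H. \<Sum>i<length \<Delta>. complex_of_real (r i) * (\<Delta> ! i) H)"

text \<open>An ordered basis of simple roots: a linearly independent list of roots such that every root is
  a combination with integer coefficients that are all nonnegative or all nonpositive.\<close>

definition simple_roots ::
  "('e::real_vector \<Rightarrow> 'e \<Rightarrow> 'e) \<Rightarrow> 'e set \<Rightarrow> 'e functional list \<Rightarrow> bool" where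
  "simple_roots L t \<Delta> \<longleftrightarrow>
     set \<Delta> \<subseteq> roots L t \<and>
     (\<forall>r. lin_comb \<Delta> r = 0 \<longrightarrow> (\<forall>i<length \<Delta>. r i = 0)) \<and>
     (\<forall>\<gamma>\<in>roots L t. \<exists>n::nat \<Rightarrow> nat.
        \<gamma> = lin_comb \<Delta> (\<lambda>i. real (n i)) \<or> \<gamma> = lin_comb \<Delta> (\<lambda>i. - real (n i)))"

definition positive_roots ::
  "('e::real_vector \<Rightarrow> 'e \<Rightarrow> 'e) \<Rightarrow> 'e set \<Rightarrow> 'e functional list \<Rightarrow> 'e functional set" where
  "positive_roots L t \<Delta> = {\<gamma> \<in> roots L t. \<exists>n::nat \<Rightarrow> nat. \<gamma> = lin_comb \<Delta> (\<lambda>i. real (n i))}"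

text \<open>\<open>root_less \<Delta> \<delta> \<gamma>\<close> means \<open>\<delta> < \<gamma>\<close>: the first nonzero coefficient of \<open>\<gamma> - \<delta>\<close> is positive.\<close>

definition root_less :: "'e functional list \<Rightarrow> 'e functional \<Rightarrow> 'e functional \<Rightarrow> bool" where
  "root_less \<Delta> \<delta> \<gamma> \<longleftrightarrow>
     (\<exists>d c. \<delta> = lin_comb \<Delta> d \<and> \<gamma> = lin_comb \<Delta> c \<and>
        (\<exists>k<length \<Delta>. (\<forall>i<k. c i - d i = 0) \<and> c k - d k > 0))"


section \<open>Invariant metrics and the formula\<close>

definition m_root_space ::
  "('e::euclidean_space \<Rightarrow> 'e \<Rightarrow> 'e) \<Rightarrow> 'e set \<Rightarrow> 'e functional \<Rightarrow> 'e set" where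
  "m_root_space L t \<alpha> =
     {X \<in> m_space L t. \<exists>P\<in>root_space L t \<alpha>. \<exists>Q\<in>root_space L t (- \<alpha>). (X, 0) = P + Q}"

text \<open>Component in the summand belonging to \<open>\<alpha>\<close> of \<open>X\<close> in \<open>\<mm> = \<Sum>\<alpha>\<in>R\<^sup>+. \<mm>\<^sup>\<alpha>\<close>.\<close>

definition m_component ::
  "('e::euclidean_space \<Rightarrow> 'e \<Rightarrow> 'e) \<Rightarrow> 'e set \<Rightarrow> 'e functional list \<Rightarrow> 'e \<Rightarrow> 'e functional \<Rightarrow> 'e" where
  "m_component L t \<Delta> X =
     (THE f. (\<forall>\<alpha>\<in>positive_roots L t \<Delta>. f \<alpha> \<in> m_root_space L t \<alpha>) \<and>
        (\<forall>\<alpha>. \<alpha> \<notin> positive_roots L t \<Delta> \<longrightarrow> f \<alpha> = 0) \<and>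
        X = (\<Sum>\<alpha>\<in>positive_roots L t \<Delta>. f \<alpha>))"

definition invariant_metric ::
  "('e::euclidean_space \<Rightarrow> 'e \<Rightarrow> 'e) \<Rightarrow> 'e set \<Rightarrow> 'e functional list \<Rightarrow> ('e functional \<Rightarrow> real) \<Rightarrow>
   'e \<Rightarrow> 'e \<Rightarrow> real" where
  "invariant_metric L t \<Delta> c X Y =
     (\<Sum>\<alpha>\<in>positive_roots L t \<Delta>.
        c \<alpha> * - killing L (m_component L t \<Delta> X \<alpha>) (m_component L t \<Delta> Y \<alpha>))"

definition symmetric_bilinear_map_on ::
  "'e::real_vector set \<Rightarrow> ('e \<Rightarrow> 'e \<Rightarrow> 'e) \<Rightarrow> bool" where
  "symmetric_bilinear_map_on m U \<longleftrightarrow>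
     (\<forall>X\<in>m. \<forall>Y\<in>m. U X Y \<in> m \<and> U X Y = U Y X) \<and>
     (\<forall>X\<in>m. \<forall>Y\<in>m. \<forall>Z\<in>m. U (X + Y) Z = U X Z + U Y Z) \<and>
     (\<forall>a. \<forall>X\<in>m. \<forall>Y\<in>m. U (a *\<^sub>R X) Y = a *\<^sub>R U X Y)"

definition root_decomposition ::
  "('e::real_vector \<Rightarrow> 'e \<Rightarrow> 'e) \<Rightarrow> 'e set \<Rightarrow> 'e \<Rightarrow> ('e functional \<Rightarrow> 'e cplx) \<Rightarrow> bool" where
  "root_decomposition L t X Xr \<longleftrightarrow>
     (\<forall>\<alpha>\<in>roots L t. Xr \<alpha> \<in> root_space L t \<alpha>) \<and> (X, 0) = (\<Sum>\<alpha>\<in>roots L t. Xr \<alpha>)"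

text \<open>\<open>Z_term L Xr Yr \<alpha> \<beta>\<close> is \<open>Z\<close> with lower index \<open>\<alpha>\<close> and upper index \<open>\<beta>\<close>.\<close>

definition Z_term ::
  "('e::real_vector \<Rightarrow> 'e \<Rightarrow> 'e) \<Rightarrow> ('e functional \<Rightarrow> 'e cplx) \<Rightarrow> ('e functional \<Rightarrow> 'e cplx) \<Rightarrow>
   'e functional \<Rightarrow> 'e functional \<Rightarrow> 'e cplx" where
  "Z_term L Xr Yr \<alpha> \<beta> =
     cbracket L (Yr \<beta>) (Xr \<alpha>) + cbracket L (Xr \<beta>) (Yr \<alpha>) +
     cbracket L (Yr (- \<beta>)) (Xr (- \<alpha>)) + cbracket L (Xr (- \<beta>)) (Yr (- \<alpha>))"

end

theory Submission
  imports Defs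
begin

text \<open>Extend \<open>c\<close> to all roots by \<open>c\<^sub>-\<^sub>\<alpha> = c\<^sub>\<alpha>\<close> and let \<open>\<Lambda>\<close> multiply the root space of \<open>\<alpha>\<close> by \<open>c\<^sub>\<alpha>\<close>, so that
  \<open>g X Z = - B (\<Lambda> X) Z\<close>. Invariance of the Killing form \<open>B\<close> turns the equation for \<open>U\<close> into
  \<open>2 \<Lambda> U(X, Y) = [Y, \<Lambda> X] + [X, \<Lambda> Y]\<close> modulo \<open>\<tt>\<close>. Comparing root components expresses \<open>U(X, Y)\<close> as a sum
  over ordered pairs of roots whose sum is a root; the bracket is antisymmetric, so the two orders of a
  pair combine to the factor \<open>c\<^sub>\<alpha> - c\<^sub>\<beta>\<close>.

  The structure theory this needs is obtained without the exponential map, Haar measure or Cartan's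
  theorems. One-parameter subgroups are limits of discrete powers. Negative definiteness of \<open>B\<close> comes
  from a trace estimate for operators all of whose powers are bounded, applied to the bounded
  operators \<open>Ad a\<close>. That \<open>\<tt>\<close> is its own centralizer follows from maximality of \<open>T\<close> once \<open>T\<close> is known to
  act trivially on the centralizer of \<open>\<tt>\<close>, and the stabilizer in \<open>T\<close> of this centralizer is open by an
  argument in the spirit of the closed subgroup theorem.\<close>


section \<open>Symmetry of second derivatives\<close>

text \<open>The bracket is given as the derivative of \<open>Ad\<close> read in one chart, so its
  differentiability and antisymmetry have to be established: it is rewritten as the antisymmetrized
  mixed second derivative of the product at the identity, and antisymmetry is then Schwarz's
  theorem. The torus is known only as a compact connected abelian subgroup. It carries no manifold
  structure, and it is not known beforehand to be generated by its one-parameter subgroups. Hence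
  [X, t] = 0 does not say at once that \<open>X\<close> is fixed by \<open>Ad T\<close>; this is the
  gap that the stabilizer argument closes. A uniform bound for \<open>Ad\<close> over the compact
  group takes the place of an invariant inner product. Complex vectors are pairs of real ones, and
  the complexification is treated as a real space of twice the dimension: \<i> ad H is then
  symmetric for the real part of the Hermitian form of -B, so that real spectral theory yields all
  root vectors. The order on roots only selects one of the two orders of a pair of positive roots.
  In a pair of mixed signs the signs themselves distinguish the members, so the second sum carries
  no order condition.\<close>

lemma linear_sum_Basis:
  fixes f :: "'a::euclidean_space \<Rightarrow> 'b::real_vector"
  assumes "linear f" shows "f v = (\<Sum>b\<in>Basis. (v \<bullet> b) *\<^sub>R f b)"
  by (metis (no_types, lifting) assms euclidean_representation linear_cmul linear_sum sum.cong)

text \<open>\<open>Ck_on\<close> sees only germs at points of the open set \<open>S\<close>, so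
  equality on \<open>S\<close> passes to all iterated derivatives. This carries smoothness from the
  product-atlas form of the group operation over to \<open>mult_chart\<close>.\<close>

lemma Ck_on_cong:
  assumes "open S" and "\<And>x. x \<in> S \<Longrightarrow> f x = g x" and "Ck_on k S f"
  shows "Ck_on k S g"
  using assms(2,3)
proof (induction k arbitrary: f g)
  case 0
  then show ?case by (metis Ck_on.simps(1) continuous_on_eq)
next
  case (Suc k)
  have d: "(g has_derivative frechet_derivative f (at x)) (at x)" if "x \<in> S" for x
    using has_derivative_transform_within_open[OF _ assms(1) that, where f=f and g=g and f'="frechet_derivative f (at x)"] Suc.prems that
    by (simp add: frechet_derivative_works)
  have fd: "frechet_derivative f (at x) = frechet_derivative g (at x)" if "x \<in> S" for x
    using frechet_derivative_at[OF d[OF that]] .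
  have "Ck_on k S (\<lambda>x. frechet_derivative g (at x) v)" for v
    by (rule Suc.IH[of "\<lambda>x. frechet_derivative f (at x) v"]) (use Suc.prems fd in auto)
  then show ?case using d by (auto simp: differentiable_def)
qed

text \<open>Schwarz's theorem by second differences. The mean value theorem, used once in direction
  \<open>v\<close> and once in direction \<open>w\<close>, turns f(p+hv+hw) - f(p+hv) - f(p+hw) +
  f(p) into h^2 times a mixed derivative at a nearby point, and this difference is symmetric in
  \<open>v\<close> and \<open>w\<close>.\<close>

lemma mixed_partials_eq_real:
  fixes f :: "'a::euclidean_space \<Rightarrow> real"
  assumes S: "open S" "p \<in> S"
    and fv: "\<And>x. x \<in> S \<Longrightarrow> (f has_derivative f' x) (at x)"
    and dv: "\<And>x. x \<in> S \<Longrightarrow> ((\<lambda>x. f' x v) has_derivative V x) (at x)"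
    and dw: "\<And>x. x \<in> S \<Longrightarrow> ((\<lambda>x. f' x w) has_derivative W x) (at x)"
    and cv: "continuous_on S (\<lambda>x. V x w)" and cw: "continuous_on S (\<lambda>x. W x v)"
  shows "V p w = W p v"
proof -
  \<comment> \<open>Stated for arbitrary directions and derivatives, because it is used once as it
    stands and once with \<open>v\<close> and \<open>w\<close> exchanged.\<close>
  have key: "\<exists>x. norm (x - p) \<le> h * (norm v + norm w) \<and>
      f (p + h *\<^sub>R v + h *\<^sub>R w) - f (p + h *\<^sub>R v) - f (p + h *\<^sub>R w) + f p = h * h * V x w"
    if h: "h > 0" and cb: "cball p (h * (norm v + norm w)) \<subseteq> S"
      and fv: "\<And>x. x \<in> S \<Longrightarrow> (f has_derivative f' x) (at x)"
      and dv: "\<And>x. x \<in> S \<Longrightarrow> ((\<lambda>x. f' x v) has_derivative V x) (at x)"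
    for h v w f' V
  proof -
    have inS: "p + s *\<^sub>R v + r *\<^sub>R w \<in> S" if "0 \<le> s" "s \<le> h" "0 \<le> r" "r \<le> h" for s r
    proof -
      have "norm (s *\<^sub>R v + r *\<^sub>R w) \<le> s * norm v + r * norm w"
        using norm_triangle_ineq[of "s *\<^sub>R v" "r *\<^sub>R w"] that by simp
      also have "\<dots> \<le> h * (norm v + norm w)"
        using that by (simp add: distrib_left add_mono mult_right_mono)
      finally show ?thesis using cb by (auto simp: dist_norm subset_iff norm_minus_commute add.assoc
            intro: order_trans[OF norm_minus_cancel[THEN eq_refl]])
    qed
    define g where "g s = f (p + s *\<^sub>R v + h *\<^sub>R w) - f (p + s *\<^sub>R v)" for s
    have g: "(g has_real_derivative f' (p + s *\<^sub>R v + h *\<^sub>R w) v - f' (p + s *\<^sub>R v) v) (at s)"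
      if "0 \<le> s" "s \<le> h" for s
    proof -
      have s1: "p + s *\<^sub>R v + h *\<^sub>R w \<in> S" and s2: "p + s *\<^sub>R v \<in> S"
        using inS[of s h] inS[of s 0] that h by auto
      have 1: "((\<lambda>s. f (p + s *\<^sub>R v + h *\<^sub>R w)) has_derivative (\<lambda>r. f' (p + s *\<^sub>R v + h *\<^sub>R w) (r *\<^sub>R v))) (at s)"
        by (rule has_derivative_compose[where g=f and f="\<lambda>s. p + s *\<^sub>R v + h *\<^sub>R w", OF _ fv[OF s1]]) (auto intro!: derivative_eq_intros)
      have 2: "((\<lambda>s. f (p + s *\<^sub>R v)) has_derivative (\<lambda>r. f' (p + s *\<^sub>R v) (r *\<^sub>R v))) (at s)"
        by (rule has_derivative_compose[where g=f and f="\<lambda>s. p + s *\<^sub>R v", OF _ fv[OF s2]]) (auto intro!: derivative_eq_intros)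
      show ?thesis
        unfolding has_field_derivative_def g_def
        by (rule has_derivative_eq_rhs[OF has_derivative_diff[OF 1 2]])
          (auto simp: linear_scale[OF has_derivative_linear[OF fv[OF s1]]]
             linear_scale[OF has_derivative_linear[OF fv[OF s2]]] fun_eq_iff right_diff_distrib mult.commute)
    qed
    obtain s where s: "0 < s" "s < h"
      and gs: "g h - g 0 = h * (f' (p + s *\<^sub>R v + h *\<^sub>R w) v - f' (p + s *\<^sub>R v) v)"
      using MVT2[OF h, of g "\<lambda>s. f' (p + s *\<^sub>R v + h *\<^sub>R w) v - f' (p + s *\<^sub>R v) v"] g by auto
    have k: "((\<lambda>r. f' (p + s *\<^sub>R v + r *\<^sub>R w) v) has_real_derivative V (p + s *\<^sub>R v + r *\<^sub>R w) w) (at r)"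
      if "0 \<le> r" "r \<le> h" for r
    proof -
      have s1: "p + s *\<^sub>R v + r *\<^sub>R w \<in> S" using inS[of s r] that s by auto
      have 1: "((\<lambda>r. f' (p + s *\<^sub>R v + r *\<^sub>R w) v) has_derivative (\<lambda>x. V (p + s *\<^sub>R v + r *\<^sub>R w) (x *\<^sub>R w))) (at r)"
        by (rule has_derivative_compose[where g="\<lambda>x. f' x v" and f="\<lambda>r. p + s *\<^sub>R v + r *\<^sub>R w", OF _ dv[OF s1]]) (auto intro!: derivative_eq_intros)
      show ?thesis unfolding has_field_derivative_def
        by (rule has_derivative_eq_rhs[OF 1])
          (auto simp: linear_scale[OF has_derivative_linear[OF dv[OF s1]]] fun_eq_iff mult.commute)
    qed
    obtain r where r: "0 < r" "r < h"
      and kr: "f' (p + s *\<^sub>R v + h *\<^sub>R w) v - f' (p + s *\<^sub>R v + 0 *\<^sub>R w) v = h * V (p + s *\<^sub>R v + r *\<^sub>R w) w"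
      using MVT2[OF h, of "\<lambda>r. f' (p + s *\<^sub>R v + r *\<^sub>R w) v" "\<lambda>r. V (p + s *\<^sub>R v + r *\<^sub>R w) w"] k by auto
    have "norm (s *\<^sub>R v + r *\<^sub>R w) \<le> s * norm v + r * norm w"
      using norm_triangle_ineq[of "s *\<^sub>R v" "r *\<^sub>R w"] s r by simp
    also have "\<dots> \<le> h * (norm v + norm w)"
      using s r by (simp add: distrib_left add_mono mult_right_mono)
    finally have "norm ((p + s *\<^sub>R v + r *\<^sub>R w) - p) \<le> h * (norm v + norm w)" by (simp add: add.assoc)
    moreover have "f (p + h *\<^sub>R v + h *\<^sub>R w) - f (p + h *\<^sub>R v) - f (p + h *\<^sub>R w) + f p = h * h * V (p + s *\<^sub>R v + r *\<^sub>R w) w"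
      using gs kr by (simp add: g_def)
    ultimately show ?thesis by blast
  qed
  show ?thesis
  proof (rule ccontr)
    assume "V p w \<noteq> W p v"
    \<comment> \<open>The two mixed derivatives agree at suitable points \<open>x\<close> and
      \<open>y\<close>. If each value differs from the one at \<open>p\<close> by less than half the
      supposed gap, the triangle inequality is violated.\<close>
    then have pos: "dist (V p w) (W p v) / 2 > 0" by simp
    have c1: "isCont (\<lambda>x. V x w) p" and c2: "isCont (\<lambda>x. W x v) p"
      using cv cw S continuous_on_eq_continuous_at by blast+
    obtain d1 where d1: "d1 > 0" "\<And>x. dist x p < d1 \<Longrightarrow> dist (V x w) (V p w) < dist (V p w) (W p v) / 2"
      using c1 pos unfolding continuous_at_eps_delta by metis
    obtain d2 where d2: "d2 > 0" "\<And>x. dist x p < d2 \<Longrightarrow> dist (W x v) (W p v) < dist (V p w) (W p v) / 2"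
      using c2 pos unfolding continuous_at_eps_delta by metis
    obtain d3 where d3: "d3 > 0" "ball p d3 \<subseteq> S" using S open_contains_ball by metis
    define d where "d = min d1 (min d2 d3)"
    have d: "d > 0" using d1 d2 d3 by (auto simp: d_def)
    \<comment> \<open>The summand 1 keeps \<open>n\<close> positive when both directions
      vanish.\<close>
    define n where "n = norm v + norm w + 1"
    define h where "h = d / (2 * n)"
    have nn: "n > 0" by (simp add: add_nonneg_pos n_def)
    have h: "h > 0" using d nn by (auto simp: h_def)
    have "h * (norm v + norm w) \<le> h * n" using h by (simp add: n_def)
    also have "\<dots> = d / 2" using nn by (simp add: h_def)
    finally have hd: "h * (norm v + norm w) < d" using d by simp
    have cb: "cball p (h * (norm v + norm w)) \<subseteq> S"
      using d3 hd by (auto simp: d_def)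
    obtain x where x: "norm (x - p) \<le> h * (norm v + norm w)"
      "f (p + h *\<^sub>R v + h *\<^sub>R w) - f (p + h *\<^sub>R v) - f (p + h *\<^sub>R w) + f p = h * h * V x w"
      using key[OF h cb fv dv] by auto
    obtain y where y: "norm (y - p) \<le> h * (norm w + norm v)"
      "f (p + h *\<^sub>R w + h *\<^sub>R v) - f (p + h *\<^sub>R w) - f (p + h *\<^sub>R v) + f p = h * h * W y v"
      using key[OF h _ fv dw] cb by (metis add.commute)
    have "h * h * V x w = h * h * W y v" using x(2) y(2) by (simp add: algebra_simps)
    then have eq: "V x w = W y v" using h by simp
    have "dist (V x w) (V p w) < dist (V p w) (W p v) / 2" "dist (W y v) (W p v) < dist (V p w) (W p v) / 2"
      using d1(2)[of x] d2(2)[of y] x(1) y(1) hd by (auto simp: dist_norm d_def add.commute)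
    then show False using eq by (metis dist_commute dist_triangle_half_r less_irrefl)
  qed
qed

lemma mixed_partials_eq:
  fixes f :: "'a::euclidean_space \<Rightarrow> 'b::euclidean_space"
  assumes S: "open S" "p \<in> S" and f: "Ck_on (Suc (Suc 0)) S f"
  shows "frechet_derivative (\<lambda>x. frechet_derivative f (at x) v) (at p) w =
         frechet_derivative (\<lambda>x. frechet_derivative f (at x) w) (at p) v"
proof (rule euclidean_eqI)
  fix b :: 'b assume "b \<in> Basis"
  have 1: "(f has_derivative frechet_derivative f (at x)) (at x)" if "x \<in> S" for x
    using f that by (auto simp: frechet_derivative_works)
  have 2: "((\<lambda>x. frechet_derivative f (at x) v) has_derivative
      frechet_derivative (\<lambda>x. frechet_derivative f (at x) v) (at x)) (at x)" if "x \<in> S" for x v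
    using f that by (auto simp: frechet_derivative_works)
  have 3: "continuous_on S (\<lambda>x. frechet_derivative (\<lambda>x. frechet_derivative f (at x) v) (at x) w)" for v w
    using f by auto
  show "frechet_derivative (\<lambda>x. frechet_derivative f (at x) v) (at p) w \<bullet> b =
         frechet_derivative (\<lambda>x. frechet_derivative f (at x) w) (at p) v \<bullet> b"
    by (rule mixed_partials_eq_real[OF S, of "\<lambda>x. f x \<bullet> b" "\<lambda>x v. frechet_derivative f (at x) v \<bullet> b"])
      (auto intro!: has_derivative_inner_left 1 2 3 continuous_intros)
qed

section \<open>Traces of generators of bounded groups\<close>

definition tr :: "('a::euclidean_space \<Rightarrow> 'a) \<Rightarrow> real" where
  "tr f = (\<Sum>b\<in>Basis. f b \<bullet> b)"

lemma tr_commute: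
  fixes f g :: "'a::euclidean_space \<Rightarrow> 'a"
  assumes "linear f" "linear g"
  shows "tr (\<lambda>x. f (g x)) = tr (\<lambda>x. g (f x))"
proof -
  have 1: "f (g b) \<bullet> b = (\<Sum>c\<in>Basis. (g b \<bullet> c) * (f c \<bullet> b))" if "linear f" for f g :: "'a \<Rightarrow> 'a" and b
  proof -
    have "f (g b) = (\<Sum>c\<in>Basis. (g b \<bullet> c) *\<^sub>R f c)" by (rule linear_sum_Basis[OF that])
    then show ?thesis by (simp add: inner_sum_left)
  qed
  have "tr (\<lambda>x. f (g x)) = (\<Sum>b\<in>Basis. \<Sum>c\<in>Basis. (g b \<bullet> c) * (f c \<bullet> b))"
    unfolding tr_def by (rule sum.cong[OF refl 1[OF assms(1)]])
  also have "\<dots> = (\<Sum>c\<in>Basis. \<Sum>b\<in>Basis. (f c \<bullet> b) * (g b \<bullet> c))"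
    by (subst sum.swap) (simp only: mult.commute)
  also have "\<dots> = tr (\<lambda>x. g (f x))"
    unfolding tr_def by (rule sum.cong[OF refl 1[OF assms(2), symmetric]])
  finally show ?thesis .
qed

lemma tr_sum: "tr (\<lambda>x. \<Sum>k\<in>S. f k x) = (\<Sum>k\<in>S. tr (f k))"
  unfolding tr_def inner_sum_left by (rule sum.swap)

lemma tr_scale: "tr (\<lambda>x. c *\<^sub>R f x) = c * tr f"
  by (simp add: tr_def sum_distrib_left)

lemma tr_diff: "tr (\<lambda>x. f x - g x) = tr f - tr g"
  by (simp add: tr_def inner_diff_left sum_subtractf)

lemma norm_adjoint_le:
  fixes f :: "'a::euclidean_space \<Rightarrow> 'a"
  assumes f: "linear f" and K: "\<And>v. norm (f v) \<le> K * norm v"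
  shows "norm (adjoint f v) \<le> K * norm v"
proof (cases "adjoint f v = 0")
  case True
  have "0 \<le> K * norm v" using K[of v] norm_ge_zero order_trans by blast
  then show ?thesis using True by simp
next
  case False
  have "norm (adjoint f v) * norm (adjoint f v) = f (adjoint f v) \<bullet> v"
    using adjoint_works[OF f, of "adjoint f v" v] by (simp add: power2_norm_eq_inner[symmetric] power2_eq_square)
  also have "\<dots> \<le> norm (f (adjoint f v)) * norm v" by (rule norm_cauchy_schwarz)
  also have "\<dots> \<le> (K * norm (adjoint f v)) * norm v" by (intro mult_right_mono K) simp
  finally have "norm (adjoint f v) * norm (adjoint f v) \<le> norm (adjoint f v) * (K * norm v)"
    by (simp add: ac_simps)
  then show ?thesis using False by simp
qed

text \<open>The averages \<open>W = (\<Sum>k<N. M\<^sup>k (M\<^sup>k)\<^sup>T) / N\<close> are uniformly positive definite and satisfy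
  \<open>M W M\<^sup>T = W + O(1/N)\<close>, so \<open>C = M - M\<^sup>-\<^sup>1\<close> is skew with respect to \<open>W\<close> up to \<open>O(1/N)\<close>.\<close>

lemma tr_square_power_bounded:
  fixes M M' :: "'a::euclidean_space \<Rightarrow> 'a"
  assumes lin: "linear M" "linear M'" and inv: "\<And>v. M (M' v) = v" "\<And>v. M' (M v) = v"
    and K: "\<And>k v. norm ((M ^^ k) v) \<le> K * norm v" "\<And>k v. norm ((M' ^^ k) v) \<le> K * norm v" "K > 0"
  defines "C \<equiv> \<lambda>v. M v - M' v"
  shows "tr (\<lambda>v. C (C v)) \<le> - (\<Sum>b\<in>Basis. (norm (C b))\<^sup>2) / K ^ 8"
proof -
  have linC: "linear C" unfolding C_def using lin by (intro linear_compose_sub)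
  define Mk where "Mk k = M ^^ k" for k
  define Mi where "Mi k = M' ^^ k" for k
  have lk: "linear (Mk k)" for k unfolding Mk_def
  proof (induction k)
    case (Suc k) then show ?case using linear_compose[OF Suc lin(1)] by (simp add: o_def)
  qed (simp add: linear_ident id_def)
  have MkS: "Mk (Suc k) v = M (Mk k v)" "Mk (Suc k) v = Mk k (M v)"
    "Mi (Suc k) v = M' (Mi k v)" "Mi (Suc k) v = Mi k (M' v)" for k v
    by (simp_all add: Mk_def Mi_def funpow_swap1)
  have Mk0: "Mk 0 v = v" "Mi 0 v = v" for v by (simp_all add: Mk_def Mi_def)
  have MkMi: "Mk k (Mi k v) = v" for k v
    by (induction k arbitrary: v) (simp_all only: Mk0 MkS(2,3) inv)
  have Mi_Mk: "Mi k (Mk k v) = v" for k v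
    by (induction k arbitrary: v) (simp_all only: Mk0 MkS(1,4) inv)
  have bk: "norm (Mk k v) \<le> K * norm v" "norm (Mi k v) \<le> K * norm v" for k v
    using K by (auto simp: Mk_def Mi_def)
  let ?T = "\<lambda>k. adjoint (Mk k)"
  have lT: "linear (?T k)" for k using adjoint_linear[OF lk] .
  have bT: "norm (?T k v) \<le> K * norm v" for k v by (rule norm_adjoint_le[OF lk bk(1)])
  have bT': "norm v \<le> K * norm (?T k v)" for k v
  proof (cases "v = 0")
    case True then show ?thesis using \<open>K > 0\<close> by simp
  next
    case False
    have "norm v * norm v = Mk k (Mi k v) \<bullet> v"
      by (simp add: MkMi power2_norm_eq_inner[symmetric] power2_eq_square)
    also have "\<dots> = Mi k v \<bullet> ?T k v" using adjoint_works[OF lk] by metis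
    also have "\<dots> \<le> norm (Mi k v) * norm (?T k v)" by (rule norm_cauchy_schwarz)
    also have "\<dots> \<le> (K * norm v) * norm (?T k v)" by (intro mult_right_mono bk) simp
    finally show ?thesis using False by simp
  qed
  \<comment> \<open>The average over N powers is invariant only up to a boundary term of order 1/N,
    so the bound is proved with this error and N tends to infinity at the end.\<close>
  have main: "tr (\<lambda>v. C (C v)) \<le> - (\<Sum>b\<in>Basis. (norm (C b))\<^sup>2) / K ^ 8
      + real (DIM('a)) * (2 * K) * (2 * K * (K * K + 1)) * (K * K) / real N" if N: "N > 0" for N :: nat
  proof -
    define W where "W v = (1 / real N) *\<^sub>R (\<Sum>k<N. Mk k (?T k v))" for v
    have lkT: "linear (\<lambda>v. Mk k (?T k v))" for k
      using linear_compose[OF lT lk] by (simp add: o_def)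
    have lW: "linear W" unfolding W_def
      by (intro linear_compose_scale_right linear_compose_sum) (use lkT in auto)
    have TT: "u \<bullet> Mk k (?T k v) = ?T k u \<bullet> ?T k v" for k u v
      using adjoint_works[OF lk, of "?T k v" k u] inner_commute by metis
    have WW: "u \<bullet> W v = (1 / real N) * (\<Sum>k<N. ?T k u \<bullet> ?T k v)" for u v
      unfolding W_def by (simp add: inner_sum_right TT)
    have Wpos: "(norm v)\<^sup>2 / K\<^sup>2 \<le> v \<bullet> W v" for v
    proof -
      have "(norm v)\<^sup>2 / K\<^sup>2 \<le> ?T k v \<bullet> ?T k v" for k
      proof -
        have "(norm v)\<^sup>2 \<le> (K * norm (?T k v))\<^sup>2" by (intro power_mono bT') simp
        then show ?thesis using \<open>K > 0\<close> by (simp add: field_simps power_mult_distrib power2_norm_eq_inner)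
      qed
      then have "(\<Sum>k<N. (norm v)\<^sup>2 / K\<^sup>2) \<le> (\<Sum>k<N. ?T k v \<bullet> ?T k v)" by (intro sum_mono)
      then show ?thesis using N by (simp add: WW field_simps)
    qed
    have Wle: "norm (W v) \<le> K * K * norm v" for v
    proof -
      have "norm (\<Sum>k<N. Mk k (?T k v)) \<le> (\<Sum>k<N. K * (K * norm v))"
        by (intro sum_norm_le order_trans[OF bk(1)] mult_left_mono bT) (use K in auto)
      then show ?thesis using N by (simp add: W_def field_simps)
    qed
    have Wge: "norm v \<le> K * K * norm (W v)" for v
    proof (cases "v = 0")
      case False
      have "(norm v)\<^sup>2 \<le> K\<^sup>2 * (v \<bullet> W v)" using Wpos[of v] \<open>K > 0\<close> by (simp add: field_simps)
      also have "\<dots> \<le> K\<^sup>2 * (norm v * norm (W v))" by (intro mult_left_mono norm_cauchy_schwarz) simp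
      finally have "norm v * norm v \<le> norm v * (K * K * norm (W v))" by (simp add: power2_eq_square ac_simps)
      then show ?thesis using False by simp
    qed (simp add: K less_imp_le)
    have "inj W"
    proof (rule linear_injective_0[THEN iffD2, OF lW], intro allI impI)
      fix v assume "W v = 0" then show "v = 0" using Wge[of v] by simp
    qed
    then obtain V where lV: "linear V" and VW: "\<And>v. V (W v) = v" and WV: "\<And>v. W (V v) = v"
      using linear_injective_isomorphism[OF lW] by blast
    have Vle: "norm (V v) \<le> K * K * norm v" for v using Wge[of "V v"] by (simp add: WV)
    \<comment> \<open>\<open>V\<close> inverts \<open>W\<close>. The square of norm u \<le> K^2 norm
      (V u) contributes K^4, and the lower bound \<open>Wpos\<close> at V u contributes K^2.\<close>
    have Vpos: "(norm u)\<^sup>2 / K ^ 6 \<le> V u \<bullet> u" for u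
    proof -
      have "(norm u)\<^sup>2 \<le> (K * K * norm (V u))\<^sup>2" using Wle[of "V u"] by (intro power_mono) (auto simp: WV)
      then have "(norm u)\<^sup>2 / K ^ 6 \<le> (norm (V u))\<^sup>2 / K\<^sup>2"
        using \<open>K > 0\<close> by (simp add: field_simps power_mult_distrib eval_nat_numeral)
      also have "\<dots> \<le> V u \<bullet> u" using Wpos[of "V u"] by (simp add: WV)
      finally show ?thesis .
    qed
    define M't where "M't = adjoint M'"
    define Mt where "Mt = adjoint M"
    define Ct where "Ct = adjoint C"
    have lt: "linear M't" "linear Mt" "linear Ct" by (auto simp: M't_def Mt_def Ct_def adjoint_linear lin linC)
    have aM: "x \<bullet> Mt y = M x \<bullet> y" "x \<bullet> M't y = M' x \<bullet> y" "x \<bullet> Ct y = C x \<bullet> y" for x y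
      by (auto simp: M't_def Mt_def Ct_def adjoint_works lin linC)
    have Ct: "Ct v = Mt v - M't v" for v
      by (rule vector_eq_ldot[THEN iffD1]) (auto simp: aM inner_diff_right inner_diff_left C_def)
    have MtM't: "Mt (M't v) = v" for v
      by (rule vector_eq_ldot[THEN iffD1]) (auto simp: aM inv)
    \<comment> \<open>\<open>F\<close> is what the telescoping sum leaves over: M W M^T - W = (M^N
      (M^N)^T - 1) / N.\<close>
    define F where "F v = (1 / real N) *\<^sub>R (Mk N (?T N v) - v)" for v
    have lF: "linear F" unfolding F_def
      by (intro linear_compose_scale_right linear_compose_sub lkT) (simp add: linear_ident)
    have T0: "?T 0 v = v" for v
      by (rule vector_eq_ldot[THEN iffD1]) (simp add: adjoint_works lk Mk0)
    have TS: "?T (Suc k) v = ?T k (Mt v)" for k v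
      by (rule vector_eq_ldot[THEN iffD1]) (simp add: adjoint_works lk aM MkS(1))
    have MWM: "M (W (Mt v)) = W v + F v" for v
    proof -
      have "M (W (Mt v)) = (1 / real N) *\<^sub>R (\<Sum>k<N. Mk (Suc k) (?T (Suc k) v))"
        unfolding W_def TS by (simp add: linear_scale[OF lin(1)] linear_sum[OF lin(1)] MkS(1))
      also have "(\<Sum>k<N. Mk (Suc k) (?T (Suc k) v)) =
          (\<Sum>k<N. Mk k (?T k v)) + (Mk N (?T N v) - v)"
      proof -
        have "(\<Sum>k<N. Mk (Suc k) (?T (Suc k) v)) - (\<Sum>k<N. Mk k (?T k v)) =
            Mk N (?T N v) - Mk 0 (?T 0 v)"
          unfolding sum_subtractf[symmetric] by (rule sum_lessThan_telescope)
        then show ?thesis by (simp add: T0 Mk0 algebra_simps)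
      qed
      finally show ?thesis by (simp add: W_def F_def scaleR_add_right)
    qed
    \<comment> \<open>\<open>E\<close> collects the defects of M W = W M'^T + F M'^T and W M^T = M'
      W + M' F. The result is C W = E - W C^T, so \<open>C\<close> is skew for \<open>W\<close> up
      to \<open>E\<close>.\<close>
    define E where "E v = F (M't v) + M' (F v)" for v
    have lE: "linear E"
      unfolding E_def using linear_compose[OF lt(1) lF] linear_compose[OF lF lin(2)]
      by (intro linear_compose_add) (auto simp: o_def)
    have MW: "M (W v) = W (M't v) + F (M't v)" for v
      using MWM[of "M't v"] by (simp add: MtM't)
    have WMt: "W (Mt v) = M' (W v) + M' (F v)" for v
      using arg_cong[OF MWM[of v], of M'] by (simp add: inv linear_add[OF lin(2)])
    have CW: "C (W v) = E v - W (Ct v)" for v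
      unfolding C_def E_def Ct linear_diff[OF lW] MW WMt by (simp add: algebra_simps)
    have F: "norm (F v) \<le> (K * K + 1) * norm v / real N" for v
    proof -
      have "norm (Mk N (?T N v) - v) \<le> K * (K * norm v) + norm v"
        using bk(1)[of N "?T N v"] bT[of N v] \<open>K > 0\<close>
        by (intro order_trans[OF norm_triangle_ineq4] add_mono order_refl)
          (meson mult_left_mono less_imp_le order_trans)
      then show ?thesis unfolding F_def norm_scaleR using N by (simp add: field_simps)
    qed
    have M1: "norm (M v) \<le> K * norm v" "norm (M' v) \<le> K * norm v" for v
      using K(1)[of "Suc 0" v] K(2)[of "Suc 0" v] by (simp_all only: funpow.simps o_apply id_apply)
    have M't1: "norm (M't v) \<le> K * norm v" for v
      unfolding M't_def by (rule norm_adjoint_le[OF lin(2) M1(2)])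
    have E: "norm (E v) \<le> 2 * K * (K * K + 1) * norm v / real N" for v
    proof -
      have "norm (F (M't v)) \<le> (K * K + 1) * (K * norm v) / real N"
        by (rule order_trans[OF F]) (intro divide_right_mono mult_left_mono M't1, auto)
      moreover have "norm (M' (F v)) \<le> K * ((K * K + 1) * norm v / real N)"
        by (rule order_trans[OF M1(2)]) (use K(3) in \<open>intro mult_left_mono F, simp\<close>)
      moreover have "norm (E v) \<le> norm (F (M't v)) + norm (M' (F v))"
        unfolding E_def by (rule norm_triangle_ineq)
      moreover have "(K * K + 1) * (K * norm v) / real N + K * ((K * K + 1) * norm v / real N)
          = 2 * K * (K * K + 1) * norm v / real N"
        using N by (simp add: field_simps)
      ultimately show ?thesis by linarith
    qed
    have C1: "norm (C v) \<le> 2 * K * norm v" for v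
      using norm_triangle_ineq4[of "M v" "M' v"] M1[of v] unfolding C_def by linarith
    have CkC: "C (Mk k v) = Mk k (C v)" for k v
    proof -
      have swap: "M (Mk k v) = Mk k (M v)" for v by (simp only: MkS[symmetric])
      have "M' (Mk k v) = Mk k (M' v)"
        using swap[of "M' v"] inv by metis
      then show ?thesis by (simp add: C_def linear_diff[OF lk] swap)
    qed
    have t1: "tr (\<lambda>v. C (E (V v))) \<le> real (DIM('a)) * (2 * K) * (2 * K * (K * K + 1)) * (K * K) / real N"
    proof -
      have "tr (\<lambda>v. C (E (V v))) \<le> (\<Sum>b\<in>(Basis::'a set). (2 * K) * (2 * K * (K * K + 1)) * (K * K) / real N)"
        unfolding tr_def
      proof (rule sum_mono)
        fix b :: 'a assume b: "b \<in> Basis"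
        have "C (E (V b)) \<bullet> b \<le> norm (C (E (V b)))"
          using norm_cauchy_schwarz[of "C (E (V b))" b] b by simp
        also have "\<dots> \<le> 2 * K * norm (E (V b))" by (rule C1)
        also have "\<dots> \<le> 2 * K * (2 * K * (K * K + 1) * norm (V b) / real N)"
          using E[of "V b"] K by (intro mult_left_mono) auto
        also have "\<dots> \<le> 2 * K * (2 * K * (K * K + 1) * (K * K) / real N)"
          using Vle[of b] b K(3) by (intro mult_left_mono divide_right_mono) auto
        finally show "C (E (V b)) \<bullet> b \<le> (2 * K) * (2 * K * (K * K + 1)) * (K * K) / real N" by simp
      qed
      then show ?thesis by (simp add: mult.assoc mult.left_commute)
    qed
    \<comment> \<open>Each summand C M^k (M^k)^T C^T V is cycled under the trace into a sum of
      values of the form \<open>V\<close> at the vectors C M^k b. Since \<open>C\<close> commutes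
      with M^k, whose inverse is bounded by \<open>K\<close>, the K^6 of \<open>Vpos\<close> becomes
      K^8.\<close>
    have t2: "(\<Sum>b\<in>Basis. (norm (C b))\<^sup>2) / K ^ 8 \<le> tr (\<lambda>v. C (W (Ct (V v))))"
    proof -
      have "tr (\<lambda>v. C (W (Ct (V v)))) = tr (\<lambda>v. (1 / real N) *\<^sub>R (\<Sum>k<N. C (Mk k (?T k (Ct (V v))))))"
        by (simp add: W_def linear_scale[OF linC] linear_sum[OF linC])
      also have "\<dots> = (1 / real N) * (\<Sum>k<N. tr (\<lambda>v. C (Mk k (?T k (Ct (V v))))))"
        unfolding tr_scale tr_sum ..
      finally have eq: "tr (\<lambda>v. C (W (Ct (V v)))) = (1 / real N) * (\<Sum>k<N. tr (\<lambda>v. C (Mk k (?T k (Ct (V v))))))" .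
      have "(\<Sum>b\<in>Basis. (norm (C b))\<^sup>2) / K ^ 8 \<le> tr (\<lambda>v. C (Mk k (?T k (Ct (V v)))))" for k
      proof -
        have "tr (\<lambda>v. C (Mk k (?T k (Ct (V v))))) = tr (\<lambda>v. ?T k (Ct (V (C (Mk k v)))))"
          using tr_commute[of "\<lambda>v. C (Mk k v)" "\<lambda>v. ?T k (Ct (V v))"]
            linear_compose[OF lk linC] linear_compose[OF linear_compose[OF lV lt(3)] lT]
          by (simp add: o_def)
        also have "\<dots> = (\<Sum>b\<in>Basis. V (C (Mk k b)) \<bullet> C (Mk k b))"
          unfolding tr_def
        proof (rule sum.cong[OF refl])
          fix b :: 'a
          have "?T k (Ct (V (C (Mk k b)))) \<bullet> b = b \<bullet> ?T k (Ct (V (C (Mk k b))))" by (rule inner_commute)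
          also have "\<dots> = C (Mk k b) \<bullet> V (C (Mk k b))" by (simp only: adjoint_works[OF lk] aM)
          finally show "?T k (Ct (V (C (Mk k b)))) \<bullet> b = V (C (Mk k b)) \<bullet> C (Mk k b)"
            by (simp only: inner_commute)
        qed
        finally have eq: "tr (\<lambda>v. C (Mk k (?T k (Ct (V v))))) = (\<Sum>b\<in>Basis. V (C (Mk k b)) \<bullet> C (Mk k b))" .
        have "(norm (C b))\<^sup>2 / K ^ 8 \<le> V (C (Mk k b)) \<bullet> C (Mk k b)" for b
        proof -
          have "norm (C b) \<le> K * norm (Mk k (C b))" using bk(2)[of k "Mk k (C b)"] by (simp add: Mi_Mk)
          then have "(norm (C b))\<^sup>2 \<le> (K * norm (C (Mk k b)))\<^sup>2" unfolding CkC by (intro power_mono) auto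
          then have "(norm (C b))\<^sup>2 / K ^ 8 \<le> (norm (C (Mk k b)))\<^sup>2 / K ^ 6"
            using \<open>K > 0\<close> by (simp add: field_simps power_mult_distrib eval_nat_numeral)
          then show ?thesis using Vpos[of "C (Mk k b)"] by linarith
        qed
        then show ?thesis unfolding eq sum_divide_distrib by (intro sum_mono)
      qed
      then have "(\<Sum>k<N. (\<Sum>b\<in>Basis. (norm (C b))\<^sup>2) / K ^ 8) \<le> (\<Sum>k<N. tr (\<lambda>v. C (Mk k (?T k (Ct (V v))))))"
        by (intro sum_mono)
      then show ?thesis using N unfolding eq by (simp add: field_simps)
    qed
    \<comment> \<open>Insert 1 = W V and move the second \<open>C\<close> across
      \<open>W\<close>.\<close>
    have "tr (\<lambda>v. C (C v)) = tr (\<lambda>v. C (C (W (V v))))" by (simp add: WV)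
    also have "\<dots> = tr (\<lambda>v. C (E (V v)) - C (W (Ct (V v))))" by (simp add: CW linear_diff[OF linC])
    also have "\<dots> = tr (\<lambda>v. C (E (V v))) - tr (\<lambda>v. C (W (Ct (V v))))" by (rule tr_diff)
    finally show ?thesis using t1 t2 by linarith
  qed
  define Z where "Z = real (DIM('a)) * (2 * K) * (2 * K * (K * K + 1)) * (K * K)"
  have lim: "(\<lambda>N. - (\<Sum>b\<in>Basis. (norm (C b))\<^sup>2) / K ^ 8 + Z / real N) \<longlonglongrightarrow> - (\<Sum>b\<in>Basis. (norm (C b))\<^sup>2) / K ^ 8 + 0"
    by (intro tendsto_intros lim_const_over_n)
  have ev: "\<forall>\<^sub>F N in sequentially. tr (\<lambda>v. C (C v)) \<le> - (\<Sum>b\<in>Basis. (norm (C b))\<^sup>2) / K ^ 8 + Z / real N"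
    using eventually_gt_at_top[of 0] by eventually_elim (use main Z_def in simp)
  have "tr (\<lambda>v. C (C v)) \<le> - (\<Sum>b\<in>Basis. (norm (C b))\<^sup>2) / K ^ 8 + 0"
    by (rule tendsto_lowerbound[OF lim ev]) simp
  then show ?thesis by (simp only: add_0_right)
qed

text \<open>In finite dimension pointwise convergence of linear maps is locally uniform, so the
  argument may move together with the map. Expansion in \<open>Basis\<close> makes this
  explicit.\<close>

lemma tendsto_linear_apply:
  fixes L :: "'b \<Rightarrow> 'a::euclidean_space \<Rightarrow> 'a"
  assumes "\<And>n. linear (L n)" "linear l" "\<And>v. ((\<lambda>n. L n v) \<longlongrightarrow> l v) F" "(w \<longlongrightarrow> u) F"
  shows "((\<lambda>n. L n (w n)) \<longlongrightarrow> l u) F"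
proof -
  have eq: "(\<lambda>n. L n (w n)) = (\<lambda>n. \<Sum>b\<in>Basis. (w n \<bullet> b) *\<^sub>R L n b)" "l u = (\<Sum>b\<in>Basis. (u \<bullet> b) *\<^sub>R l b)"
    by (rule ext, rule linear_sum_Basis[OF assms(1)]) (rule linear_sum_Basis[OF assms(2)])
  have "((\<lambda>n. \<Sum>b\<in>Basis. (w n \<bullet> b) *\<^sub>R L n b) \<longlongrightarrow> (\<Sum>b\<in>Basis. (u \<bullet> b) *\<^sub>R l b)) F"
    by (intro tendsto_intros assms)
  then show ?thesis unfolding eq .
qed

text \<open>The symmetric difference quotients (M - M^-1) / (2 h) converge to the generator
  \<open>A\<close>. The estimate for power-bounded operators is homogeneous of degree 2 in M - M^-1,
  so it survives the division by (2 h)^2 and the passage to the limit.\<close>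

lemma tr_square_generator:
  fixes M M' :: "nat \<Rightarrow> 'a::euclidean_space \<Rightarrow> 'a"
  assumes lin: "\<And>n. linear (M n)" "\<And>n. linear (M' n)" "linear A"
    and inv: "\<And>n v. M n (M' n v) = v" "\<And>n v. M' n (M n v) = v"
    and K: "\<And>n k v. norm ((M n ^^ k) v) \<le> K * norm v" "\<And>n k v. norm ((M' n ^^ k) v) \<le> K * norm v" "K > 0"
    and h: "\<And>n. h n > 0" "h \<longlonglongrightarrow> 0"
    and A: "\<And>v. (\<lambda>n. (1 / h n) *\<^sub>R (M n v - v)) \<longlonglongrightarrow> A v"
  shows "tr (\<lambda>v. A (A v)) \<le> - (\<Sum>b\<in>Basis. (norm (A b))\<^sup>2) / K ^ 8"
proof -
  define C where "C n v = M n v - M' n v" for n v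
  define c where "c n v = (1 / (2 * h n)) *\<^sub>R C n v" for n v
  have M: "(\<lambda>n. M n v) \<longlonglongrightarrow> v" for v
  proof -
    have "(\<lambda>n. h n *\<^sub>R ((1 / h n) *\<^sub>R (M n v - v)) + v) \<longlonglongrightarrow> 0 *\<^sub>R A v + v"
      by (intro tendsto_intros h A)
    moreover have "h n *\<^sub>R ((1 / h n) *\<^sub>R (M n v - v)) + v = M n v" for n using h(1)[of n] by simp
    ultimately show ?thesis by simp
  qed
  \<comment> \<open>M' w - u = M' (w - M u), and the inverses are uniformly bounded.\<close>
  have M': "(\<lambda>n. M' n (w n)) \<longlonglongrightarrow> u" if w: "w \<longlonglongrightarrow> u" for w u
  proof -
    have "(\<lambda>n. K * norm (w n - M n u)) \<longlonglongrightarrow> K * norm (u - u)" by (intro tendsto_intros w M)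
    then have lim: "(\<lambda>n. K * norm (w n - M n u)) \<longlonglongrightarrow> 0" by simp
    have le: "norm (M' n (w n) - u) \<le> K * norm (w n - M n u)" for n
      using K(2)[of 1 n "w n - M n u"] by (simp add: linear_diff[OF lin(2)] inv)
    have "(\<lambda>n. M' n (w n) - u) \<longlonglongrightarrow> 0"
      by (rule Lim_null_comparison[OF _ lim]) (simp add: le)
    then show ?thesis by (simp add: LIM_zero_iff)
  qed
  have lc: "linear (c n)" for n
    unfolding c_def C_def using lin by (intro linear_compose_scale_right linear_compose_sub)
  have c: "(\<lambda>n. c n v) \<longlonglongrightarrow> A v" for v
  proof -
    have "(\<lambda>n. (1/2) *\<^sub>R ((1 / h n) *\<^sub>R (M n v - v) + M' n ((1 / h n) *\<^sub>R (M n v - v)))) \<longlonglongrightarrow> (1/2) *\<^sub>R (A v + A v)"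
      by (intro tendsto_intros A M')
    moreover have "(1/2) *\<^sub>R ((1 / h n) *\<^sub>R (M n v - v) + M' n ((1 / h n) *\<^sub>R (M n v - v))) = c n v" for n
      by (simp add: c_def C_def linear_scale[OF lin(2)] linear_diff[OF lin(2)] inv algebra_simps)
    moreover have "(1/2) *\<^sub>R (A v + A v) = A v" by (simp add: scaleR_half_double)
    ultimately show ?thesis by simp
  qed
  have le: "tr (\<lambda>v. c n (c n v)) \<le> - (\<Sum>b\<in>Basis. (norm (c n b))\<^sup>2) / K ^ 8" for n
  proof -
    have 1: "tr (\<lambda>v. C n (C n v)) \<le> - (\<Sum>b\<in>Basis. (norm (C n b))\<^sup>2) / K ^ 8"
      unfolding C_def by (rule tr_square_power_bounded) (use lin inv K in auto)
    have lC: "linear (C n)" unfolding C_def[abs_def] using lin by (intro linear_compose_sub)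
    define r where "r = (1 / (2 * h n))\<^sup>2"
    have "tr (\<lambda>v. c n (c n v)) = tr (\<lambda>v. r *\<^sub>R C n (C n v))"
      by (simp add: c_def linear_scale[OF lC] r_def power2_eq_square)
    then have 2: "tr (\<lambda>v. c n (c n v)) = r * tr (\<lambda>v. C n (C n v))" by (simp add: tr_scale)
    have 3: "(\<Sum>b\<in>Basis. (norm (c n b))\<^sup>2) = r * (\<Sum>b\<in>Basis. (norm (C n b))\<^sup>2)"
      by (simp add: c_def sum_distrib_left r_def power_mult_distrib power_divide)
    have "r \<ge> 0" by (simp add: r_def)
    from mult_left_mono[OF 1 this] show ?thesis unfolding 2 3 by simp
  qed
  have cc: "(\<lambda>n. c n (c n v)) \<longlonglongrightarrow> A (A v)" for v
    by (rule tendsto_linear_apply[OF lc lin(3) c c])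
  have 1: "(\<lambda>n. tr (\<lambda>v. c n (c n v))) \<longlonglongrightarrow> tr (\<lambda>v. A (A v))"
    unfolding tr_def by (intro tendsto_sum tendsto_inner tendsto_const cc)
  have 2: "(\<lambda>n. - (\<Sum>b\<in>Basis. (norm (c n b))\<^sup>2) / K ^ 8) \<longlonglongrightarrow> - (\<Sum>b\<in>Basis. (norm (A b))\<^sup>2) / K ^ 8"
    by (intro tendsto_divide tendsto_minus tendsto_sum tendsto_power tendsto_norm tendsto_const c) (use K(3) in simp)
  show ?thesis by (rule LIMSEQ_le[OF 1 2]) (use le in blast)
qed

section \<open>Multiplication in charts and the adjoint representation\<close>

locale compact_lie_group = group G
  for G :: "('g::{t2_space,second_countable_topology}, 'm) monoid_scheme" (structure) +
  fixes A :: "('g, 'e::euclidean_space) chart set" and D :: "'g set" and \<phi> :: "'g \<Rightarrow> 'e"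
  assumes lie: "lie_group G A" and compact_carrier: "compact (carrier G)"
    and chart: "(D, \<phi>) \<in> A" and one_in_D: "\<one> \<in> D"
begin

abbreviation "\<psi> \<equiv> inv_into D \<phi>"
abbreviation "e \<equiv> \<phi> \<one>"

lemma chart_facts:
  assumes "(E, \<kappa>) \<in> A"
  shows "openin (top_of_set (carrier G)) E" "open (\<kappa> ` E)"
    "homeomorphism E (\<kappa> ` E) \<kappa> (inv_into E \<kappa>)" "E \<subseteq> carrier G" "inj_on \<kappa> E"
    "continuous_on E \<kappa>" "continuous_on (\<kappa> ` E) (inv_into E \<kappa>)"
proof -
  have sm: "smooth_manifold (carrier G) A" using lie by (simp add: lie_group_def)
  then show 1: "openin (top_of_set (carrier G)) E" "open (\<kappa> ` E)"
    and h: "homeomorphism E (\<kappa> ` E) \<kappa> (inv_into E \<kappa>)"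
    using assms unfolding smooth_manifold_def by blast+
  show "E \<subseteq> carrier G" using 1(1) openin_imp_subset by blast
  show "inj_on \<kappa> E" using h unfolding homeomorphism_def by (metis inj_onI)
  show "continuous_on E \<kappa>" "continuous_on (\<kappa> ` E) (inv_into E \<kappa>)"
    using h by (auto simp: homeomorphism_def)
qed

lemma chart_cover:
  assumes "a \<in> carrier G" obtains E \<kappa> where "(E, \<kappa>) \<in> A" "a \<in> E"
  using assms lie unfolding lie_group_def smooth_manifold_def by blast

lemma D_carrier [intro, simp]: "x \<in> D \<Longrightarrow> x \<in> carrier G"
  using chart_facts(4)[OF chart] by blast

lemma psi_phi [simp]: "x \<in> D \<Longrightarrow> \<psi> (\<phi> x) = x"
  using chart_facts(5)[OF chart] by simp

lemma phi_psi [simp]: "x \<in> \<phi> ` D \<Longrightarrow> \<phi> (\<psi> x) = x"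
  by (simp add: f_inv_into_f)

lemma psi_in [intro, simp]: "x \<in> \<phi> ` D \<Longrightarrow> \<psi> x \<in> D"
  by (simp add: inv_into_into)

lemma open_phi_D: "open (\<phi> ` D)" using chart_facts(2)[OF chart] .

lemma continuous_mult: "continuous_on (carrier G \<times> carrier G) (\<lambda>(x, y). x \<otimes> y)"
  using lie by (simp add: lie_group_def smooth_map_def)

lemma continuous_inv: "continuous_on (carrier G) (\<lambda>x. inv x)"
  using lie by (simp add: lie_group_def smooth_map_def)

lemma tendsto_mult_carrier:
  assumes "(f \<longlongrightarrow> a) F" "(h \<longlongrightarrow> b) F" "a \<in> carrier G" "b \<in> carrier G"
    and "\<forall>\<^sub>F x in F. f x \<in> carrier G" "\<forall>\<^sub>F x in F. h x \<in> carrier G"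
  shows "((\<lambda>x. f x \<otimes> h x) \<longlongrightarrow> a \<otimes> b) F"
proof -
  have "((\<lambda>x. (case (f x, h x) of (x, y) \<Rightarrow> x \<otimes> y)) \<longlongrightarrow> (case (a, b) of (x, y) \<Rightarrow> x \<otimes> y)) F"
    by (rule continuous_on_tendsto_compose[OF continuous_mult])
      (use assms in \<open>auto intro: tendsto_Pair elim: eventually_elim2\<close>)
  then show ?thesis by simp
qed

lemma tendsto_inv_carrier:
  assumes "(f \<longlongrightarrow> a) F" "a \<in> carrier G" "\<forall>\<^sub>F x in F. f x \<in> carrier G"
  shows "((\<lambda>x. inv (f x)) \<longlongrightarrow> inv a) F"
  using continuous_on_tendsto_compose[OF continuous_inv assms] .

text \<open>A chart domain is open only relative to \<open>carrier G\<close>; hence the separate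
  condition that the values eventually lie in the carrier.\<close>

lemma eventually_chart:
  assumes "(E, \<kappa>) \<in> A" "(f \<longlongrightarrow> a) F" "a \<in> E" "\<forall>\<^sub>F x in F. f x \<in> carrier G"
  shows "\<forall>\<^sub>F x in F. f x \<in> E"
proof -
  obtain O' where O': "open O'" "E = carrier G \<inter> O'"
    using chart_facts(1)[OF assms(1)] by (auto simp: openin_open)
  then have "\<forall>\<^sub>F x in F. f x \<in> O'" using assms topological_tendstoD by blast
  then show ?thesis using assms(4) O'(2) by (auto elim: eventually_elim2)
qed

lemma tendsto_chart:
  assumes "(E, \<kappa>) \<in> A" "(f \<longlongrightarrow> a) F" "a \<in> E" "\<forall>\<^sub>F x in F. f x \<in> carrier G"
  shows "((\<lambda>x. \<kappa> (f x)) \<longlongrightarrow> \<kappa> a) F"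
  using continuous_on_tendsto_compose[OF chart_facts(6)[OF assms(1)] assms(2,3) eventually_chart[OF assms]] .

lemma tendsto_psi:
  assumes "(f \<longlongrightarrow> x) F" "x \<in> \<phi> ` D"
  shows "((\<lambda>y. \<psi> (f y)) \<longlongrightarrow> \<psi> x) F"
  using continuous_on_tendsto_compose[OF chart_facts(7)[OF chart] assms] topological_tendstoD[OF assms(1) open_phi_D assms(2)] .

text \<open>Three charts, two for the factors and one for the product, because translations by
  arbitrary group elements leave the chart at the identity.\<close>

definition mult_dom :: "('g, 'e) chart \<Rightarrow> ('g, 'e) chart \<Rightarrow> ('g, 'e) chart \<Rightarrow> ('e \<times> 'e) set" where
  "mult_dom c1 c2 c3 = {(x, y). x \<in> snd c1 ` fst c1 \<and> y \<in> snd c2 ` fst c2 \<and>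
     inv_into (fst c1) (snd c1) x \<otimes> inv_into (fst c2) (snd c2) y \<in> fst c3}"

definition mult_chart :: "('g, 'e) chart \<Rightarrow> ('g, 'e) chart \<Rightarrow> ('g, 'e) chart \<Rightarrow> 'e \<times> 'e \<Rightarrow> 'e" where
  "mult_chart c1 c2 c3 = (\<lambda>(x, y). snd c3 (inv_into (fst c1) (snd c1) x \<otimes> inv_into (fst c2) (snd c2) y))"

lemma mult_chart_smooth:
  assumes "c1 \<in> A" "c2 \<in> A" "c3 \<in> A"
  shows "open (mult_dom c1 c2 c3)" "smooth_on (mult_dom c1 c2 c3) (mult_chart c1 c2 c3)"
proof -
  obtain D1 \<phi>1 D2 \<phi>2 D3 \<phi>3 where c: "c1 = (D1, \<phi>1)" "c2 = (D2, \<phi>2)" "c3 = (D3, \<phi>3)"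
    by (metis surj_pair)
  note f1 = chart_facts[OF assms(1)[unfolded c]] and f2 = chart_facts[OF assms(2)[unfolded c]]
    and f3 = chart_facts[OF assms(3)[unfolded c]]
  obtain O' where O': "open O'" "D3 = carrier G \<inter> O'" using f3(1) by (auto simp: openin_open)
  define S where "S = \<phi>1 ` D1 \<times> \<phi>2 ` D2"
  have i1: "inv_into D1 \<phi>1 x \<in> carrier G" if "x \<in> \<phi>1 ` D1" for x
    using f1(4) inv_into_into[OF that] by blast
  have i2: "inv_into D2 \<phi>2 x \<in> carrier G" if "x \<in> \<phi>2 ` D2" for x
    using f2(4) inv_into_into[OF that] by blast
  have "continuous_on S (\<lambda>p. (inv_into D1 \<phi>1 (fst p), inv_into D2 \<phi>2 (snd p)))"
    unfolding S_def
    by (auto intro!: continuous_on_Pair continuous_on_compose2[OF f1(7)] continuous_on_compose2[OF f2(7)]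
        continuous_on_fst continuous_on_snd continuous_on_id)
  then have "continuous_on S (\<lambda>p. (\<lambda>(x, y). x \<otimes> y) (inv_into D1 \<phi>1 (fst p), inv_into D2 \<phi>2 (snd p)))"
    by (rule continuous_on_compose2[OF continuous_mult]) (auto simp: S_def intro!: i1 i2)
  then have "open (S \<inter> (\<lambda>p. (\<lambda>(x, y). x \<otimes> y) (inv_into D1 \<phi>1 (fst p), inv_into D2 \<phi>2 (snd p))) -` O')"
    by (rule continuous_open_preimage) (auto simp: S_def O' intro!: open_Times f1 f2)
  also have "\<dots> = mult_dom c1 c2 c3"
    using i1 i2 by (auto simp: mult_dom_def c S_def O')
  finally show op: "open (mult_dom c1 c2 c3)" .
  \<comment> \<open>The coordinate form provided by \<open>smooth_map\<close> inverts the product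
    chart as a whole; on the domain this is the pair of separate inverses that
    \<open>mult_chart\<close> uses.\<close>
  let ?f = "\<phi>3 \<circ> (\<lambda>(x, y). x \<otimes> y) \<circ> inv_into (D1 \<times> D2) (map_prod \<phi>1 \<phi>2)"
  have inj: "inj_on (map_prod \<phi>1 \<phi>2) (D1 \<times> D2)" using f1(5) f2(5) by (auto simp: inj_on_def)
  have iv: "inv_into (D1 \<times> D2) (map_prod \<phi>1 \<phi>2) (x, y) = (inv_into D1 \<phi>1 x, inv_into D2 \<phi>2 y)"
    if "x \<in> \<phi>1 ` D1" "y \<in> \<phi>2 ` D2" for x y
    by (rule inv_into_f_eq[OF inj]) (use that in \<open>auto simp: inv_into_into f_inv_into_f\<close>)
  have eq: "map_prod \<phi>1 \<phi>2 ` (D1 \<times> D2 \<inter> (\<lambda>(x, y). x \<otimes> y) -` D3) = mult_dom c1 c2 c3"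
  proof (rule subset_antisym; rule subsetI)
    fix p assume "p \<in> map_prod \<phi>1 \<phi>2 ` (D1 \<times> D2 \<inter> (\<lambda>(x, y). x \<otimes> y) -` D3)"
    then show "p \<in> mult_dom c1 c2 c3"
      using f1(5) f2(5) by (auto simp: mult_dom_def c)
  next
    fix p assume p: "p \<in> mult_dom c1 c2 c3"
    then have "p = map_prod \<phi>1 \<phi>2 (inv_into D1 \<phi>1 (fst p), inv_into D2 \<phi>2 (snd p))"
      by (auto simp: mult_dom_def c f_inv_into_f)
    moreover have "(inv_into D1 \<phi>1 (fst p), inv_into D2 \<phi>2 (snd p)) \<in> D1 \<times> D2 \<inter> (\<lambda>(x, y). x \<otimes> y) -` D3"
      using p by (auto simp: mult_dom_def c inv_into_into)
    ultimately show "p \<in> map_prod \<phi>1 \<phi>2 ` (D1 \<times> D2 \<inter> (\<lambda>(x, y). x \<otimes> y) -` D3)" by blast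
  qed
  have "(D1 \<times> D2, map_prod \<phi>1 \<phi>2) \<in> product_atlas A A"
    using assms c by (auto simp: product_atlas_def)
  then have "smooth_on (mult_dom c1 c2 c3) ?f"
    using lie assms(3) eq unfolding lie_group_def smooth_map_def c by fastforce
  moreover have "?f p = mult_chart c1 c2 c3 p" if "p \<in> mult_dom c1 c2 c3" for p
    using that by (auto simp: mult_dom_def mult_chart_def c iv)
  ultimately show "smooth_on (mult_dom c1 c2 c3) (mult_chart c1 c2 c3)"
    unfolding smooth_on_def using Ck_on_cong[OF op] by blast
qed

lemma mult_chart_has_derivative:
  assumes "c1 \<in> A" "c2 \<in> A" "c3 \<in> A" "p \<in> mult_dom c1 c2 c3"
  shows "(mult_chart c1 c2 c3 has_derivative frechet_derivative (mult_chart c1 c2 c3) (at p)) (at p)"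
proof -
  have "Ck_on (Suc 0) (mult_dom c1 c2 c3) (mult_chart c1 c2 c3)"
    using mult_chart_smooth(2)[OF assms(1-3)] by (auto simp: smooth_on_def)
  then show ?thesis using assms(4) by (simp add: frechet_derivative_works)
qed

lemma e_in [simp, intro]: "e \<in> \<phi> ` D" using one_in_D by blast

lemma psi_e [simp]: "\<psi> e = \<one>" using one_in_D by simp

lemma eventually_phi_D: "\<forall>\<^sub>F x in nhds e. x \<in> \<phi> ` D"
  using open_phi_D e_in eventually_nhds by blast

lemma tendsto_translate:
  assumes "a \<in> carrier G" "b \<in> carrier G"
  shows "((\<lambda>x. a \<otimes> \<psi> x \<otimes> b) \<longlongrightarrow> a \<otimes> b) (nhds e)"
    "\<forall>\<^sub>F x in nhds e. a \<otimes> \<psi> x \<in> carrier G \<and> a \<otimes> \<psi> x \<otimes> b \<in> carrier G"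
    "((\<lambda>x. a \<otimes> \<psi> x) \<longlongrightarrow> a) (nhds e)"
proof -
  have 0: "\<forall>\<^sub>F x in nhds e. \<psi> x \<in> carrier G"
    using eventually_phi_D by (auto elim!: eventually_mono)
  have 1: "(\<psi> \<longlongrightarrow> \<one>) (nhds e)" using tendsto_psi[OF filterlim_ident e_in] by simp
  have 2: "((\<lambda>x. a \<otimes> \<psi> x) \<longlongrightarrow> a \<otimes> \<one>) (nhds e)"
    by (rule tendsto_mult_carrier[OF _ 1]) (use assms 0 in auto)
  then show "((\<lambda>x. a \<otimes> \<psi> x) \<longlongrightarrow> a) (nhds e)" using assms by simp
  show 4: "\<forall>\<^sub>F x in nhds e. a \<otimes> \<psi> x \<in> carrier G \<and> a \<otimes> \<psi> x \<otimes> b \<in> carrier G"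
    using 0 by eventually_elim (use assms in auto)
  have "((\<lambda>x. a \<otimes> \<psi> x \<otimes> b) \<longlongrightarrow> (a \<otimes> \<one>) \<otimes> b) (nhds e)"
    by (rule tendsto_mult_carrier[OF 2]) (use assms 4 in \<open>auto elim: eventually_mono\<close>)
  then show "((\<lambda>x. a \<otimes> \<psi> x \<otimes> b) \<longlongrightarrow> a \<otimes> b) (nhds e)" using assms by simp
qed

text \<open>\<open>a\<close> and \<open>b\<close> need not lie in \<open>D\<close>. Left translation
  is read from \<open>D\<close> into a chart around \<open>a\<close>, and right translation by
  \<open>b\<close> from that chart back into \<open>D\<close>, with a further chart around
  \<open>b\<close> for the second factor.\<close>

lemma translate_differentiable:
  assumes a: "a \<in> carrier G" and b: "b \<in> carrier G" and ab: "a \<otimes> b \<in> D"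
  shows "(\<lambda>x. \<phi> (a \<otimes> \<psi> x \<otimes> b)) differentiable (at e)"
proof -
  obtain E \<kappa> where E: "(E, \<kappa>) \<in> A" "a \<in> E" using chart_cover[OF a] .
  obtain F \<theta> where F: "(F, \<theta>) \<in> A" "b \<in> F" using chart_cover[OF b] .
  note fE = chart_facts[OF E(1)] and fF = chart_facts[OF F(1)]
  have iE: "inv_into E \<kappa> (\<kappa> x) = x" if "x \<in> E" for x using that fE(5) by simp
  have iF: "inv_into F \<theta> (\<theta> b) = b" using F fF(5) by simp
  let ?m1 = "mult_chart (E, \<kappa>) (D, \<phi>) (E, \<kappa>)" and ?m2 = "mult_chart (E, \<kappa>) (F, \<theta>) (D, \<phi>)"
  have p1: "(\<kappa> a, e) \<in> mult_dom (E, \<kappa>) (D, \<phi>) (E, \<kappa>)"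
    using E a by (auto simp: mult_dom_def iE)
  have p2: "(\<kappa> a, \<theta> b) \<in> mult_dom (E, \<kappa>) (F, \<theta>) (D, \<phi>)"
    using E F ab by (auto simp: mult_dom_def iE iF)
  have d1: "?m1 differentiable (at (\<kappa> a, e))"
    using mult_chart_has_derivative[OF E(1) chart E(1) p1] by (auto simp: differentiable_def)
  have d2: "?m2 differentiable (at (\<kappa> a, \<theta> b))"
    using mult_chart_has_derivative[OF E(1) F(1) chart p2] by (auto simp: differentiable_def)
  have 1: "(\<lambda>x. ?m1 (\<kappa> a, x)) differentiable (at e)"
    by (rule differentiable_compose[of ?m1 "\<lambda>x. (\<kappa> a, x)", OF d1]) (auto intro!: derivative_intros)
  have 2: "(\<lambda>z. ?m2 (z, \<theta> b)) differentiable (at (\<kappa> a))"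
    by (rule differentiable_compose[of ?m2 "\<lambda>z. (z, \<theta> b)", OF d2]) (auto intro!: derivative_intros)
  have m1e: "?m1 (\<kappa> a, e) = \<kappa> a" using E a by (simp add: mult_chart_def iE)
  have 3: "(\<lambda>x. ?m2 (?m1 (\<kappa> a, x), \<theta> b)) differentiable (at e)"
    by (rule differentiable_compose[of "\<lambda>z. ?m2 (z, \<theta> b)" "\<lambda>x. ?m1 (\<kappa> a, x)", OF _ 1]) (use 2 m1e in simp)
  then obtain f' where f': "((\<lambda>x. ?m2 (?m1 (\<kappa> a, x), \<theta> b)) has_derivative f') (at e)"
    by (auto simp: differentiable_def)
  have "\<forall>\<^sub>F x in nhds e. a \<otimes> \<psi> x \<in> E"
    by (rule eventually_chart[OF E(1) tendsto_translate(3)[OF a b] E(2)])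
      (use tendsto_translate(2)[OF a b] in \<open>auto elim: eventually_mono\<close>)
  then have "\<forall>\<^sub>F x in nhds e. ?m2 (?m1 (\<kappa> a, x), \<theta> b) = \<phi> (a \<otimes> \<psi> x \<otimes> b)"
    using eventually_phi_D by eventually_elim (use E F a in \<open>simp add: mult_chart_def iE iF\<close>)
  then have "((\<lambda>x. \<phi> (a \<otimes> \<psi> x \<otimes> b)) has_derivative f') (at e)"
    using has_derivative_transform_eventually[OF f', of "\<lambda>x. \<phi> (a \<otimes> \<psi> x \<otimes> b)"]
    by (simp add: eventually_nhds_conv_at)
  then show ?thesis by (auto simp: differentiable_def)
qed

section \<open>The adjoint representation\<close>

definition Ad :: "'g \<Rightarrow> 'e \<Rightarrow> 'e" where "Ad = Ad_chart G (D, \<phi>)"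

definition br :: "'e \<Rightarrow> 'e \<Rightarrow> 'e" where "br = lie_bracket G (D, \<phi>)"

lemma conj_has_derivative:
  assumes a: "a \<in> carrier G"
  shows "((\<lambda>x. \<phi> (a \<otimes> \<psi> x \<otimes> inv a)) has_derivative Ad a) (at e)"
  using translate_differentiable[of a "inv a"] a one_in_D
  by (simp add: Ad_def Ad_chart_def frechet_derivative_works)

lemma linear_Ad: "a \<in> carrier G \<Longrightarrow> linear (Ad a)"
  using conj_has_derivative has_derivative_linear by blast

lemma eventually_conj_D:
  assumes a: "a \<in> carrier G"
  shows "\<forall>\<^sub>F x in nhds e. x \<in> \<phi> ` D \<and> a \<otimes> \<psi> x \<otimes> inv a \<in> D"
proof -
  have "\<forall>\<^sub>F x in nhds e. a \<otimes> \<psi> x \<otimes> inv a \<in> D"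
    by (rule eventually_chart[OF chart tendsto_translate(1)[of a "inv a"]])
      (use a one_in_D tendsto_translate(2)[of a "inv a"] in \<open>auto elim: eventually_mono\<close>)
  then show ?thesis using eventually_phi_D by eventually_elim auto
qed

lemma Ad_one: "Ad \<one> v = v"
proof -
  have "\<forall>\<^sub>F x in nhds e. \<phi> (\<one> \<otimes> \<psi> x \<otimes> inv \<one>) = x"
    using eventually_phi_D by eventually_elim simp
  then have "((\<lambda>x. x) has_derivative Ad \<one>) (at e)"
    using has_derivative_transform_eventually[OF conj_has_derivative[OF one_closed], of "\<lambda>x. x"]
    by (simp add: eventually_nhds_conv_at)
  then have "Ad \<one> = (\<lambda>x. x)" using has_derivative_ident has_derivative_unique by blast
  then show ?thesis by simp
qed

lemma Ad_mult:
  assumes a: "a \<in> carrier G" and b: "b \<in> carrier G"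
  shows "Ad (a \<otimes> b) v = Ad a (Ad b v)"
proof -
  have 1: "((\<lambda>x. \<phi> (a \<otimes> \<psi> (\<phi> (b \<otimes> \<psi> x \<otimes> inv b)) \<otimes> inv a)) has_derivative (\<lambda>v. Ad a (Ad b v))) (at e)"
    using has_derivative_compose[of "\<lambda>x. \<phi> (b \<otimes> \<psi> x \<otimes> inv b)", OF conj_has_derivative[OF b],
        of "\<lambda>x. \<phi> (a \<otimes> \<psi> x \<otimes> inv a)" "Ad a"] conj_has_derivative[OF a] b by simp
  have "\<forall>\<^sub>F x in nhds e. \<phi> (a \<otimes> \<psi> (\<phi> (b \<otimes> \<psi> x \<otimes> inv b)) \<otimes> inv a)
      = \<phi> (a \<otimes> b \<otimes> \<psi> x \<otimes> inv (a \<otimes> b))"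
    using eventually_conj_D[OF b]
  proof eventually_elim
    case (elim x)
    have "\<psi> (\<phi> (b \<otimes> \<psi> x \<otimes> inv b)) = b \<otimes> \<psi> x \<otimes> inv b" using elim by simp
    then show ?case using a b elim by (simp add: inv_mult_group m_assoc)
  qed
  then have "((\<lambda>x. \<phi> (a \<otimes> b \<otimes> \<psi> x \<otimes> inv (a \<otimes> b))) has_derivative (\<lambda>v. Ad a (Ad b v))) (at e)"
    using has_derivative_transform_eventually[OF 1, of "\<lambda>x. \<phi> (a \<otimes> b \<otimes> \<psi> x \<otimes> inv (a \<otimes> b))"] a b
    by (simp add: eventually_nhds_conv_at)
  then show ?thesis
    using conj_has_derivative[of "a \<otimes> b"] a b has_derivative_unique by (metis m_closed)
qed

lemma Ad_inv:
  assumes "a \<in> carrier G"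
  shows "Ad a (Ad (inv a) v) = v" "Ad (inv a) (Ad a v) = v"
  using Ad_mult[of a "inv a" v] Ad_mult[of "inv a" a v] assms by (simp_all add: Ad_one)

section \<open>The bracket through second derivatives of the product\<close>

abbreviation "mu \<equiv> mult_chart (D, \<phi>) (D, \<phi>) (D, \<phi>)"
abbreviation "\<Omega> \<equiv> mult_dom (D, \<phi>) (D, \<phi>) (D, \<phi>)"

lemmas mu_def = mult_chart_def[of "(D, \<phi>)" "(D, \<phi>)" "(D, \<phi>)", simplified]

lemma Omega_iff: "(x, y) \<in> \<Omega> \<longleftrightarrow> x \<in> \<phi> ` D \<and> y \<in> \<phi> ` D \<and> \<psi> x \<otimes> \<psi> y \<in> D"
  by (auto simp: mult_dom_def)

lemma open_Omega: "open \<Omega>" and mu_smooth: "Ck_on k \<Omega> mu"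
  using mult_chart_smooth[OF chart chart chart] by (auto simp: smooth_on_def)

abbreviation Dmu :: "'e \<times> 'e \<Rightarrow> 'e \<times> 'e \<Rightarrow> 'e" where "Dmu p \<equiv> frechet_derivative mu (at p)"
abbreviation "DDmu p v \<equiv> frechet_derivative (\<lambda>p. Dmu p v) (at p)"

lemma Dmu: "p \<in> \<Omega> \<Longrightarrow> (mu has_derivative Dmu p) (at p)"
  by (rule mult_chart_has_derivative[OF chart chart chart])

lemma DDmu: "p \<in> \<Omega> \<Longrightarrow> ((\<lambda>p. Dmu p v) has_derivative DDmu p v) (at p)"
  unfolding frechet_derivative_works[symmetric] using mu_smooth[of "Suc (Suc 0)"] by (cases v) simp

lemma mu_e [simp]: "x \<in> \<phi> ` D \<Longrightarrow> mu (x, e) = x" "x \<in> \<phi> ` D \<Longrightarrow> mu (e, x) = x"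
  by (simp_all add: mu_def)

lemma Omega_e [simp, intro]: "x \<in> \<phi> ` D \<Longrightarrow> (x, e) \<in> \<Omega>" "x \<in> \<phi> ` D \<Longrightarrow> (e, x) \<in> \<Omega>"
  by (auto simp: Omega_iff)

lemma Dmu_e: "Dmu (e, e) (v, 0) = v" "Dmu (e, e) (0, v) = v"
proof -
  have 1: "((\<lambda>x. mu (x, e)) has_derivative (\<lambda>v. Dmu (e, e) (v, 0))) (at e)"
    by (rule has_derivative_compose[of "\<lambda>x. (x, e)" "\<lambda>v. (v, 0)", OF _ Dmu])
      (auto intro!: derivative_eq_intros)
  have 2: "((\<lambda>x. mu (e, x)) has_derivative (\<lambda>v. Dmu (e, e) (0, v))) (at e)"
    by (rule has_derivative_compose[of "\<lambda>x. (e, x)" "\<lambda>v. (0, v)", OF _ Dmu])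
      (auto intro!: derivative_eq_intros)
  have "((\<lambda>x. x) has_derivative (\<lambda>v. Dmu (e, e) (v, 0))) (at e)"
    by (rule has_derivative_transform_within_open[OF 1 open_phi_D e_in]) simp
  moreover have "((\<lambda>x. x) has_derivative (\<lambda>v. Dmu (e, e) (0, v))) (at e)"
    by (rule has_derivative_transform_within_open[OF 2 open_phi_D e_in]) simp
  ultimately show "Dmu (e, e) (v, 0) = v" "Dmu (e, e) (0, v) = v"
    using has_derivative_unique[OF has_derivative_ident] by metis+
qed

text \<open>The identity \<open>(a y a\<^sup>-\<^sup>1) a = a y\<close>, differentiated in \<open>y\<close>, gives \<open>Ad\<close> in terms of the first
  derivatives of the product without differentiating the inverse.\<close>

lemma Dmu_Ad:
  assumes x: "x \<in> \<phi> ` D"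
  shows "Dmu (e, x) (Ad (\<psi> x) v, 0) = Dmu (x, e) (0, v)"
proof -
  let ?a = "\<psi> x"
  have a: "?a \<in> carrier G" using x by blast
  have 1: "((\<lambda>y. mu (\<phi> (?a \<otimes> \<psi> y \<otimes> inv ?a), x)) has_derivative (\<lambda>v. Dmu (e, x) (Ad ?a v, 0))) (at e)"
  proof (rule has_derivative_compose[of "\<lambda>y. (\<phi> (?a \<otimes> \<psi> y \<otimes> inv ?a), x)" "\<lambda>v. (Ad ?a v, 0)"])
    show "((\<lambda>y. (\<phi> (?a \<otimes> \<psi> y \<otimes> inv ?a), x)) has_derivative (\<lambda>v. (Ad ?a v, 0))) (at e)"
      by (intro has_derivative_Pair conj_has_derivative a has_derivative_const)
    show "(mu has_derivative Dmu (e, x)) (at (\<phi> (?a \<otimes> \<psi> e \<otimes> inv ?a), x))"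
      using a x by (simp add: Dmu)
  qed
  have 2: "((\<lambda>y. mu (x, y)) has_derivative (\<lambda>v. Dmu (x, e) (0, v))) (at e)"
    by (rule has_derivative_compose[of "\<lambda>y. (x, y)" "\<lambda>v. (0, v)", OF _ Dmu])
      (use x in \<open>auto intro!: derivative_eq_intros\<close>)
  have "\<forall>\<^sub>F y in nhds e. mu (x, y) = mu (\<phi> (?a \<otimes> \<psi> y \<otimes> inv ?a), x)"
    using eventually_conj_D[OF a]
  proof eventually_elim
    case (elim y)
    have "\<psi> (\<phi> (?a \<otimes> \<psi> y \<otimes> inv ?a)) = ?a \<otimes> \<psi> y \<otimes> inv ?a" using elim by simp
    then show ?case using a x elim by (simp add: mu_def m_assoc)
  qed
  then have "((\<lambda>y. mu (\<phi> (?a \<otimes> \<psi> y \<otimes> inv ?a), x)) has_derivative (\<lambda>v. Dmu (x, e) (0, v))) (at e)"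
    using has_derivative_transform_eventually[OF 2, of "\<lambda>y. mu (\<phi> (?a \<otimes> \<psi> y \<otimes> inv ?a), x)"] a x
    by (simp add: eventually_nhds_conv_at)
  from has_derivative_unique[OF 1 this] show ?thesis by metis
qed

text \<open>By \<open>Dmu_Ad\<close> the difference R = \<open>Ad (\<psi> x) v - v\<close> solves P
  R = N, where P = \<open>?P x\<close> tends to the identity and N vanishes at \<open>e\<close>. So
  R and N differ by o(norm (x - e)) and share their derivative, and P never has to be
  inverted.\<close>

lemma Ad_has_derivative:
  "((\<lambda>x. Ad (\<psi> x) v) has_derivative (\<lambda>w. DDmu (e, e) (0, v) (w, 0) - DDmu (e, e) (v, 0) (0, w))) (at e)"
proof -
  let ?P = "\<lambda>x w. Dmu (e, x) (w, 0)" and ?Q = "\<lambda>x w. Dmu (x, e) (0, w)"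
  let ?N = "\<lambda>x. ?Q x v - ?P x v" and ?R = "\<lambda>x. Ad (\<psi> x) v - v"
  have dP: "((\<lambda>x. ?P x w) has_derivative (\<lambda>u. DDmu (e, e) (w, 0) (0, u))) (at e)" for w
    by (rule has_derivative_compose[of "\<lambda>y. (e, y)" "\<lambda>v. (0, v)", OF _ DDmu])
      (auto intro!: derivative_eq_intros)
  have dQ: "((\<lambda>x. ?Q x w) has_derivative (\<lambda>u. DDmu (e, e) (0, w) (u, 0))) (at e)" for w
    by (rule has_derivative_compose[of "\<lambda>y. (y, e)" "\<lambda>v. (v, 0)", OF _ DDmu])
      (auto intro!: derivative_eq_intros)
  define N' where "N' = (\<lambda>w. DDmu (e, e) (0, v) (w, 0) - DDmu (e, e) (v, 0) (0, w))"
  have dN: "(?N has_derivative N') (at e)"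
    unfolding N'_def by (rule has_derivative_diff[OF dQ dP])
  have Ne: "?N e = 0" by (simp add: Dmu_e)
  \<comment> \<open>\<open>\<rho> x\<close> bounds the operator norm of \<open>?P x\<close> minus
    the identity.\<close>
  define \<rho> where "\<rho> x = (\<Sum>b\<in>Basis. norm (?P x b - b))" for x
  have \<rho>: "(\<rho> \<longlongrightarrow> 0) (at e)"
  proof -
    have "((\<lambda>x. ?P x b) \<longlongrightarrow> ?P e b) (at e)" for b
      using has_derivative_continuous[OF dP] continuous_at by blast
    then have "((\<lambda>x. norm (?P x b - b)) \<longlongrightarrow> norm (b - b)) (at e)" for b
      by (intro tendsto_intros) (simp add: Dmu_e)
    then have "((\<lambda>x. \<Sum>b\<in>Basis. norm (?P x b - b)) \<longlongrightarrow> (\<Sum>b\<in>(Basis::'e set). norm (b - b))) (at e)"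
      by (intro tendsto_sum)
    then show ?thesis by (simp add: \<rho>_def[abs_def])
  qed
  have lP: "linear (\<lambda>w. ?P x w)" if "x \<in> \<phi> ` D" for x
    using linear_compose[of "\<lambda>w. (w, 0)" "Dmu (e, x)"] has_derivative_linear[OF Dmu[of "(e, x)"]] that
    by (simp add: o_def linear_iff)
  have P: "norm (?P x w - w) \<le> \<rho> x * norm w" if x: "x \<in> \<phi> ` D" for x w
  proof -
    have "linear (\<lambda>w. ?P x w - w)" by (intro linear_compose_sub linear_ident lP x)
    then have "?P x w - w = (\<Sum>b\<in>Basis. (w \<bullet> b) *\<^sub>R (?P x b - b))" by (rule linear_sum_Basis)
    then have "norm (?P x w - w) \<le> (\<Sum>b\<in>Basis. norm ((w \<bullet> b) *\<^sub>R (?P x b - b)))"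
      by (simp only: norm_sum)
    also have "\<dots> \<le> (\<Sum>b\<in>Basis. norm w * norm (?P x b - b))"
      by (intro sum_mono) (simp add: Basis_le_norm mult_right_mono)
    finally show ?thesis by (simp add: \<rho>_def sum_distrib_left mult.commute)
  qed
  have R: "?R x = ?N x - (?P x (?R x) - ?R x)" if x: "x \<in> \<phi> ` D" for x
  proof -
    have "?P x (?R x) = ?P x (Ad (\<psi> x) v) - ?P x v"
      by (rule linear_diff[OF lP[OF x]])
    then show ?thesis using Dmu_Ad[OF x, of v] by simp
  qed
  \<comment> \<open>With \<rho> \<le> 1/2 the inequality norm R \<le> norm N + \<rho> norm R gives
    norm R \<le> 2 norm N, which bounds the deviation of R from N in terms of N alone.\<close>
  have R2: "norm (?R x - ?N x) \<le> 2 * \<rho> x * norm (?N x)" if x: "x \<in> \<phi> ` D" and s: "\<rho> x \<le> 1/2" for x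
  proof -
    have a: "norm (?R x - ?N x) \<le> \<rho> x * norm (?R x)"
    proof -
      have aux: "norm (r - n) = norm d" if "r = n - d" for r n d :: 'e using that by simp
      show ?thesis unfolding aux[OF R[OF x]] by (rule P[OF x])
    qed
    have r0: "0 \<le> \<rho> x" by (simp add: \<rho>_def sum_nonneg)
    have "norm (?R x) \<le> norm (?N x) + norm (?R x - ?N x)"
      using norm_triangle_ineq[of "?N x" "?R x - ?N x"] by simp
    also have "\<dots> \<le> norm (?N x) + 1/2 * norm (?R x)"
      using a mult_right_mono[OF s, of "norm (?R x)"] by simp
    finally have "norm (?R x) \<le> 2 * norm (?N x)" by simp
    then have "\<rho> x * norm (?R x) \<le> \<rho> x * (2 * norm (?N x))" using r0 mult_left_mono by blast
    with a show ?thesis by simp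
  qed
  have small: "\<forall>\<^sub>F x in at e. \<rho> x \<le> 1/2"
    using order_tendstoD(2)[OF \<rho>, of "1/2"] by (auto elim: eventually_mono)
  have phiD: "\<forall>\<^sub>F x in at e. x \<in> \<phi> ` D"
    using eventually_phi_D by (simp add: eventually_nhds_conv_at)
  obtain K where K: "\<And>w. norm (N' w) \<le> norm w * K" "K \<ge> 0"
    using bounded_linear.nonneg_bounded[OF has_derivative_bounded_linear[OF dN]] by blast
  have dN0: "((\<lambda>x. norm (?N x - N' (x - e)) / norm (x - e)) \<longlongrightarrow> 0) (at e)"
    using dN Ne by (simp add: has_derivative_iff_norm)
  have bound: "\<forall>\<^sub>F x in at e. norm (?R x - N' (x - e)) / norm (x - e)
      \<le> norm (?N x - N' (x - e)) / norm (x - e) * (1 + 2 * \<rho> x) + 2 * \<rho> x * K"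
    using small phiD
  proof eventually_elim
    case (elim x)
    then have x: "x \<in> \<phi> ` D" "\<rho> x \<le> 1/2" by auto
    show ?case
    proof (cases "x = e")
      case True then show ?thesis by (simp add: K(2) \<rho>_def sum_nonneg)
    next
      case False
      then have nx: "norm (x - e) > 0" by simp
      have r0: "0 \<le> \<rho> x" by (simp add: \<rho>_def sum_nonneg)
      let ?d = "norm (?N x - N' (x - e))"
      have "norm (?N x) \<le> ?d + norm (x - e) * K"
        using norm_triangle_ineq[of "?N x - N' (x - e)" "N' (x - e)"] K(1)[of "x - e"] by simp
      then have "2 * \<rho> x * norm (?N x) \<le> 2 * \<rho> x * (?d + norm (x - e) * K)"
        using r0 by (intro mult_left_mono) auto
      then have "norm (?R x - ?N x) \<le> 2 * \<rho> x * (?d + norm (x - e) * K)"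
        using R2[OF x] by linarith
      moreover have "norm (?R x - N' (x - e)) \<le> norm (?R x - ?N x) + ?d"
        using norm_triangle_ineq[of "?R x - ?N x" "?N x - N' (x - e)"] by simp
      ultimately have "norm (?R x - N' (x - e)) \<le> ?d * (1 + 2 * \<rho> x) + 2 * \<rho> x * K * norm (x - e)"
        by (simp add: algebra_simps)
      then have "norm (?R x - N' (x - e)) / norm (x - e)
          \<le> (?d * (1 + 2 * \<rho> x) + 2 * \<rho> x * K * norm (x - e)) / norm (x - e)"
        using nx by (intro divide_right_mono) auto
      also have "\<dots> = ?d / norm (x - e) * (1 + 2 * \<rho> x) + 2 * \<rho> x * K"
        using nx by (simp add: add_divide_distrib)
      finally show ?thesis .
    qed
  qed
  have lim: "((\<lambda>x. norm (?N x - N' (x - e)) / norm (x - e) * (1 + 2 * \<rho> x) + 2 * \<rho> x * K)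
     \<longlongrightarrow> 0 * (1 + 2 * 0) + 2 * 0 * K) (at e)"
    by (intro tendsto_intros dN0 \<rho>)
  have "((\<lambda>x. norm (?R x - N' (x - e)) / norm (x - e)) \<longlongrightarrow> 0) (at e)"
    by (rule tendsto_sandwich[OF _ bound tendsto_const]) (use lim in auto)
  then have "((\<lambda>x. norm (Ad (\<psi> x) v - Ad (\<psi> e) v - N' (x - e)) / norm (x - e)) \<longlongrightarrow> 0) (at e)"
    by (simp add: Ad_one)
  then show ?thesis
    using has_derivative_bounded_linear[OF dN]
    unfolding has_derivative_iff_norm N'_def by simp
qed

lemma br_eq: "br w v = DDmu (e, e) (0, v) (w, 0) - DDmu (e, e) (v, 0) (0, w)"
  unfolding br_def lie_bracket_def prod.case Ad_def[symmetric]
  using fun_cong[OF frechet_derivative_at[OF Ad_has_derivative[of v]], of w] by simp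

lemma Ad_has_derivative_br: "((\<lambda>x. Ad (\<psi> x) v) has_derivative (\<lambda>w. br w v)) (at e)"
  using Ad_has_derivative[of v] by (simp add: br_eq)

text \<open>After Schwarz's theorem, exchanging the arguments exchanges the two terms of
  \<open>br_eq\<close>.\<close>

lemma br_antisym: "br v w = - br w v"
  using mixed_partials_eq[OF open_Omega, of "(e, e)" mu "(0, v)" "(w, 0)"]
    mixed_partials_eq[OF open_Omega, of "(e, e)" mu "(v, 0)" "(0, w)"] mu_smooth
  by (simp add: br_eq)

lemma linear_br_left: "linear (\<lambda>w. br w v)"
  using Ad_has_derivative_br has_derivative_linear by blast

lemma linear_br_right: "linear (br v)"
proof -
  have "br v = (\<lambda>w. - br w v)" using br_antisym by blast
  then show ?thesis using linear_br_left linear_compose_neg by fastforce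
qed

lemma bilinear_br: "bilinear br"
  by (simp add: bilinear_def linear_br_left linear_br_right)

text \<open>Differentiate Ad a (Ad x w) = Ad (a x a^-1) (Ad a w) with respect to x at the
  identity.\<close>

lemma Ad_br:
  assumes a: "a \<in> carrier G"
  shows "Ad a (br v w) = br (Ad a v) (Ad a w)"
proof -
  have 1: "((\<lambda>x. Ad (\<psi> (\<phi> (a \<otimes> \<psi> x \<otimes> inv a))) (Ad a w)) has_derivative (\<lambda>v. br (Ad a v) (Ad a w))) (at e)"
    by (rule has_derivative_compose[of "\<lambda>x. \<phi> (a \<otimes> \<psi> x \<otimes> inv a)", OF conj_has_derivative[OF a]])
      (use a in \<open>simp add: Ad_has_derivative_br\<close>)
  have 2: "((\<lambda>x. Ad a (Ad (\<psi> x) w)) has_derivative (\<lambda>v. Ad a (br v w))) (at e)"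
    using linear_Ad[OF a] Ad_has_derivative_br
    by (metis bounded_linear.has_derivative linear_linear)
  have "\<forall>\<^sub>F x in nhds e. Ad a (Ad (\<psi> x) w) = Ad (\<psi> (\<phi> (a \<otimes> \<psi> x \<otimes> inv a))) (Ad a w)"
    using eventually_conj_D[OF a]
    by eventually_elim (use a in \<open>simp add: Ad_mult Ad_inv\<close>)
  then have "((\<lambda>x. Ad (\<psi> (\<phi> (a \<otimes> \<psi> x \<otimes> inv a))) (Ad a w)) has_derivative (\<lambda>v. Ad a (br v w))) (at e)"
    using has_derivative_transform_eventually[OF 2, of "\<lambda>x. Ad (\<psi> (\<phi> (a \<otimes> \<psi> x \<otimes> inv a))) (Ad a w)"] a
    by (simp add: eventually_nhds_conv_at Ad_one)
  from has_derivative_unique[OF 1 this] show ?thesis by metis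
qed

text \<open>The derivative of the automorphism property Ad x [v, w] = [Ad x v, Ad x w] at the
  identity.\<close>

lemma br_jacobi: "br u (br v w) = br (br u v) w + br v (br u w)"
proof -
  interpret bb: bounded_bilinear br using bilinear_br bilinear_conv_bounded_bilinear by blast
  have 1: "((\<lambda>x. br (Ad (\<psi> x) v) (Ad (\<psi> x) w)) has_derivative (\<lambda>u. br v (br u w) + br (br u v) w)) (at e)"
    using bb.FDERIV[OF Ad_has_derivative_br[of v] Ad_has_derivative_br[of w]] by (simp add: Ad_one)
  have 2: "((\<lambda>x. Ad (\<psi> x) (br v w)) has_derivative (\<lambda>u. br v (br u w) + br (br u v) w)) (at e)"
    by (rule has_derivative_transform_within_open[OF 1 open_phi_D e_in]) (simp add: Ad_br)
  from has_derivative_unique[OF Ad_has_derivative_br this] show ?thesis by (metis add.commute)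
qed

text \<open>Differentiability gives continuity at the identity, and Ad x v = Ad (x a^-1) (Ad a v)
  carries it to every a.\<close>

lemma continuous_Ad: "continuous_on (carrier G) (\<lambda>a. Ad a v)"
proof -
  have psi1: "((\<lambda>x. Ad (\<psi> x) v) \<longlongrightarrow> v) (nhds e)" for v
    using has_derivative_continuous[OF Ad_has_derivative_br[of v]]
    by (simp add: isCont_def tendsto_nhds_iff Ad_one)
  have one: "((\<lambda>x. Ad (f x) v) \<longlongrightarrow> v) F"
    if "(f \<longlongrightarrow> \<one>) F" "\<forall>\<^sub>F x in F. f x \<in> carrier G" for f :: "'g \<Rightarrow> 'g" and F v
  proof -
    have D: "\<forall>\<^sub>F x in F. f x \<in> D" using eventually_chart[OF chart that(1) one_in_D that(2)] .
    have "((\<lambda>x. \<phi> (f x)) \<longlongrightarrow> e) F" using tendsto_chart[OF chart that(1) one_in_D that(2)] .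
    then have "((\<lambda>x. Ad (\<psi> (\<phi> (f x))) v) \<longlongrightarrow> v) F" using filterlim_compose[OF psi1] by fastforce
    then show ?thesis by (rule Lim_transform_eventually) (use D in \<open>auto elim: eventually_mono\<close>)
  qed
  show ?thesis
    unfolding continuous_on_def
  proof
    fix a assume a: "a \<in> carrier G"
    let ?F = "at a within carrier G"
    have c: "\<forall>\<^sub>F x in ?F. x \<in> carrier G" by (simp add: eventually_at_topological) (auto intro: exI[of _ UNIV])
    have 1: "((\<lambda>x. x \<otimes> inv a) \<longlongrightarrow> \<one>) ?F"
      using tendsto_mult_carrier[of "\<lambda>x. x" a ?F "\<lambda>x. inv a" "inv a"] a c by simp
    have "((\<lambda>x. Ad (x \<otimes> inv a) (Ad a v)) \<longlongrightarrow> Ad a v) ?F"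
      by (rule one[OF 1]) (use a c in \<open>auto elim: eventually_mono\<close>)
    then show "((\<lambda>x. Ad x v) \<longlongrightarrow> Ad a v) ?F"
      by (rule Lim_transform_eventually) (use c a in \<open>auto elim!: eventually_mono simp: Ad_mult[symmetric] m_assoc\<close>)
  qed
qed

text \<open>Compactness bounds the orbit of each vector; the finitely many orbits of basis vectors
  then give one constant for all operator norms.\<close>

lemma Ad_bounded: obtains K where "K > 0" "\<And>a v. a \<in> carrier G \<Longrightarrow> norm (Ad a v) \<le> K * norm v"
proof -
  have "\<exists>B. \<forall>a\<in>carrier G. norm (Ad a v) \<le> B" for v
    using compact_imp_bounded[OF compact_continuous_image[OF continuous_Ad compact_carrier]]
    by (auto simp: bounded_iff)
  then obtain B where B: "\<And>v a. a \<in> carrier G \<Longrightarrow> norm (Ad a v) \<le> B v" by metis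
  define K where "K = (\<Sum>b\<in>Basis. \<bar>B b\<bar>) + 1"
  have "norm (Ad a v) \<le> K * norm v" if a: "a \<in> carrier G" for a v
  proof -
    have "norm (Ad a v) \<le> (\<Sum>b\<in>Basis. norm ((v \<bullet> b) *\<^sub>R Ad a b))"
      using linear_sum_Basis[OF linear_Ad[OF a], of v] norm_sum by metis
    also have "\<dots> \<le> (\<Sum>b\<in>Basis. norm v * \<bar>B b\<bar>)"
    proof (rule sum_mono)
      fix b :: 'e assume b: "b \<in> Basis"
      have "norm (Ad a b) \<le> \<bar>B b\<bar>" using B[OF a, of b] by simp
      then show "norm ((v \<bullet> b) *\<^sub>R Ad a b) \<le> norm v * \<bar>B b\<bar>"
        using Basis_le_norm[OF b, of v] by (auto intro!: mult_mono)
    qed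
    also have "\<dots> = norm v * (\<Sum>b\<in>Basis. \<bar>B b\<bar>)" by (rule sum_distrib_left[symmetric])
    also have "\<dots> \<le> norm v * K" by (intro mult_left_mono) (simp_all add: K_def)
    finally show ?thesis by (simp add: mult.commute)
  qed
  moreover have "K > 0" by (simp add: K_def add_nonneg_pos sum_nonneg)
  ultimately show ?thesis using that by blast
qed

end

section \<open>One-parameter subgroups\<close>

text \<open>A product of uncountably many copies of a compact set is compact but in general not
  sequentially compact. A filter finer than \<open>sequentially\<close>, along which the sequence
  converges, therefore replaces a convergent subsequence.\<close>

lemma cluster_filter:
  fixes z :: "nat \<Rightarrow> 'a::topological_space"
  assumes "compact C" "\<And>n. z n \<in> C"
  obtains x F where "F \<noteq> bot" "F \<le> sequentially" "(z \<longlongrightarrow> x) F" "x \<in> C"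
proof -
  have "filtermap z sequentially \<noteq> bot" by (simp add: filtermap_bot_iff)
  moreover have "eventually (\<lambda>x. x \<in> C) (filtermap z sequentially)" by (simp add: eventually_filtermap assms)
  ultimately obtain x where x: "x \<in> C" "inf (nhds x) (filtermap z sequentially) \<noteq> bot"
    using assms(1) unfolding compact_filter by blast
  define F where "F = inf (filtercomap z (nhds x)) sequentially"
  have "F \<noteq> bot"
  proof
    assume "F = bot"
    then have "eventually (\<lambda>_. False) F" by simp
    then obtain P Q where PQ: "eventually P (filtercomap z (nhds x))" "eventually Q sequentially"
      "\<And>n. P n \<Longrightarrow> Q n \<Longrightarrow> False"
      unfolding F_def eventually_inf by blast
    obtain P' where P': "eventually P' (nhds x)" "\<And>n. P' (z n) \<Longrightarrow> P n"
      using PQ(1) unfolding eventually_filtercomap by blast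
    have "eventually (\<lambda>x. \<not> P' x) (filtermap z sequentially)"
      unfolding eventually_filtermap using PQ(2) by eventually_elim (use PQ(3) P'(2) in blast)
    with P'(1) have "eventually (\<lambda>_. False) (inf (nhds x) (filtermap z sequentially))"
      unfolding eventually_inf by blast
    with x(2) show False by (simp add: trivial_limit_def)
  qed
  moreover have "F \<le> sequentially" by (simp add: F_def)
  moreover have "(z \<longlongrightarrow> x) F"
    unfolding F_def filterlim_def
    by (rule order_trans[OF filtermap_mono[OF inf_le1] filtermap_filtercomap])
  ultimately show ?thesis using that x(1) by blast
qed

section \<open>Estimates for products and powers near the identity\<close>

context compact_lie_group
begin

text \<open>The chart is not assumed to send the identity to 0; this recentres it.\<close>

definition nu :: "'g \<Rightarrow> 'e" where "nu a = \<phi> a - e"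

lemma nu_one [simp]: "nu \<one> = 0" by (simp add: nu_def)

text \<open>The error is proportional to the second factor alone: y \<mapsto> mu (x, y) - y has a
  small derivative near the identity, and the mean value inequality is applied between
  \<open>e\<close> and \<phi> b. An error of this shape can be summed over the factors of a
  power.\<close>

lemma mult_estimate:
  assumes "\<delta> > 0"
  obtains r where "r > 0" "\<And>a b. a \<in> D \<Longrightarrow> b \<in> D \<Longrightarrow> norm (nu a) < r \<Longrightarrow> norm (nu b) < r \<Longrightarrow>
    a \<otimes> b \<in> D \<and> norm (nu (a \<otimes> b) - nu a - nu b) \<le> \<delta> * norm (nu b)"
proof -
  define \<rho> where "\<rho> p = (\<Sum>b\<in>Basis. norm (Dmu p (0, b) - b))" for p
  have "isCont \<rho> (e, e)"
    unfolding \<rho>_def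
    by (intro continuous_intros has_derivative_continuous[OF DDmu] Omega_e e_in)
  moreover have "\<rho> (e, e) = 0" by (simp add: \<rho>_def Dmu_e)
  ultimately have "(\<rho> \<longlongrightarrow> 0) (nhds (e, e))" using isCont_def tendsto_nhds_iff by metis
  then have "\<forall>\<^sub>F p in nhds (e, e). \<rho> p < \<delta>" using order_tendstoD(2) assms by blast
  moreover have "\<forall>\<^sub>F p in nhds (e, e). p \<in> \<Omega>" using open_Omega Omega_e(1)[OF e_in] eventually_nhds by blast
  ultimately have "\<forall>\<^sub>F p in nhds (e, e). \<rho> p < \<delta> \<and> p \<in> \<Omega>" by eventually_elim auto
  then obtain d where d: "d > 0" "\<And>p. dist p (e, e) < d \<Longrightarrow> \<rho> p < \<delta> \<and> p \<in> \<Omega>"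
    unfolding eventually_nhds_metric by blast
  define r where "r = d / 2"
  have r: "r > 0" using d by (simp add: r_def)
  have near: "\<rho> (x, y) < \<delta> \<and> (x, y) \<in> \<Omega>" if "dist x e < r" "dist y e < r" for x y
  proof -
    have "dist (x, y) (e, e) \<le> dist x e + dist y e"
      unfolding dist_Pair_Pair by (rule sqrt_sum_squares_le_sum) auto
    also have "\<dots> < d" using that by (simp add: r_def)
    finally show ?thesis using d by blast
  qed
  have "a \<otimes> b \<in> D \<and> norm (nu (a \<otimes> b) - nu a - nu b) \<le> \<delta> * norm (nu b)"
    if ab: "a \<in> D" "b \<in> D" "norm (nu a) < r" "norm (nu b) < r" for a b
  proof -
    let ?x = "\<phi> a" and ?y = "\<phi> b"
    have x: "dist ?x e < r" and y: "dist ?y e < r" using ab by (auto simp: nu_def dist_norm)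
    have D: "a \<otimes> b \<in> D" using near[OF x y] ab by (simp add: Omega_iff)
    have "norm ((mu (?x, ?y) - ?y) - (mu (?x, e) - e)) \<le> \<delta> * norm (?y - e)"
    proof (rule differentiable_bound[of "ball e r" "\<lambda>y. mu (?x, y) - y" "\<lambda>y v. Dmu (?x, y) (0, v) - v"])
      fix y assume "y \<in> ball e r"
      then have y: "dist y e < r" by (simp add: dist_commute)
      have O: "(?x, y) \<in> \<Omega>" and l: "\<rho> (?x, y) < \<delta>" using near[OF x y] by auto
      have der: "((\<lambda>y. mu (?x, y) - y) has_derivative (\<lambda>v. Dmu (?x, y) (0, v) - v)) (at y)"
        by (intro has_derivative_diff has_derivative_ident
            has_derivative_compose[of "\<lambda>y. (?x, y)" "\<lambda>v. (0, v)", OF _ Dmu[OF O]])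
          (auto intro!: derivative_eq_intros)
      then show "((\<lambda>y. mu (?x, y) - y) has_derivative (\<lambda>v. Dmu (?x, y) (0, v) - v)) (at y within ball e r)"
        by (rule has_derivative_at_withinI)
      show "onorm (\<lambda>v. Dmu (?x, y) (0, v) - v) \<le> \<delta>"
      proof (rule onorm_bound)
        fix v
        have "Dmu (?x, y) (0, v) - v = (\<Sum>b\<in>Basis. (v \<bullet> b) *\<^sub>R (Dmu (?x, y) (0, b) - b))"
          by (rule linear_sum_Basis[OF has_derivative_linear[OF der]])
        then have "norm (Dmu (?x, y) (0, v) - v) \<le> (\<Sum>b\<in>Basis. norm ((v \<bullet> b) *\<^sub>R (Dmu (?x, y) (0, b) - b)))"
          by (simp only: norm_sum)
        also have "\<dots> \<le> (\<Sum>b\<in>Basis. norm v * norm (Dmu (?x, y) (0, b) - b))"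
          by (intro sum_mono) (simp add: Basis_le_norm mult_right_mono)
        also have "\<dots> = norm v * \<rho> (?x, y)" by (simp add: \<rho>_def sum_distrib_left)
        also have "\<dots> \<le> norm v * \<delta>" using l by (intro mult_left_mono) auto
        finally show "norm (Dmu (?x, y) (0, v) - v) \<le> \<delta> * norm v" by (simp add: mult.commute)
      qed (use assms in simp)
    qed (use r y in \<open>auto simp: dist_commute\<close>)
    moreover have "mu (?x, ?y) = \<phi> (a \<otimes> b)" "mu (?x, e) = ?x" using ab by (simp_all add: mu_def)
    ultimately show ?thesis using D by (simp add: nu_def algebra_simps)
  qed
  with r show ?thesis using that by blast
qed

lemma phi_ball: obtains r where "r > 0" "cball e r \<subseteq> \<phi> ` D"
  using open_phi_D e_in open_contains_cball by blast

text \<open>Each further factor adds an error of at most \<delta> norm (nu b). As \<delta> \<le> 1,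
  the coordinate of the k-th power has norm at most 2 k norm (nu b); this is the origin of the
  factor 2 in the hypothesis, which keeps all powers in the range of the product estimate.\<close>

lemma pow_estimate:
  assumes \<delta>: "0 < \<delta>" "\<delta> \<le> 1"
    and r: "\<And>a b. a \<in> D \<Longrightarrow> b \<in> D \<Longrightarrow> norm (nu a) < r \<Longrightarrow> norm (nu b) < r \<Longrightarrow>
      a \<otimes> b \<in> D \<and> norm (nu (a \<otimes> b) - nu a - nu b) \<le> \<delta> * norm (nu b)"
    and b: "b \<in> D" and k: "2 * real k * norm (nu b) < r"
  shows "b [^] k \<in> D \<and> norm (nu (b [^] k) - real k *\<^sub>R nu b) \<le> \<delta> * real k * norm (nu b)"
  using k
proof (induction k)
  case 0
  then show ?case by (simp add: one_in_D)
next
  case (Suc k)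
  let ?n = "norm (nu b)"
  have lt: "2 * real k * ?n + 2 * ?n < r" using Suc.prems by (simp add: algebra_simps)
  have n0: "0 \<le> real k * ?n" by simp
  have lt1: "2 * real k * ?n < r" using lt norm_ge_zero[of "nu b"] by linarith
  have IH: "b [^] k \<in> D" "norm (nu (b [^] k) - real k *\<^sub>R nu b) \<le> \<delta> * real k * ?n"
    using Suc.IH lt1 by auto
  have "\<delta> * (real k * ?n) \<le> 1 * (real k * ?n)" by (rule mult_right_mono) (use \<delta> in auto)
  moreover have "norm (nu (b [^] k)) \<le> norm (nu (b [^] k) - real k *\<^sub>R nu b) + real k * ?n"
    using norm_triangle_ineq[of "nu (b [^] k) - real k *\<^sub>R nu b" "real k *\<^sub>R nu b"] by simp
  ultimately have "norm (nu (b [^] k)) \<le> 2 * real k * ?n" using IH(2) by simp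
  then have "norm (nu (b [^] k)) < r" using lt1 by linarith
  moreover have "?n < r" using lt n0 norm_ge_zero[of "nu b"] by linarith
  ultimately have 1: "b [^] k \<otimes> b \<in> D" "norm (nu (b [^] k \<otimes> b) - nu (b [^] k) - nu b) \<le> \<delta> * ?n"
    using r[OF IH(1) b] by auto
  have "norm (nu (b [^] k \<otimes> b) - real (Suc k) *\<^sub>R nu b) \<le>
      norm (nu (b [^] k \<otimes> b) - nu (b [^] k) - nu b) + norm (nu (b [^] k) - real k *\<^sub>R nu b)"
    using norm_triangle_ineq[of "nu (b [^] k \<otimes> b) - nu (b [^] k) - nu b" "nu (b [^] k) - real k *\<^sub>R nu b"]
    by (simp add: algebra_simps)
  also have "\<dots> \<le> \<delta> * real (Suc k) * ?n" using 1(2) IH(2) by (simp add: algebra_simps)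
  finally show ?case using 1(1) by simp
qed

text \<open>Differentiability at 0 in epsilon form, together with membership in the chart near 0.
  Since \<phi> carries no information outside \<open>D\<close>, a derivative of \<phi> (\<gamma> s)
  alone would not control the curve. Taking s = 0 forces \<gamma> 0 to be the identity.\<close>

definition velocity :: "(real \<Rightarrow> 'g) \<Rightarrow> 'e \<Rightarrow> bool" where
  "velocity \<gamma> X \<longleftrightarrow> (\<forall>\<epsilon>>0. \<exists>s0>0. \<forall>s. \<bar>s\<bar> \<le> s0 \<longrightarrow> \<gamma> s \<in> D \<and> norm (nu (\<gamma> s) - s *\<^sub>R X) \<le> \<epsilon> * \<bar>s\<bar>)"

definition one_param :: "'g set \<Rightarrow> (real \<Rightarrow> 'g) \<Rightarrow> 'e \<Rightarrow> bool" where
  "one_param T \<gamma> X \<longleftrightarrow> continuous_on UNIV \<gamma> \<and> (\<forall>s. \<gamma> s \<in> T) \<and> (\<forall>s r. \<gamma> (s + r) = \<gamma> s \<otimes> \<gamma> r) \<and>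
     ((\<lambda>s. \<phi> (\<gamma> s)) has_vector_derivative X) (at 0)"

lemma subgroup_lie_algebra_eq: "subgroup_lie_algebra G (D, \<phi>) T = {X. \<exists>\<gamma>. one_param T \<gamma> X}"
  by (auto simp: subgroup_lie_algebra_def one_param_def)

lemma velocity_zero: assumes "velocity \<gamma> X" shows "\<gamma> 0 = \<one>"
proof -
  obtain s0 where "s0 > 0" "\<forall>s. \<bar>s\<bar> \<le> s0 \<longrightarrow> \<gamma> s \<in> D \<and> norm (nu (\<gamma> s) - s *\<^sub>R X) \<le> 1 * \<bar>s\<bar>"
    using assms unfolding velocity_def by (metis zero_less_one)
  then have "\<gamma> 0 \<in> D" "norm (nu (\<gamma> 0) - 0 *\<^sub>R X) \<le> 1 * \<bar>0\<bar>" by (metis abs_zero less_imp_le)+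
  then show ?thesis unfolding nu_def using psi_phi[of "\<gamma> 0"] by simp
qed

lemma velocity_eventually_D: assumes "velocity \<gamma> X" shows "\<forall>\<^sub>F s in nhds 0. \<gamma> s \<in> D"
proof -
  obtain s0 where "s0 > 0" "\<forall>s. \<bar>s\<bar> \<le> s0 \<longrightarrow> \<gamma> s \<in> D \<and> norm (nu (\<gamma> s) - s *\<^sub>R X) \<le> 1 * \<bar>s\<bar>"
    using assms unfolding velocity_def by (metis zero_less_one)
  then show ?thesis unfolding eventually_nhds_metric dist_real_def
    by (intro exI[of _ s0]) auto
qed

lemma velocity_has_vector_derivative:
  assumes "velocity \<gamma> X" shows "((\<lambda>s. \<phi> (\<gamma> s)) has_vector_derivative X) (at 0)"
  unfolding has_vector_derivative_def has_derivative_within_alt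
proof (intro conjI allI impI)
  fix \<epsilon> :: real assume "\<epsilon> > 0"
  then obtain s0 where "s0 > 0" "\<forall>s. \<bar>s\<bar> \<le> s0 \<longrightarrow> \<gamma> s \<in> D \<and> norm (nu (\<gamma> s) - s *\<^sub>R X) \<le> \<epsilon> * \<bar>s\<bar>"
    using assms unfolding velocity_def by metis
  then show "\<exists>d>0. \<forall>y\<in>UNIV. norm (y - 0) < d \<longrightarrow>
      norm (\<phi> (\<gamma> y) - \<phi> (\<gamma> 0) - (y - 0) *\<^sub>R X) \<le> \<epsilon> * norm (y - 0)"
    by (intro exI[of _ s0]) (auto simp: velocity_zero[OF assms] nu_def)
qed (rule bounded_linear_scaleR_left)

lemma velocityI:
  assumes d: "((\<lambda>s. \<phi> (\<gamma> s)) has_vector_derivative X) (at 0)" and z: "\<gamma> 0 = \<one>"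
    and ev: "\<forall>\<^sub>F s in nhds 0. \<gamma> s \<in> D"
  shows "velocity \<gamma> X"
  unfolding velocity_def
proof (intro allI impI)
  fix \<epsilon> :: real assume "\<epsilon> > 0"
  then obtain d1 where d1: "d1 > 0" "\<And>s. \<bar>s\<bar> < d1 \<Longrightarrow> norm (\<phi> (\<gamma> s) - \<phi> (\<gamma> 0) - s *\<^sub>R X) \<le> \<epsilon> * \<bar>s\<bar>"
    using d unfolding has_vector_derivative_def has_derivative_within_alt by fastforce
  obtain d2 where d2: "d2 > 0" "\<And>s. \<bar>s\<bar> < d2 \<Longrightarrow> \<gamma> s \<in> D"
    using ev unfolding eventually_nhds_metric dist_real_def by auto
  show "\<exists>s0>0. \<forall>s. \<bar>s\<bar> \<le> s0 \<longrightarrow> \<gamma> s \<in> D \<and> norm (nu (\<gamma> s) - s *\<^sub>R X) \<le> \<epsilon> * \<bar>s\<bar>"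
    by (rule exI[of _ "min d1 d2 / 2"]) (use d1 d2 z in \<open>auto simp: nu_def\<close>)
qed

lemma velocity_tendsto: assumes "velocity \<gamma> X" shows "(\<gamma> \<longlongrightarrow> \<one>) (at 0)"
proof -
  have "continuous (at 0) (\<lambda>s. \<phi> (\<gamma> s))"
    using velocity_has_vector_derivative[OF assms] has_vector_derivative_continuous by blast
  then have "((\<lambda>s. \<phi> (\<gamma> s)) \<longlongrightarrow> e) (at 0)" by (simp add: continuous_at velocity_zero[OF assms])
  then have "((\<lambda>s. \<psi> (\<phi> (\<gamma> s))) \<longlongrightarrow> \<psi> e) (at 0)" by (rule tendsto_psi) simp
  then have "((\<lambda>s. \<psi> (\<phi> (\<gamma> s))) \<longlongrightarrow> \<one>) (at 0)" by simp
  then show ?thesis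
    by (rule Lim_transform_eventually)
      (use velocity_eventually_D[OF assms] in \<open>auto simp: eventually_nhds_conv_at elim: eventually_mono\<close>)
qed

lemma velocity_unique:
  assumes "velocity \<gamma> X" "velocity \<gamma> Y" shows "X = Y"
  using velocity_has_vector_derivative[OF assms(1)] velocity_has_vector_derivative[OF assms(2)]
  by (rule vector_derivative_unique_at)

lemma velocity_scale:
  assumes "velocity \<gamma> X" shows "velocity (\<lambda>s. \<gamma> (c * s)) (c *\<^sub>R X)"
proof (rule velocityI)
  have 1: "((\<lambda>s. \<phi> (\<gamma> s)) has_derivative (\<lambda>s. s *\<^sub>R X)) (at (c * 0))"
    using velocity_has_vector_derivative[OF assms] by (simp add: has_vector_derivative_def)
  have "((\<lambda>s. \<phi> (\<gamma> (c * s))) has_derivative (\<lambda>s. (c * s) *\<^sub>R X)) (at 0)"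
    by (rule has_derivative_compose[of "\<lambda>s. c * s" "\<lambda>s. c * s", OF _ 1]) (auto intro!: derivative_eq_intros)
  then show "((\<lambda>s. \<phi> (\<gamma> (c * s))) has_vector_derivative c *\<^sub>R X) (at 0)"
    by (simp add: has_vector_derivative_def mult.commute)
  show "\<gamma> (c * 0) = \<one>" using velocity_zero[OF assms] by simp
  have "filterlim (\<lambda>s. c * s) (nhds 0) (nhds 0)"
    using tendsto_mult[OF tendsto_const[of c] filterlim_ident[of "nhds (0::real)"]] by simp
  from eventually_compose_filterlim[OF velocity_eventually_D[OF assms] this]
  show "\<forall>\<^sub>F s in nhds 0. \<gamma> (c * s) \<in> D" .
qed

lemma velocity_mult:
  assumes \<gamma>: "velocity \<gamma> X" and \<eta>: "velocity \<eta> Y"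
  shows "velocity (\<lambda>s. \<gamma> s \<otimes> \<eta> s) (X + Y)"
  unfolding velocity_def
proof (intro allI impI)
  fix \<epsilon> :: real assume \<epsilon>: "\<epsilon> > 0"
  \<comment> \<open>The product estimate costs at most \<delta> (norm Y + 1) per unit of s and the
    two curves cost \<delta> each, in total \<delta> (norm Y + 3).\<close>
  define \<delta> where "\<delta> = min 1 (\<epsilon> / (norm Y + 3))"
  have nY: "norm Y + 3 > 0" using norm_ge_zero[of Y] by linarith
  have \<delta>: "\<delta> > 0" "\<delta> \<le> 1" "\<delta> * (norm Y + 3) \<le> \<epsilon>"
    using \<epsilon> nY by (simp_all add: \<delta>_def pos_le_divide_eq[OF nY, symmetric])
  obtain r where r: "r > 0" "\<And>a b. a \<in> D \<Longrightarrow> b \<in> D \<Longrightarrow> norm (nu a) < r \<Longrightarrow> norm (nu b) < r \<Longrightarrow>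
    a \<otimes> b \<in> D \<and> norm (nu (a \<otimes> b) - nu a - nu b) \<le> \<delta> * norm (nu b)"
    using mult_estimate[OF \<delta>(1)] by blast
  obtain s1 where s1: "s1 > 0" "\<And>s. \<bar>s\<bar> \<le> s1 \<Longrightarrow> \<gamma> s \<in> D \<and> norm (nu (\<gamma> s) - s *\<^sub>R X) \<le> \<delta> * \<bar>s\<bar>"
    using \<gamma> \<delta> unfolding velocity_def by metis
  obtain s2 where s2: "s2 > 0" "\<And>s. \<bar>s\<bar> \<le> s2 \<Longrightarrow> \<eta> s \<in> D \<and> norm (nu (\<eta> s) - s *\<^sub>R Y) \<le> \<delta> * \<bar>s\<bar>"
    using \<eta> \<delta> unfolding velocity_def by metis
  define N where "N = norm X + norm Y + 2"
  have N: "N > 0" using norm_ge_zero[of X] norm_ge_zero[of Y] unfolding N_def by linarith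
  define s0 where "s0 = min (min s1 s2) (r / (2 * N))"
  have s0: "s0 > 0" using s1 s2 r N by (simp add: s0_def)
  have "\<gamma> s \<otimes> \<eta> s \<in> D \<and> norm (nu (\<gamma> s \<otimes> \<eta> s) - s *\<^sub>R (X + Y)) \<le> \<epsilon> * \<bar>s\<bar>" if s: "\<bar>s\<bar> \<le> s0" for s
  proof -
    have g: "\<gamma> s \<in> D" "norm (nu (\<gamma> s) - s *\<^sub>R X) \<le> \<delta> * \<bar>s\<bar>"
      and h: "\<eta> s \<in> D" "norm (nu (\<eta> s) - s *\<^sub>R Y) \<le> \<delta> * \<bar>s\<bar>"
      using s1(2)[of s] s2(2)[of s] s by (auto simp: s0_def)
    have ds: "\<delta> * \<bar>s\<bar> \<le> \<bar>s\<bar>" using \<delta> mult_right_mono[of \<delta> 1 "\<bar>s\<bar>"] by simp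
    have ng: "norm (nu (\<gamma> s)) \<le> \<bar>s\<bar> * (norm X + 1)"
      using norm_triangle_ineq[of "nu (\<gamma> s) - s *\<^sub>R X" "s *\<^sub>R X"] g(2) ds by (simp add: algebra_simps)
    have nh: "norm (nu (\<eta> s)) \<le> \<bar>s\<bar> * (norm Y + 1)"
      using norm_triangle_ineq[of "nu (\<eta> s) - s *\<^sub>R Y" "s *\<^sub>R Y"] h(2) ds by (simp add: algebra_simps)
    have "\<bar>s\<bar> * N \<le> r / (2 * N) * N" using s N by (intro mult_right_mono) (auto simp: s0_def)
    also have "\<dots> < r" using N r by simp
    finally have sN: "\<bar>s\<bar> * N < r" .
    have "\<bar>s\<bar> * (norm X + 1) \<le> \<bar>s\<bar> * N" "\<bar>s\<bar> * (norm Y + 1) \<le> \<bar>s\<bar> * N"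
      by (auto simp: N_def intro!: mult_left_mono)
    then have "norm (nu (\<gamma> s)) < r" "norm (nu (\<eta> s)) < r" using ng nh sN by linarith+
    then have m: "\<gamma> s \<otimes> \<eta> s \<in> D" "norm (nu (\<gamma> s \<otimes> \<eta> s) - nu (\<gamma> s) - nu (\<eta> s)) \<le> \<delta> * norm (nu (\<eta> s))"
      using r(2)[OF g(1) h(1)] by auto
    have "nu (\<gamma> s \<otimes> \<eta> s) - s *\<^sub>R (X + Y) = (nu (\<gamma> s \<otimes> \<eta> s) - nu (\<gamma> s) - nu (\<eta> s)) +
        ((nu (\<gamma> s) - s *\<^sub>R X) + (nu (\<eta> s) - s *\<^sub>R Y))" by (simp add: algebra_simps)
    then have "norm (nu (\<gamma> s \<otimes> \<eta> s) - s *\<^sub>R (X + Y)) \<le> \<delta> * norm (nu (\<eta> s)) + (\<delta> * \<bar>s\<bar> + \<delta> * \<bar>s\<bar>)"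
      using m(2) g(2) h(2) by (metis (no_types, lifting) norm_triangle_mono)
    also have "\<dots> \<le> \<delta> * (\<bar>s\<bar> * (norm Y + 1)) + (\<delta> * \<bar>s\<bar> + \<delta> * \<bar>s\<bar>)"
      using mult_left_mono[OF nh, of \<delta>] \<delta>(1) by simp
    also have "\<dots> = \<delta> * (norm Y + 3) * \<bar>s\<bar>" by (simp add: algebra_simps)
    also have "\<dots> \<le> \<epsilon> * \<bar>s\<bar>" using \<delta>(3) by (intro mult_right_mono) auto
    finally show ?thesis using m(1) by simp
  qed
  with s0 show "\<exists>s0>0. \<forall>s. \<bar>s\<bar> \<le> s0 \<longrightarrow> \<gamma> s \<otimes> \<eta> s \<in> D \<and> norm (nu (\<gamma> s \<otimes> \<eta> s) - s *\<^sub>R (X + Y)) \<le> \<epsilon> * \<bar>s\<bar>"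
    by blast
qed

lemma one_param_velocity:
  assumes "one_param T \<gamma> X" "T \<subseteq> carrier G" shows "velocity \<gamma> X"
proof (rule velocityI)
  have c: "\<gamma> s \<in> carrier G" for s using assms by (auto simp: one_param_def)
  have "\<gamma> 0 = \<gamma> 0 \<otimes> \<gamma> 0" using assms(1) unfolding one_param_def by (metis add_0)
  then show z: "\<gamma> 0 = \<one>" using c[of 0] by (metis r_cancel_one)
  have "(\<gamma> \<longlongrightarrow> \<gamma> 0) (nhds 0)"
    using assms(1) unfolding one_param_def continuous_on_def by (metis UNIV_I tendsto_at_iff_tendsto_nhds)
  then show "\<forall>\<^sub>F s in nhds 0. \<gamma> s \<in> D"
    using eventually_chart[OF chart, of \<gamma> "\<gamma> 0"] z one_in_D c by simp
qed (use assms in \<open>auto simp: one_param_def\<close>)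

lemma one_paramI:
  assumes v: "velocity \<gamma> X" and T: "T \<subseteq> carrier G" "\<And>s. \<gamma> s \<in> T"
    and hom: "\<And>s r. \<gamma> (s + r) = \<gamma> s \<otimes> \<gamma> r"
  shows "one_param T \<gamma> X"
proof -
  have c: "\<gamma> s \<in> carrier G" for s using T by auto
  have "continuous_on UNIV \<gamma>"
    unfolding continuous_on_def
  proof
    fix s :: real
    have "((\<lambda>h. \<gamma> s \<otimes> \<gamma> h) \<longlongrightarrow> \<gamma> s \<otimes> \<one>) (at 0)"
      by (rule tendsto_mult_carrier[OF tendsto_const velocity_tendsto[OF v]]) (use c in auto)
    then have "((\<lambda>h. \<gamma> (s + h)) \<longlongrightarrow> \<gamma> s) (at 0)" using c by (simp add: hom)
    then show "(\<gamma> \<longlongrightarrow> \<gamma> s) (at s within UNIV)" using LIM_offset_zero_iff[of s \<gamma>] by simp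
  qed
  then show ?thesis using assms velocity_has_vector_derivative[OF v] by (simp add: one_param_def)
qed

text \<open>The discrete approximation of a one-parameter subgroup gives an estimate only for s
  \<ge> 0. For negative parameters the product estimate is applied to \<gamma> u and its inverse:
  their product has coordinate 0, so the coordinate of the inverse is nearly the negative of that of
  \<gamma> u.\<close>

lemma velocity_from_right:
  assumes right: "\<And>\<epsilon>. \<epsilon> > 0 \<Longrightarrow> \<exists>s0>0. \<forall>s. 0 \<le> s \<and> s \<le> s0 \<longrightarrow> \<gamma> s \<in> D \<and> norm (nu (\<gamma> s) - s *\<^sub>R X) \<le> \<epsilon> * s"
    and c: "\<And>s. \<gamma> s \<in> carrier G" and hom: "\<And>s r. \<gamma> (s + r) = \<gamma> s \<otimes> \<gamma> r"
  shows "velocity \<gamma> X"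
  unfolding velocity_def
proof (intro allI impI)
  fix \<epsilon> :: real assume \<epsilon>: "\<epsilon> > 0"
  have "\<gamma> 0 = \<gamma> 0 \<otimes> \<gamma> 0" using hom[of 0 0] by simp
  then have z: "\<gamma> 0 = \<one>" using c[of 0] by (metis r_cancel_one)
  have inv: "\<gamma> (- s) = inv (\<gamma> s)" for s
    using hom[of "-s" s] z c by (intro inv_equality[symmetric]) auto
  obtain s1 where s1: "s1 > 0" "\<And>s. 0 \<le> s \<Longrightarrow> s \<le> s1 \<Longrightarrow> \<gamma> s \<in> D \<and> norm (nu (\<gamma> s) - s *\<^sub>R X) \<le> 1 * s"
    using right[of 1] by auto
  have ev1: "\<forall>\<^sub>F s in at_right 0. \<gamma> s \<in> D \<and> norm (nu (\<gamma> s)) \<le> s * (norm X + 1)"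
    unfolding eventually_at_right_field
  proof (intro exI[of _ s1] conjI allI impI s1(1))
    fix s assume "0 < s" "s < s1"
    then have g: "\<gamma> s \<in> D" "norm (nu (\<gamma> s) - s *\<^sub>R X) \<le> 1 * s" using s1(2)[of s] by auto
    then show "\<gamma> s \<in> D" by blast
    show "norm (nu (\<gamma> s)) \<le> s * (norm X + 1)"
      using g(2) norm_triangle_ineq[of "nu (\<gamma> s) - s *\<^sub>R X" "s *\<^sub>R X"] \<open>0 < s\<close> by (simp add: algebra_simps)
  qed
  have lim: "((\<lambda>s. s * (norm X + 1)) \<longlongrightarrow> 0 * (norm X + 1)) (at_right 0)"
    by (intro tendsto_intros)
  have "((\<lambda>s. nu (\<gamma> s)) \<longlongrightarrow> 0) (at_right 0)"
    by (rule Lim_null_comparison[OF _ lim[simplified]]) (use ev1 in \<open>auto elim: eventually_mono\<close>)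
  then have "((\<lambda>s. nu (\<gamma> s) + e) \<longlongrightarrow> 0 + e) (at_right 0)" by (intro tendsto_intros)
  then have "((\<lambda>s. \<psi> (\<phi> (\<gamma> s))) \<longlongrightarrow> \<psi> e) (at_right 0)"
    by (intro tendsto_psi) (simp_all add: nu_def)
  then have "((\<lambda>s. \<psi> (\<phi> (\<gamma> s))) \<longlongrightarrow> \<one>) (at_right 0)" by simp
  then have lim1: "(\<gamma> \<longlongrightarrow> \<one>) (at_right 0)"
    by (rule Lim_transform_eventually) (use ev1 in \<open>auto elim: eventually_mono\<close>)
  have "((\<lambda>s. inv (\<gamma> s)) \<longlongrightarrow> inv \<one>) (at_right 0)"
    by (rule tendsto_inv_carrier[OF lim1]) (auto simp: c)
  then have lim2: "((\<lambda>s. inv (\<gamma> s)) \<longlongrightarrow> \<one>) (at_right 0)" by simp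
  have ev2: "\<forall>\<^sub>F s in at_right 0. inv (\<gamma> s) \<in> D"
    by (rule eventually_chart[OF chart lim2 one_in_D]) (auto simp: c)
  have nulim: "((\<lambda>s. norm (nu (f s))) \<longlongrightarrow> 0) (at_right 0)"
    if "(f \<longlongrightarrow> \<one>) (at_right 0)" "\<And>s. f s \<in> carrier G" for f :: "real \<Rightarrow> 'g"
  proof -
    have "((\<lambda>s. norm (\<phi> (f s) - e)) \<longlongrightarrow> norm (e - e)) (at_right 0)"
      by (intro tendsto_intros tendsto_chart[OF chart that(1) one_in_D]) (simp add: that)
    then show ?thesis by (simp add: nu_def)
  qed
  \<comment> \<open>2 (norm X + 1) + 1, the sum of the two errors in the final estimate. The
    additional bound \<delta> \<le> 1/2 allows the term \<delta> norm (nu b) to be absorbed.\<close>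
  define M where "M = 2 * norm X + 3"
  have M: "M > 0" using norm_ge_zero[of X] unfolding M_def by linarith
  define \<delta> where "\<delta> = min (1 / 2) (\<epsilon> / M)"
  have "\<delta> \<le> 1 / 2" unfolding \<delta>_def by (rule min.cobounded1)
  then have \<delta>: "\<delta> > 0" "\<delta> \<le> 1 / 2" "\<delta> * M \<le> \<epsilon>"
    using \<epsilon> M by (simp_all add: \<delta>_def pos_le_divide_eq[OF M, symmetric])
  have dle: "\<delta> \<le> \<epsilon>"
    using \<delta>(3) mult_left_mono[of 1 M \<delta>] \<delta>(1) norm_ge_zero[of X] unfolding M_def by linarith
  obtain r where r: "r > 0" "\<And>a b. a \<in> D \<Longrightarrow> b \<in> D \<Longrightarrow> norm (nu a) < r \<Longrightarrow> norm (nu b) < r \<Longrightarrow>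
    a \<otimes> b \<in> D \<and> norm (nu (a \<otimes> b) - nu a - nu b) \<le> \<delta> * norm (nu b)"
    using mult_estimate[OF \<delta>(1)] by blast
  obtain s2 where s2: "s2 > 0" "\<And>s. 0 \<le> s \<Longrightarrow> s \<le> s2 \<Longrightarrow> \<gamma> s \<in> D \<and> norm (nu (\<gamma> s) - s *\<^sub>R X) \<le> \<delta> * s"
    using right[OF \<delta>(1)] by auto
  have "\<forall>\<^sub>F s in at_right 0. norm (nu (\<gamma> s)) < r \<and> norm (nu (inv (\<gamma> s))) < r \<and> inv (\<gamma> s) \<in> D"
    using order_tendstoD(2)[OF nulim[OF lim1 c] r(1)] order_tendstoD(2)[OF nulim[OF lim2 inv_closed[OF c]] r(1)] ev2
    by eventually_elim auto
  then obtain s3 where s3: "s3 > 0" "\<And>s. 0 < s \<Longrightarrow> s < s3 \<Longrightarrow>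
      norm (nu (\<gamma> s)) < r \<and> norm (nu (inv (\<gamma> s))) < r \<and> inv (\<gamma> s) \<in> D"
    unfolding eventually_at_right_field by auto
  define s0 where "s0 = min s2 (s3 / 2)"
  have "\<gamma> s \<in> D \<and> norm (nu (\<gamma> s) - s *\<^sub>R X) \<le> \<epsilon> * \<bar>s\<bar>" if s: "\<bar>s\<bar> \<le> s0" for s
  proof (cases "s \<ge> 0")
    case True
    then have 1: "\<gamma> s \<in> D" "norm (nu (\<gamma> s) - s *\<^sub>R X) \<le> \<delta> * s" using s2(2)[of s] s by (auto simp: s0_def)
    have "\<delta> * s \<le> \<epsilon> * s" using dle True by (rule mult_right_mono)
    then show ?thesis using 1 True by simp
  next
    case False
    define u where "u = - s"
    have u: "0 < u" "u \<le> s2" "u < s3" using False s s3(1) by (auto simp: u_def s0_def)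
    let ?a = "\<gamma> u" and ?b = "inv (\<gamma> u)"
    have a: "?a \<in> D" "norm (nu ?a - u *\<^sub>R X) \<le> \<delta> * u" using s2(2)[of u] u by auto
    have b: "?b \<in> D" "norm (nu ?a) < r" "norm (nu ?b) < r" using s3(2)[of u] u by auto
    have "norm (nu (?a \<otimes> ?b) - nu ?a - nu ?b) \<le> \<delta> * norm (nu ?b)" using r(2)[OF a(1) b] by blast
    then have ab: "norm (nu ?a + nu ?b) \<le> \<delta> * norm (nu ?b)"
      using c by (simp add: norm_minus_commute[of "- nu ?a"] add.commute)
    have du: "\<delta> * u \<le> u" using mult_right_mono[of \<delta> 1 u] \<delta> u by simp
    have "norm (nu ?a) \<le> \<delta> * u + u * norm X"
      using a(2) norm_triangle_ineq[of "nu ?a - u *\<^sub>R X" "u *\<^sub>R X"] u by simp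
    also have "\<dots> \<le> u + u * norm X" by (rule add_right_mono[OF du])
    finally have na: "norm (nu ?a) \<le> u * (norm X + 1)" by (simp add: algebra_simps)
    have "norm (nu ?b) \<le> norm (nu ?a + nu ?b) + norm (nu ?a)"
      using norm_triangle_ineq4[of "nu ?a + nu ?b" "nu ?a"] by simp
    also have "norm (nu ?a + nu ?b) \<le> 1 / 2 * norm (nu ?b)"
      using ab mult_right_mono[OF \<delta>(2), of "norm (nu ?b)"] by simp
    finally have nb: "norm (nu ?b) \<le> 2 * (u * (norm X + 1))" using na by linarith
    have "norm (nu ?b - s *\<^sub>R X) \<le> norm (nu ?a + nu ?b) + norm (nu ?a - u *\<^sub>R X)"
      using norm_triangle_ineq4[of "nu ?a + nu ?b" "nu ?a - u *\<^sub>R X"] by (simp add: u_def)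
    also have "\<dots> \<le> \<delta> * (2 * (u * (norm X + 1))) + \<delta> * u"
      using ab mult_left_mono[OF nb, of \<delta>] \<delta>(1) a(2) by linarith
    also have "\<dots> = \<delta> * M * u" by (simp add: M_def algebra_simps)
    also have "\<dots> \<le> \<epsilon> * u" using \<delta>(3) u by (intro mult_right_mono) auto
    finally have "norm (nu ?b - s *\<^sub>R X) \<le> \<epsilon> * u" .
    moreover have "\<gamma> s = ?b" using inv[of u] by (simp add: u_def)
    ultimately show ?thesis using b(1) False by (simp add: u_def)
  qed
  moreover have "s0 > 0" using s2 s3 by (simp add: s0_def)
  ultimately show "\<exists>s0>0. \<forall>s. \<bar>s\<bar> \<le> s0 \<longrightarrow> \<gamma> s \<in> D \<and> norm (nu (\<gamma> s) - s *\<^sub>R X) \<le> \<epsilon> * \<bar>s\<bar>" by blast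
qed

text \<open>One-parameter subgroups are cluster points of the discrete ones \<open>s \<mapsto> y\<^sub>n\<^bsup>\<lfloor>s/\<epsilon>\<^sub>n\<rfloor>\<^esup>\<close> in the compact
  product space of all functions from the reals to \<open>T\<close>.\<close>

lemma one_param_exists:
  assumes T: "subgroup T G" "compact T" and y: "\<And>n. y n \<in> T" "\<And>n. y n \<in> D"
    and \<epsilon>: "\<And>n. \<epsilon> n > 0" "\<epsilon> \<longlonglongrightarrow> 0" and X: "(\<lambda>n. (1 / \<epsilon> n) *\<^sub>R nu (y n)) \<longlonglongrightarrow> X"
  shows "\<exists>\<gamma>. one_param T \<gamma> X"
proof -
  interpret T: subgroup T G by (rule T)
  have yc: "y n \<in> carrier G" for n using y(2) by blast
  define z where "z n = (\<lambda>s::real. y n [^] \<lfloor>s / \<epsilon> n\<rfloor>)" for n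
  have yk: "y n [^] k \<in> T" for n and k :: nat
    by (induction k) (simp_all add: y)
  have yi: "y n [^] i \<in> T" for n and i :: int
    unfolding int_pow_def2 using yk[of n "nat i"] T.m_inv_closed[OF yk[of n "nat (- i)"]] by presburger
  have zT: "z n s \<in> T" for n s
    unfolding z_def by (rule yi)
  \<comment> \<open>Tychonoff's theorem gives one filter along which z n s converges for all real s
    at once.\<close>
  have "compactin (product_topology (\<lambda>_. euclidean) UNIV) (PiE UNIV (\<lambda>_::real. T))"
    unfolding compactin_PiE compactin_euclidean_iff using T(2) by blast
  then have "compact (PiE UNIV (\<lambda>_::real. T))"
    by (simp add: euclidean_product_topology)
  moreover have "z n \<in> PiE UNIV (\<lambda>_::real. T)" for n using zT by auto
  ultimately obtain \<gamma> F where F: "F \<noteq> bot" "F \<le> sequentially" "(z \<longlongrightarrow> \<gamma>) F" "\<gamma> \<in> PiE UNIV (\<lambda>_::real. T)"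
    by (rule cluster_filter)
  have \<gamma>T: "\<gamma> s \<in> T" for s using F(4) by auto
  have zlim: "((\<lambda>n. z n s) \<longlongrightarrow> \<gamma> s) F" for s
    using continuous_on_tendsto_compose[OF continuous_on_product_coordinates[of s] F(3)] by simp
  have \<epsilon>F: "(\<epsilon> \<longlongrightarrow> 0) F" and XF: "((\<lambda>n. (1 / \<epsilon> n) *\<^sub>R nu (y n)) \<longlongrightarrow> X) F"
    using tendsto_mono[OF F(2)] \<epsilon>(2) X by blast+
  have "((\<lambda>n. \<epsilon> n *\<^sub>R ((1 / \<epsilon> n) *\<^sub>R nu (y n)) + e) \<longlongrightarrow> 0 *\<^sub>R X + e) F"
    by (intro tendsto_intros \<epsilon>F XF)
  moreover have "\<epsilon> n *\<^sub>R ((1 / \<epsilon> n) *\<^sub>R nu (y n)) + e = \<phi> (y n)" for n using \<epsilon>(1)[of n] by (simp add: nu_def)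
  ultimately have "((\<lambda>n. \<phi> (y n)) \<longlongrightarrow> e) F" by simp
  from tendsto_psi[OF this e_in] have ylim: "(y \<longlongrightarrow> \<one>) F" by (simp add: y)
  have hom: "\<gamma> (s + r) = \<gamma> s \<otimes> \<gamma> r" for s r
  proof -
    \<comment> \<open>Floors are additive up to 0 or 1, so z n is a homomorphism up to at most one
      factor y n, which tends to the identity.\<close>
    define k where "k n = \<lfloor>(s + r) / \<epsilon> n\<rfloor> - \<lfloor>s / \<epsilon> n\<rfloor> - \<lfloor>r / \<epsilon> n\<rfloor>" for n
    have k: "k n = 0 \<or> k n = 1" for n
      unfolding k_def add_divide_distrib by linarith
    have w: "((\<lambda>n. y n [^] k n) \<longlongrightarrow> \<one>) F"
    proof (rule topological_tendstoI)
      fix S assume S: "open S" "\<one> \<in> S"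
      have "\<forall>\<^sub>F n in F. y n \<in> S" using topological_tendstoD[OF ylim S] .
      then show "\<forall>\<^sub>F n in F. y n [^] k n \<in> S"
      proof eventually_elim
        case (elim n)
        then show ?case using k[of n] S yc[of n] by (auto simp: int_pow_1)
      qed
    qed
    have 1: "((\<lambda>n. z n s \<otimes> z n r) \<longlongrightarrow> \<gamma> s \<otimes> \<gamma> r) F"
      by (rule tendsto_mult_carrier[OF zlim zlim]) (use \<gamma>T zT T.subset in auto)
    have "((\<lambda>n. z n s \<otimes> z n r \<otimes> (y n [^] k n)) \<longlongrightarrow> \<gamma> s \<otimes> \<gamma> r \<otimes> \<one>) F"
      by (rule tendsto_mult_carrier[OF 1 w]) (use \<gamma>T zT T.subset yc in auto)
    moreover have "z n s \<otimes> z n r \<otimes> (y n [^] k n) = z n (s + r)" for n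
      unfolding z_def by (simp add: int_pow_mult[symmetric] yc k_def)
    moreover have "\<gamma> s \<otimes> \<gamma> r \<otimes> \<one> = \<gamma> s \<otimes> \<gamma> r" using \<gamma>T by simp
    ultimately show ?thesis using tendsto_unique[OF F(1) zlim] by simp
  qed
  have "velocity \<gamma> X"
  proof (rule velocity_from_right[OF _ _ hom])
    show "\<gamma> s \<in> carrier G" for s using \<gamma>T T.subset by blast
    fix \<epsilon>0 :: real assume e0: "\<epsilon>0 > 0"
    define N where "N = norm X + 1"
    have N: "N > 0" using norm_ge_zero[of X] unfolding N_def by linarith
    define \<delta> where "\<delta> = min 1 (\<epsilon>0 / N)"
    have \<delta>: "\<delta> > 0" "\<delta> \<le> 1" "\<delta> * N \<le> \<epsilon>0"
      using e0 N by (simp_all add: \<delta>_def pos_le_divide_eq[OF N, symmetric])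
    obtain r1 where r1: "r1 > 0" "\<And>a b. a \<in> D \<Longrightarrow> b \<in> D \<Longrightarrow> norm (nu a) < r1 \<Longrightarrow> norm (nu b) < r1 \<Longrightarrow>
      a \<otimes> b \<in> D \<and> norm (nu (a \<otimes> b) - nu a - nu b) \<le> \<delta> * norm (nu b)"
      using mult_estimate[OF \<delta>(1)] by blast
    obtain r2 where r2: "r2 > 0" "cball e r2 \<subseteq> \<phi> ` D" using phi_ball .
    define r where "r = min r1 r2"
    have r: "r > 0" "cball e r \<subseteq> \<phi> ` D" using r1 r2 by (auto simp: r_def)
    have rr: "a \<otimes> b \<in> D \<and> norm (nu (a \<otimes> b) - nu a - nu b) \<le> \<delta> * norm (nu b)"
      if "a \<in> D" "b \<in> D" "norm (nu a) < r" "norm (nu b) < r" for a b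
      using r1(2) that by (simp add: r_def)
    \<comment> \<open>A closed set inside \<open>D\<close> containing the approximants for small s,
      so that their limit stays in the chart.\<close>
    define C where "C = \<psi> ` cball e r"
    have "compact C" unfolding C_def
      by (rule compact_continuous_image[OF continuous_on_subset[OF chart_facts(7)[OF chart] r(2)] compact_cball])
    then have closedC: "closed C" by (rule compact_imp_closed)
    have CD: "C \<subseteq> D" using r(2) by (auto simp: C_def)
    \<comment> \<open>The divisor 4 provides the factor 2 demanded by \<open>pow_estimate\<close>
      and leaves a strict inequality.\<close>
    define s0 where "s0 = r / (4 * N)"
    have s0: "s0 > 0" using r N by (simp add: s0_def)
    have "\<gamma> s \<in> D \<and> norm (nu (\<gamma> s) - s *\<^sub>R X) \<le> \<epsilon>0 * s" if s: "0 \<le> s" "s \<le> s0" for s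
    proof -
      define k where "k n = nat \<lfloor>s / \<epsilon> n\<rfloor>" for n
      have k0: "real (k n) = of_int \<lfloor>s / \<epsilon> n\<rfloor>" and zk: "z n s = y n [^] k n" for n
      proof -
        have "0 \<le> \<lfloor>s / \<epsilon> n\<rfloor>" using s \<epsilon>(1)[of n] by simp
        then have ik: "int (k n) = \<lfloor>s / \<epsilon> n\<rfloor>" by (simp add: k_def)
        then show "real (k n) = of_int \<lfloor>s / \<epsilon> n\<rfloor>" by linarith
        show "z n s = y n [^] k n" unfolding z_def ik[symmetric] by (rule int_pow_int)
      qed
      have kle: "real (k n) * \<epsilon> n \<le> s" for n
        unfolding k0 by (rule pos_le_divide_eq[OF \<epsilon>(1), THEN iffD1, OF of_int_floor_le])
      have kge: "s - \<epsilon> n \<le> real (k n) * \<epsilon> n" for n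
      proof -
        have "s / \<epsilon> n - 1 \<le> real (k n)" unfolding k0 by linarith
        then have "(s / \<epsilon> n - 1) * \<epsilon> n \<le> real (k n) * \<epsilon> n" by (rule mult_right_mono) (use \<epsilon>(1)[of n] in simp)
        then show ?thesis using \<epsilon>(1)[of n] by (simp add: left_diff_distrib)
      qed
      have klim: "((\<lambda>n. real (k n) * \<epsilon> n) \<longlongrightarrow> s) F"
      proof (rule tendsto_sandwich[of "\<lambda>n. s - \<epsilon> n" _ _ "\<lambda>_. s"])
        show "((\<lambda>n. s - \<epsilon> n) \<longlongrightarrow> s) F" using tendsto_diff[OF tendsto_const \<epsilon>F, of s] by simp
      qed (simp_all add: kle kge)
      have "((\<lambda>n. (real (k n) * \<epsilon> n) *\<^sub>R ((1 / \<epsilon> n) *\<^sub>R nu (y n))) \<longlongrightarrow> s *\<^sub>R X) F"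
        by (intro tendsto_intros klim XF)
      moreover have "(real (k n) * \<epsilon> n) *\<^sub>R ((1 / \<epsilon> n) *\<^sub>R nu (y n)) = real (k n) *\<^sub>R nu (y n)" for n
        using \<epsilon>(1)[of n] by simp
      ultimately have kX: "((\<lambda>n. real (k n) *\<^sub>R nu (y n)) \<longlongrightarrow> s *\<^sub>R X) F" by (simp only:)
      have "((\<lambda>n. norm ((1 / \<epsilon> n) *\<^sub>R nu (y n))) \<longlongrightarrow> norm X) F" by (intro tendsto_intros XF)
      then have "\<forall>\<^sub>F n in F. norm ((1 / \<epsilon> n) *\<^sub>R nu (y n)) < N"
        by (rule order_tendstoD) (simp add: N_def)
      then have small: "\<forall>\<^sub>F n in F. real (k n) * norm (nu (y n)) \<le> s * N"
      proof eventually_elim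
        case (elim n)
        then have "norm (nu (y n)) \<le> \<epsilon> n * N" using \<epsilon>(1)[of n] by (simp add: field_simps)
        then have "real (k n) * norm (nu (y n)) \<le> real (k n) * (\<epsilon> n * N)" by (intro mult_left_mono) auto
        also have "\<dots> \<le> s * N" using mult_right_mono[OF kle[of n], of N] N by (simp add: mult.assoc)
        finally show ?case .
      qed
      have sN: "2 * (s * N) < r"
      proof -
        have "s * N \<le> s0 * N" using s N by (intro mult_right_mono) auto
        also have "\<dots> = r / 4" using N by (simp add: s0_def)
        finally show ?thesis using r by simp
      qed
      have est: "\<forall>\<^sub>F n in F. z n s \<in> C \<and> norm (nu (z n s) - real (k n) *\<^sub>R nu (y n)) \<le> \<epsilon>0 * s"
        using small
      proof eventually_elim
        case (elim n)
        have "2 * real (k n) * norm (nu (y n)) < r" using elim sN by simp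
        from pow_estimate[OF \<delta>(1,2) rr y(2) this]
        have p: "z n s \<in> D" "norm (nu (z n s) - real (k n) *\<^sub>R nu (y n)) \<le> \<delta> * (real (k n) * norm (nu (y n)))"
          by (simp_all add: zk)
        have d1: "\<delta> * (real (k n) * norm (nu (y n))) \<le> 1 * (real (k n) * norm (nu (y n)))"
          by (rule mult_right_mono) (use \<delta> in auto)
        have d2: "\<delta> * (real (k n) * norm (nu (y n))) \<le> \<delta> * (s * N)" using elim \<delta>(1) by simp
        have d3: "\<delta> * (s * N) \<le> \<epsilon>0 * s" using mult_right_mono[OF \<delta>(3) s(1)] by (simp add: ac_simps)
        have "norm (nu (z n s)) \<le> norm (nu (z n s) - real (k n) *\<^sub>R nu (y n)) + real (k n) * norm (nu (y n))"
          using norm_triangle_ineq[of "nu (z n s) - real (k n) *\<^sub>R nu (y n)" "real (k n) *\<^sub>R nu (y n)"] by simp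
        then have "norm (nu (z n s)) \<le> r" using p(2) d1 elim sN by linarith
        then have "\<phi> (z n s) \<in> cball e r" by (simp add: nu_def dist_norm norm_minus_commute)
        then have "\<psi> (\<phi> (z n s)) \<in> C" unfolding C_def by blast
        then have "z n s \<in> C" using p(1) by simp
        then show ?case using p(2) d2 d3 by linarith
      qed
      have "\<gamma> s \<in> C"
        by (rule Lim_in_closed_set[OF closedC _ F(1) zlim[of s]]) (use est in \<open>auto elim: eventually_mono\<close>)
      then have gD: "\<gamma> s \<in> D" using CD by blast
      have "((\<lambda>n. \<phi> (z n s)) \<longlongrightarrow> \<phi> (\<gamma> s)) F"
        by (rule tendsto_chart[OF chart zlim gD]) (use zT T.subset in auto)
      then have "((\<lambda>n. norm ((\<phi> (z n s) - e) - real (k n) *\<^sub>R nu (y n))) \<longlongrightarrow> norm ((\<phi> (\<gamma> s) - e) - s *\<^sub>R X)) F"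
        by (intro tendsto_intros kX)
      then have "norm ((\<phi> (\<gamma> s) - e) - s *\<^sub>R X) \<le> \<epsilon>0 * s"
        by (rule tendsto_upperbound[OF _ _ F(1)])
          (use est in \<open>auto elim!: eventually_mono simp: nu_def\<close>)
      then show ?thesis using gD by (simp add: nu_def)
    qed
    with s0 show "\<exists>s0>0. \<forall>s. 0 \<le> s \<and> s \<le> s0 \<longrightarrow> \<gamma> s \<in> D \<and> norm (nu (\<gamma> s) - s *\<^sub>R X) \<le> \<epsilon>0 * s" by blast
  qed
  then have "one_param T \<gamma> X" by (rule one_paramI[OF _ T.subset \<gamma>T hom])
  then show ?thesis by blast
qed

text \<open>In the whole group there are points with the exact coordinates e + \<epsilon> X, so
  every direction is a velocity. The step sizes are scaled by norm X + 1 to keep these points in the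
  chart.\<close>

lemma exp_exists: "\<exists>\<gamma>. one_param (carrier G) \<gamma> X"
proof -
  obtain r where r: "r > 0" "cball e r \<subseteq> \<phi> ` D" using phi_ball .
  define N where "N = norm X + 1"
  have N: "N > 0" using norm_ge_zero[of X] unfolding N_def by linarith
  define \<epsilon> where "\<epsilon> n = (r / N) / real (Suc n)" for n
  have \<epsilon>: "\<epsilon> n > 0" "\<epsilon> n * norm X \<le> r" for n
  proof -
    show "\<epsilon> n > 0" using r N by (simp add: \<epsilon>_def)
    have "\<epsilon> n \<le> r / N" using r N divide_left_mono[of 1 "real (Suc n)" "r / N"] by (simp add: \<epsilon>_def)
    then have "\<epsilon> n * norm X \<le> (r / N) * N" using r N by (intro mult_mono) (auto simp: N_def)
    then show "\<epsilon> n * norm X \<le> r" using N by simp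
  qed
  have in_ball: "e + \<epsilon> n *\<^sub>R X \<in> \<phi> ` D" for n
    using r(2) \<epsilon>[of n] by (auto simp: dist_norm subset_iff)
  have lim: "\<epsilon> \<longlonglongrightarrow> 0"
    unfolding \<epsilon>_def by (rule LIMSEQ_Suc[OF lim_const_over_n])
  show ?thesis
  proof (rule one_param_exists[of _ "\<lambda>n. \<psi> (e + \<epsilon> n *\<^sub>R X)" \<epsilon>])
    show "subgroup (carrier G) G" by (rule subgroup_self)
    have "(1 / \<epsilon> n) *\<^sub>R nu (\<psi> (e + \<epsilon> n *\<^sub>R X)) = X" for n
      using in_ball[of n] \<epsilon>(1)[of n] by (simp add: nu_def)
    then show "(\<lambda>n. (1 / \<epsilon> n) *\<^sub>R nu (\<psi> (e + \<epsilon> n *\<^sub>R X))) \<longlonglongrightarrow> X" by simp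
  qed (use in_ball \<epsilon>(1) lim compact_carrier in auto)
qed

end

lemma has_vector_derivative_shift:
  fixes f :: "real \<Rightarrow> 'b::real_normed_vector"
  assumes "((\<lambda>h. f (s + h)) has_vector_derivative y) (at 0)"
  shows "(f has_vector_derivative y) (at s)"
proof -
  have 1: "((\<lambda>h. f (s + h)) has_derivative (\<lambda>r. r *\<^sub>R y)) (at (s - s))"
    using assms by (simp add: has_vector_derivative_def)
  have "((\<lambda>x. f (s + (x - s))) has_derivative (\<lambda>r. r *\<^sub>R y)) (at s)"
    by (rule has_derivative_compose[of "\<lambda>x. x - s" "\<lambda>r. r", OF _ 1]) (auto intro!: derivative_eq_intros)
  then show ?thesis by (simp add: has_vector_derivative_def)
qed

section \<open>The adjoint action along one-parameter subgroups, and their uniqueness\<close>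

context compact_lie_group
begin

lemma velocity_tendsto_nhds: assumes "velocity \<gamma> X" shows "(\<gamma> \<longlongrightarrow> \<one>) (nhds 0)"
  using velocity_tendsto[OF assms] velocity_zero[OF assms] by (metis tendsto_at_iff_tendsto_nhds)

lemma one_param_facts:
  assumes "one_param T \<gamma> X" "T \<subseteq> carrier G"
  shows "velocity \<gamma> X" "\<gamma> s \<in> T" "\<gamma> s \<in> carrier G" "\<gamma> (s + r) = \<gamma> s \<otimes> \<gamma> r" "\<gamma> 0 = \<one>"
  using assms one_param_velocity[OF assms] velocity_zero by (auto simp: one_param_def)

lemma translate_velocity:
  assumes v: "velocity \<gamma> X" and c: "\<And>s. \<gamma> s \<in> carrier G"
    and a: "a \<in> carrier G" and b: "b \<in> carrier G"
    and d: "((\<lambda>x. \<phi> (a \<otimes> \<psi> x \<otimes> b)) has_derivative f') (at e)"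
  shows "((\<lambda>s. \<phi> (a \<otimes> \<gamma> s \<otimes> b)) has_vector_derivative f' X) (at 0)"
proof -
  have 1: "((\<lambda>s. \<phi> (\<gamma> s)) has_derivative (\<lambda>s. s *\<^sub>R X)) (at 0)"
    using velocity_has_vector_derivative[OF v] by (simp add: has_vector_derivative_def)
  have 2: "((\<lambda>s. \<phi> (a \<otimes> \<psi> (\<phi> (\<gamma> s)) \<otimes> b)) has_derivative (\<lambda>s. f' (s *\<^sub>R X))) (at 0)"
    by (rule has_derivative_compose[of "\<lambda>s. \<phi> (\<gamma> s)", OF 1]) (simp add: velocity_zero[OF v] d)
  have ev: "\<forall>\<^sub>F s in nhds 0. \<phi> (a \<otimes> \<psi> (\<phi> (\<gamma> s)) \<otimes> b) = \<phi> (a \<otimes> \<gamma> s \<otimes> b)"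
    using velocity_eventually_D[OF v] by eventually_elim simp
  have "((\<lambda>s. \<phi> (a \<otimes> \<gamma> s \<otimes> b)) has_derivative (\<lambda>s. f' (s *\<^sub>R X))) (at 0)"
    by (rule has_derivative_transform_eventually[OF 2])
      (use ev eventually_nhds_x_imp_x[OF ev] in \<open>auto simp: eventually_nhds_conv_at\<close>)
  then show ?thesis
    unfolding has_vector_derivative_def linear_scale[OF has_derivative_linear[OF d]] .
qed

lemma velocity_conj:
  assumes v: "velocity \<gamma> X" and c: "\<And>s. \<gamma> s \<in> carrier G" and a: "a \<in> carrier G"
  shows "velocity (\<lambda>s. a \<otimes> \<gamma> s \<otimes> inv a) (Ad a X)"
proof (rule velocityI)
  show "((\<lambda>s. \<phi> (a \<otimes> \<gamma> s \<otimes> inv a)) has_vector_derivative Ad a X) (at 0)"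
    by (rule translate_velocity[OF v c a inv_closed[OF a] conj_has_derivative[OF a]])
  show "a \<otimes> \<gamma> 0 \<otimes> inv a = \<one>" using velocity_zero[OF v] a by simp
  have 1: "((\<lambda>s. a \<otimes> \<gamma> s) \<longlongrightarrow> a \<otimes> \<one>) (nhds 0)"
    by (rule tendsto_mult_carrier[OF tendsto_const velocity_tendsto_nhds[OF v]]) (use a c in auto)
  have "((\<lambda>s. a \<otimes> \<gamma> s \<otimes> inv a) \<longlongrightarrow> a \<otimes> \<one> \<otimes> inv a) (nhds 0)"
    by (rule tendsto_mult_carrier[OF 1 tendsto_const]) (use a c in auto)
  then show "\<forall>\<^sub>F s in nhds 0. a \<otimes> \<gamma> s \<otimes> inv a \<in> D"
    by (rule eventually_chart[OF chart]) (use a c one_in_D in auto)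
qed

lemma Ad_along:
  assumes v: "velocity \<gamma> X"
  shows "((\<lambda>s. Ad (\<gamma> s) Y) has_vector_derivative br X Y) (at 0)"
proof -
  have 1: "((\<lambda>s. \<phi> (\<gamma> s)) has_derivative (\<lambda>s. s *\<^sub>R X)) (at 0)"
    using velocity_has_vector_derivative[OF v] by (simp add: has_vector_derivative_def)
  have 2: "((\<lambda>s. Ad (\<psi> (\<phi> (\<gamma> s))) Y) has_derivative (\<lambda>s. br (s *\<^sub>R X) Y)) (at 0)"
    by (rule has_derivative_compose[of "\<lambda>s. \<phi> (\<gamma> s)", OF 1]) (simp add: velocity_zero[OF v] Ad_has_derivative_br)
  have ev: "\<forall>\<^sub>F s in nhds 0. Ad (\<psi> (\<phi> (\<gamma> s))) Y = Ad (\<gamma> s) Y"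
    using velocity_eventually_D[OF v] by eventually_elim simp
  have "((\<lambda>s. Ad (\<gamma> s) Y) has_derivative (\<lambda>s. br (s *\<^sub>R X) Y)) (at 0)"
    by (rule has_derivative_transform_eventually[OF 2])
      (use ev eventually_nhds_x_imp_x[OF ev] in \<open>auto simp: eventually_nhds_conv_at\<close>)
  then show ?thesis
    unfolding has_vector_derivative_def linear_scale[OF linear_br_left] .
qed

text \<open>The derivative of Ad (\<gamma> s) Y is Ad (\<gamma> s) [X, Y], which vanishes.\<close>

lemma Ad_one_param_fixed:
  assumes g: "one_param T \<gamma> X" "T \<subseteq> carrier G" and z: "br X Y = 0"
  shows "Ad (\<gamma> s) Y = Y"
proof -
  note f = one_param_facts[OF g]
  have d: "((\<lambda>s. Ad (\<gamma> s) Y) has_vector_derivative 0) (at s)" for s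
  proof (rule has_vector_derivative_shift)
    have "((\<lambda>h. Ad (\<gamma> s) (Ad (\<gamma> h) Y)) has_vector_derivative Ad (\<gamma> s) (br X Y)) (at 0)"
      using bounded_linear.has_vector_derivative[OF _ Ad_along[OF f(1)]] linear_Ad[OF f(3)] linear_linear by blast
    then show "((\<lambda>h. Ad (\<gamma> (s + h)) Y) has_vector_derivative 0) (at 0)"
      using f(3) by (simp add: z f(4) Ad_mult linear_0[OF linear_Ad[OF f(3)]])
  qed
  obtain c where "\<And>s. s \<in> UNIV \<Longrightarrow> Ad (\<gamma> s) Y = c"
    using has_vector_derivative_zero_constant[of UNIV "\<lambda>s. Ad (\<gamma> s) Y"] d by auto
  then have "Ad (\<gamma> s) Y = Ad (\<gamma> 0) Y" by simp
  then show ?thesis by (simp add: f(5) Ad_one)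
qed

text \<open>The quotient \<eta> s = \<gamma> (- s) \<gamma>' s satisfies \<eta> (s + h) = \<gamma>
  (- s) (\<gamma> (- h) \<gamma>' h) \<gamma>' s, whose inner factor has velocity -X + X = 0. So
  \<eta> is locally constant near every parameter where it is the identity, and the set of these
  parameters is open and closed in the real line.\<close>

lemma one_param_unique:
  assumes g: "one_param (carrier G) \<gamma> X" and h: "one_param (carrier G) \<gamma>' X"
  shows "\<gamma> s = \<gamma>' s"
proof -
  note f = one_param_facts[OF g subset_refl] and f' = one_param_facts[OF h subset_refl]
  define \<eta> where "\<eta> s = \<gamma> (- s) \<otimes> \<gamma>' s" for s
  have c: "\<eta> s \<in> carrier G" for s using f(3) f'(3) by (simp add: \<eta>_def)
  have cg: "(\<gamma> \<longlongrightarrow> \<gamma> s) (at s)" "(\<gamma>' \<longlongrightarrow> \<gamma>' s) (at s)" for s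
    using g h by (auto simp: one_param_def continuous_on_def)
  have cont: "isCont \<eta> s" for s
  proof -
    have "isCont \<gamma> (- s)" using cg by (simp add: isCont_def)
    then have "((\<lambda>s. \<gamma> (- s)) \<longlongrightarrow> \<gamma> (- s)) (at s)"
      using isCont_o2[OF continuous_minus[OF continuous_ident], of s \<gamma>] by (simp add: isCont_def)
    then have "((\<lambda>s. \<gamma> (- s) \<otimes> \<gamma>' s) \<longlongrightarrow> \<gamma> (- s) \<otimes> \<gamma>' s) (at s)"
      by (rule tendsto_mult_carrier[OF _ cg(2)]) (use f(3) f'(3) in auto)
    then show ?thesis by (simp add: isCont_def \<eta>_def[abs_def])
  qed
  have w: "velocity (\<lambda>h. \<gamma> (- 1 * h) \<otimes> \<gamma>' h) 0"
    using velocity_mult[OF velocity_scale[OF f(1), of "- 1"] f'(1)] by simp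
  have der: "((\<lambda>s. \<phi> (\<eta> s)) has_vector_derivative 0) (at s)" if eD: "\<eta> s \<in> D" for s
  proof (rule has_vector_derivative_shift)
    let ?a = "\<gamma> (- s)" and ?b = "\<gamma>' s"
    obtain f0 where f0: "((\<lambda>x. \<phi> (?a \<otimes> \<psi> x \<otimes> ?b)) has_derivative f0) (at e)"
      using translate_differentiable[OF f(3) f'(3) eD[unfolded \<eta>_def]] unfolding differentiable_def by blast
    have "((\<lambda>h. \<phi> (?a \<otimes> (\<gamma> (- 1 * h) \<otimes> \<gamma>' h) \<otimes> ?b)) has_vector_derivative f0 0) (at 0)"
      by (rule translate_velocity[OF w _ _ _ f0]) (use f(3) f'(3) in auto)
    moreover have "?a \<otimes> (\<gamma> (- 1 * h) \<otimes> \<gamma>' h) \<otimes> ?b = \<eta> (s + h)" for h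
    proof -
      have "\<gamma> (- (s + h)) = ?a \<otimes> \<gamma> (- h)" using f(4)[of "- s" "- h"] by simp
      moreover have "\<gamma>' (s + h) = \<gamma>' h \<otimes> ?b" using f'(4)[of h s] by (simp add: add.commute)
      ultimately show ?thesis using f(3) f'(3) by (simp add: \<eta>_def m_assoc)
    qed
    moreover have "f0 0 = 0" using linear_0[OF has_derivative_linear[OF f0]] .
    ultimately show "((\<lambda>h. \<phi> (\<eta> (s + h))) has_vector_derivative 0) (at 0)" by simp
  qed
  have "open {s. \<eta> s = \<one>}"
    unfolding open_contains_ball
  proof (intro ballI)
    fix s0 assume "s0 \<in> {s. \<eta> s = \<one>}"
    then have s0: "\<eta> s0 = \<one>" by simp
    have "(\<eta> \<longlongrightarrow> \<eta> s0) (nhds s0)" using cont[of s0] isCont_def tendsto_at_iff_tendsto_nhds by blast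
    then have "\<forall>\<^sub>F s in nhds s0. \<eta> s \<in> D"
      by (rule eventually_chart[OF chart]) (use s0 one_in_D c in auto)
    then obtain d where d: "d > 0" "\<And>s. dist s s0 < d \<Longrightarrow> \<eta> s \<in> D" unfolding eventually_nhds_metric by blast
    obtain k where k: "\<And>s. s \<in> ball s0 d \<Longrightarrow> \<phi> (\<eta> s) = k"
      by (rule has_vector_derivative_zero_constant[of "ball s0 d" "\<lambda>s. \<phi> (\<eta> s)"])
        (use d der in \<open>auto simp: dist_commute intro: has_vector_derivative_at_within\<close>)
    have "\<eta> s = \<one>" if "s \<in> ball s0 d" for s
    proof -
      have "\<phi> (\<eta> s) = \<phi> (\<eta> s0)" using k[OF that] k[of s0] d(1) by simp
      then have "\<psi> (\<phi> (\<eta> s)) = \<psi> (\<phi> (\<eta> s0))" by simp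
      then show ?thesis using d(2)[of s] that s0 one_in_D by (simp add: dist_commute)
    qed
    then show "\<exists>d>0. ball s0 d \<subseteq> {s. \<eta> s = \<one>}" using d(1) by blast
  qed
  moreover have "closed {s. \<eta> s = \<one>}"
    using continuous_closed_vimage[of "{\<one>}" \<eta>] cont by (simp add: vimage_def)
  moreover have "\<eta> 0 = \<one>" using f(5) f'(5) by (simp add: \<eta>_def)
  ultimately have "{s. \<eta> s = \<one>} = UNIV" using clopen[of "{s. \<eta> s = \<one>}"] by auto
  then have 1: "\<gamma> (- s) \<otimes> \<gamma>' s = \<one>" unfolding \<eta>_def by blast
  have "\<gamma> s = \<gamma> s \<otimes> (\<gamma> (- s) \<otimes> \<gamma>' s)" using 1 f(3) by simp
  also have "\<dots> = \<gamma> (s + - s) \<otimes> \<gamma>' s" unfolding f(4) using f(3) f'(3) by (simp add: m_assoc)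
  also have "\<dots> = \<gamma>' s" using f(5) f'(3) by simp
  finally show ?thesis .
qed

lemma conj_one_param:
  assumes g: "one_param (carrier G) \<gamma> X" and a: "a \<in> carrier G"
  shows "one_param (carrier G) (\<lambda>s. a \<otimes> \<gamma> s \<otimes> inv a) (Ad a X)"
proof -
  note f = one_param_facts[OF g subset_refl]
  show ?thesis
  proof (rule one_paramI[OF velocity_conj[OF f(1,3) a] subset_refl])
    fix s r
    have "inv a \<otimes> (a \<otimes> x) = x" if "x \<in> carrier G" for x
      using a that by (simp add: m_assoc[symmetric])
    then show "a \<otimes> \<gamma> (s + r) \<otimes> inv a = a \<otimes> \<gamma> s \<otimes> inv a \<otimes> (a \<otimes> \<gamma> r \<otimes> inv a)"
      using a f(3) by (simp add: f(4) m_assoc)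
  qed (use a f(3) in simp)
qed

end

section \<open>Maximal tori and the Killing form\<close>

locale compact_lie_group_torus = compact_lie_group +
  fixes T
  assumes max_torus: "maximal_torus G T"
begin

section \<open>The Lie algebra of a maximal torus\<close>

definition t where "t = subgroup_lie_algebra G (D, \<phi>) T"

lemma torus: "subgroup T G" "compact T" "connected T" "T \<subseteq> carrier G" "closed T"
  and T_comm: "x \<in> T \<Longrightarrow> y \<in> T \<Longrightarrow> x \<otimes> y = y \<otimes> x"
proof -
  show 1: "subgroup T G" "compact T" "connected T" "x \<in> T \<Longrightarrow> y \<in> T \<Longrightarrow> x \<otimes> y = y \<otimes> x"
    using max_torus by (auto simp: maximal_torus_def torus_in_def)
  show "T \<subseteq> carrier G" "closed T" using 1 subgroup.subset compact_imp_closed by blast+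
qed

lemma t_iff: "X \<in> t \<longleftrightarrow> (\<exists>\<gamma>. one_param T \<gamma> X)"
  by (simp add: t_def subgroup_lie_algebra_eq)

lemmas T_facts = one_param_facts[OF _ torus(4)]

text \<open>Commutativity of \<open>T\<close> makes the product of two one-parameter subgroups a
  one-parameter subgroup, whose velocity is the sum.\<close>

lemma subspace_t: "subspace t"
proof (rule subspaceI)
  interpret T: subgroup T G by (rule torus(1))
  have "velocity (\<lambda>_. \<one>) 0" using one_in_D by (auto simp: velocity_def intro!: exI[of _ 1])
  from one_paramI[OF this torus(4)] show "0 \<in> t" unfolding t_iff by fastforce
  fix X Y assume "X \<in> t" "Y \<in> t"
  then obtain \<gamma> \<eta> where o: "one_param T \<gamma> X" "one_param T \<eta> Y" by (auto simp: t_iff)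
  note f = T_facts[OF o(1)] and f' = T_facts[OF o(2)]
  have "one_param T (\<lambda>s. \<gamma> s \<otimes> \<eta> s) (X + Y)"
  proof (rule one_paramI[OF velocity_mult[OF f(1) f'(1)] torus(4)])
    fix s r
    have "\<gamma> r \<otimes> \<eta> s = \<eta> s \<otimes> \<gamma> r" using T_comm f(2) f'(2) by blast
    then have "\<gamma> s \<otimes> (\<gamma> r \<otimes> \<eta> s) \<otimes> \<eta> r = \<gamma> s \<otimes> (\<eta> s \<otimes> \<gamma> r) \<otimes> \<eta> r" by simp
    then show "\<gamma> (s + r) \<otimes> \<eta> (s + r) = \<gamma> s \<otimes> \<eta> s \<otimes> (\<gamma> r \<otimes> \<eta> r)"
      using f(3) f'(3) by (simp add: f(4) f'(4) m_assoc)
  qed (use f(2) f'(2) in simp)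
  then show "X + Y \<in> t" by (auto simp: t_iff)
next
  fix c X assume "X \<in> t"
  then obtain \<gamma> where o: "one_param T \<gamma> X" by (auto simp: t_iff)
  note f = T_facts[OF o]
  have "one_param T (\<lambda>s. \<gamma> (c * s)) (c *\<^sub>R X)"
    by (rule one_paramI[OF velocity_scale[OF f(1)] torus(4) f(2)]) (simp add: distrib_left f(4))
  then show "c *\<^sub>R X \<in> t" by (auto simp: t_iff)
qed

text \<open>Conjugation by \<open>a\<close> leaves the one-parameter subgroup of \<open>Y\<close>
  pointwise fixed, and a curve has only one velocity.\<close>

lemma Ad_t: assumes a: "a \<in> T" and Y: "Y \<in> t" shows "Ad a Y = Y"
proof -
  obtain \<gamma> where o: "one_param T \<gamma> Y" using Y by (auto simp: t_iff)
  note f = T_facts[OF o]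
  have ac: "a \<in> carrier G" using a torus(4) by blast
  have "a \<otimes> \<gamma> s \<otimes> inv a = \<gamma> s" for s
    using T_comm[OF a f(2)] ac f(3) by (simp add: m_assoc)
  then have "velocity \<gamma> (Ad a Y)" using velocity_conj[OF f(1,3) ac] by simp
  then show ?thesis using velocity_unique f(1) by blast
qed

lemma t_abelian: assumes "X \<in> t" "Y \<in> t" shows "br X Y = 0"
proof -
  obtain \<gamma> where o: "one_param T \<gamma> X" using assms by (auto simp: t_iff)
  note f = T_facts[OF o]
  have "((\<lambda>s. Y) has_vector_derivative br X Y) (at 0)"
    using Ad_along[OF f(1), of Y] by (simp add: Ad_t[OF f(2) assms(2)])
  then show ?thesis using has_vector_derivative_const vector_derivative_unique_at by blast
qed

section \<open>The part of the torus that acts trivially on the centralizer\<close>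

definition zt where "zt = {X. \<forall>H\<in>t. br H X = 0}"

definition K where "K = {a \<in> T. \<forall>X\<in>zt. Ad a X = X}"

lemma K_subgroup: "subgroup K G"
proof -
  interpret T: subgroup T G by (rule torus(1))
  show ?thesis
  proof
    show "K \<subseteq> carrier G" using torus(4) by (auto simp: K_def)
    show "\<one> \<in> K" by (simp add: K_def Ad_one)
    fix x assume x: "x \<in> K"
    then have xc: "x \<in> carrier G" "x \<in> T" using torus(4) by (auto simp: K_def)
    have "Ad (inv x) X = X" if "X \<in> zt" for X
      using Ad_inv(2)[OF xc(1), of X] x that by (simp add: K_def)
    then show "inv x \<in> K" using xc by (simp add: K_def)
    fix y assume y: "y \<in> K"
    then have yc: "y \<in> carrier G" "y \<in> T" using torus(4) by (auto simp: K_def)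
    show "x \<otimes> y \<in> K" using x y xc yc by (simp add: K_def Ad_mult)
  qed
qed

lemma K_compact: "compact K"
proof -
  have "closed {a \<in> T. Ad a X = X}" for X
    using continuous_closed_preimage_constant[OF continuous_on_subset[OF continuous_Ad torus(4)] torus(5), of X X] .
  then have "closed (T \<inter> (\<Inter>X\<in>zt. {a \<in> T. Ad a X = X}))" by (intro closed_Int closed_INT torus) auto
  moreover have "K = T \<inter> (\<Inter>X\<in>zt. {a \<in> T. Ad a X = X})" by (auto simp: K_def)
  ultimately have "closed K" by simp
  then show ?thesis using compact_Int_closed[OF torus(2), of K] by (simp add: K_def Int_absorb1 subset_iff Int_def)
qed

lemma one_param_in_K: assumes "one_param T \<gamma> X" shows "\<gamma> s \<in> K"
proof -
  have X: "X \<in> t" using assms t_iff by blast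
  have "Ad (\<gamma> s) Y = Y" if "Y \<in> zt" for Y
    by (rule Ad_one_param_fixed[OF assms torus(4)]) (use X that in \<open>auto simp: zt_def\<close>)
  then show ?thesis using T_facts(2)[OF assms] by (simp add: K_def)
qed

text \<open>A sequence in \<open>T - K\<close> tending to \<open>1\<close> may be replaced by the elements of smallest \<open>nu\<close> in their
  cosets of \<open>K\<close>; it is then tangent to a direction of a one-parameter subgroup of \<open>T\<close>, hence of \<open>K\<close>,
  along which it can be shortened further.\<close>

lemma K_contains_nhd: "\<exists>r>0. \<forall>a\<in>T \<inter> D. norm (nu a) < r \<longrightarrow> a \<in> K"
proof (rule ccontr)
  assume neg: "\<not> ?thesis"
  interpret K: subgroup K G by (rule K_subgroup)
  interpret T: subgroup T G by (rule torus(1))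
  have KT: "K \<subseteq> T" by (auto simp: K_def)
  obtain r0 where r0: "r0 > 0" "cball e r0 \<subseteq> \<phi> ` D" using phi_ball .
  define \<rho> where "\<rho> n = r0 / real (Suc n)" for n
  have \<rho>: "\<rho> n > 0" "\<rho> n \<le> r0" for n
    using r0 divide_left_mono[of 1 "real (Suc n)" r0] by (auto simp: \<rho>_def)
  have "\<forall>n. \<exists>a\<in>T \<inter> D. norm (nu a) < \<rho> n \<and> a \<notin> K" using neg \<rho>(1) by meson
  then obtain a where a: "\<And>n. a n \<in> T" "\<And>n. a n \<in> D" "\<And>n. norm (nu (a n)) < \<rho> n" "\<And>n. a n \<notin> K"
    by (metis IntE)
  \<comment> \<open>The coset of a n meets the closed coordinate ball of radius norm (nu (a n)) in a
    nonempty compact set, so a shortest element exists there; elements of the coset that lie in the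
    chart but outside the ball are longer anyway.\<close>
  have "\<exists>y. y \<in> T \<and> y \<notin> K \<and> y \<in> D \<and> norm (nu y) \<le> norm (nu (a n)) \<and>
      (\<forall>k\<in>K. y \<otimes> k \<in> D \<longrightarrow> norm (nu y) \<le> norm (nu (y \<otimes> k)))" for n
  proof -
    let ?b = "norm (nu (a n))"
    have ac: "a n \<in> carrier G" using a(2) by blast
    define C where "C = \<psi> ` cball e ?b"
    have sub: "cball e ?b \<subseteq> \<phi> ` D" using a(3)[of n] \<rho>(2)[of n] r0(2) by (force simp: subset_iff)
    have C_iff: "y \<in> C \<longleftrightarrow> y \<in> D \<and> norm (nu y) \<le> ?b" for y
    proof
      assume "y \<in> C"
      then obtain x where x: "x \<in> cball e ?b" "y = \<psi> x" by (auto simp: C_def)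
      then have "x \<in> \<phi> ` D" using sub by blast
      then show "y \<in> D \<and> norm (nu y) \<le> ?b" using x by (auto simp: nu_def dist_norm norm_minus_commute)
    next
      assume y: "y \<in> D \<and> norm (nu y) \<le> ?b"
      then have "\<phi> y \<in> cball e ?b" by (simp add: nu_def dist_norm norm_minus_commute)
      then have "\<psi> (\<phi> y) \<in> C" unfolding C_def by blast
      then show "y \<in> C" using y by simp
    qed
    have "compact C" unfolding C_def
      by (rule compact_continuous_image[OF continuous_on_subset[OF chart_facts(7)[OF chart] sub] compact_cball])
    have "continuous_on K (\<lambda>k. (\<lambda>(x, y). x \<otimes> y) (a n, k))"
      by (rule continuous_on_compose2[OF continuous_mult])
        (use ac K.subset in \<open>auto intro!: continuous_intros\<close>)
    then have "compact ((\<lambda>k. a n \<otimes> k) ` K)" by (intro compact_continuous_image K_compact) simp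
    then have "compact ((\<lambda>k. a n \<otimes> k) ` K \<inter> C)"
      by (intro compact_Int_closed compact_imp_closed \<open>compact C\<close>)
    moreover have "a n \<in> (\<lambda>k. a n \<otimes> k) ` K \<inter> C"
      using ac a(2) K.one_closed by (auto simp: C_iff intro!: image_eqI[of _ _ \<one>])
    moreover have "continuous_on ((\<lambda>k. a n \<otimes> k) ` K \<inter> C) (\<lambda>y. norm (nu y))"
      unfolding nu_def
      by (intro continuous_intros continuous_on_subset[OF chart_facts(6)[OF chart]]) (auto simp: C_iff)
    ultimately obtain y where y: "y \<in> (\<lambda>k. a n \<otimes> k) ` K \<inter> C"
      "\<And>z. z \<in> (\<lambda>k. a n \<otimes> k) ` K \<inter> C \<Longrightarrow> norm (nu y) \<le> norm (nu z)"
      using continuous_attains_inf[of "(\<lambda>k. a n \<otimes> k) ` K \<inter> C" "\<lambda>y. norm (nu y)"] by blast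
    obtain k where k: "k \<in> K" "y = a n \<otimes> k" using y(1) by blast
    have yT: "y \<in> T" using k a(1) KT by auto
    have yK: "y \<notin> K"
    proof
      assume "y \<in> K"
      then have "y \<otimes> inv k \<in> K" using k by simp
      moreover have "y \<otimes> inv k = a n" using k ac by (simp add: m_assoc)
      ultimately show False using a(4) by simp
    qed
    have yD: "y \<in> D" "norm (nu y) \<le> ?b" using y(1) C_iff by auto
    have "norm (nu y) \<le> norm (nu (y \<otimes> h))" if h: "h \<in> K" "y \<otimes> h \<in> D" for h
    proof (cases "norm (nu (y \<otimes> h)) \<le> ?b")
      case True
      have "y \<otimes> h = a n \<otimes> (k \<otimes> h)" using k h ac by (simp add: m_assoc)
      then have "y \<otimes> h \<in> (\<lambda>k. a n \<otimes> k) ` K \<inter> C" using k h True by (auto simp: C_iff)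
      then show ?thesis by (rule y(2))
    next
      case False then show ?thesis using yD by simp
    qed
    then show ?thesis using yT yK yD by blast
  qed
  then obtain y where yT: "\<And>n. y n \<in> T" and yK: "\<And>n. y n \<notin> K" and yD: "\<And>n. y n \<in> D"
    and ya: "\<And>n. norm (nu (y n)) \<le> norm (nu (a n))"
    and ymin: "\<And>n k. k \<in> K \<Longrightarrow> y n \<otimes> k \<in> D \<Longrightarrow> norm (nu (y n)) \<le> norm (nu (y n \<otimes> k))"
    by metis
  have ypos: "norm (nu (y n)) > 0" for n
  proof -
    have "nu (y n) \<noteq> 0"
    proof
      assume "nu (y n) = 0"
      then have "\<psi> (\<phi> (y n)) = \<psi> e" by (simp add: nu_def)
      then have "y n = \<one>" using yD by simp
      then show False using yK[of n] K.one_closed by simp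
    qed
    then show ?thesis by simp
  qed
  have ylim: "(\<lambda>n. norm (nu (y n))) \<longlonglongrightarrow> 0"
  proof (rule Lim_null_comparison)
    have "norm (nu (y n)) \<le> \<rho> n" for n using ya[of n] a(3)[of n] by linarith
    then show "\<forall>\<^sub>F n in sequentially. norm (norm (nu (y n))) \<le> \<rho> n" by simp
    show "\<rho> \<longlonglongrightarrow> 0" unfolding \<rho>_def by (rule LIMSEQ_Suc[OF lim_const_over_n])
  qed
  \<comment> \<open>Rescaling the short elements to unit length produces, by compactness of the
    sphere, a limiting tangent direction.\<close>
  define u where "u n = (1 / norm (nu (y n))) *\<^sub>R nu (y n)" for n
  have "u n \<in> sphere 0 1" for n using ypos[of n] by (simp add: u_def)
  then obtain \<xi> \<sigma> where \<xi>: "\<xi> \<in> sphere 0 1" "strict_mono \<sigma>" "(u \<circ> \<sigma>) \<longlonglongrightarrow> \<xi>"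
    using compact_sphere[of 0 1] unfolding compact_def by metis
  define w where "w n = y (\<sigma> n)" for n
  define \<epsilon> where "\<epsilon> n = norm (nu (w n))" for n
  have \<epsilon>: "\<epsilon> n > 0" "\<epsilon> \<longlonglongrightarrow> 0" for n
    using ypos LIMSEQ_subseq_LIMSEQ[OF ylim \<xi>(2)] by (auto simp: \<epsilon>_def[abs_def] w_def o_def)
  have wX: "(\<lambda>n. (1 / \<epsilon> n) *\<^sub>R nu (w n)) \<longlonglongrightarrow> \<xi>" using \<xi>(3) by (simp add: u_def \<epsilon>_def w_def o_def)
  obtain \<gamma> where \<gamma>: "one_param T \<gamma> \<xi>"
    using one_param_exists[OF torus(1,2) _ _ \<epsilon> wX] yT yD unfolding w_def by blast
  note f = T_facts[OF \<gamma>]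
  \<comment> \<open>With s the length of w n, the element k = \<gamma> (- s) has length at most 9/8
    s. The product error is at most half of that and the two approximation errors are at most s/8
    each, so w n k has length at most 13/16 s, contradicting minimality.\<close>
  obtain r where r: "r > 0" "\<And>a b. a \<in> D \<Longrightarrow> b \<in> D \<Longrightarrow> norm (nu a) < r \<Longrightarrow> norm (nu b) < r \<Longrightarrow>
    a \<otimes> b \<in> D \<and> norm (nu (a \<otimes> b) - nu a - nu b) \<le> 1 / 2 * norm (nu b)"
    using mult_estimate[of "1 / 2"] by auto
  have "velocity (\<lambda>s. \<gamma> (- 1 * s)) (- 1 *\<^sub>R \<xi>)" by (rule velocity_scale[OF f(1)])
  then obtain s0 where s0: "s0 > 0"
    "\<And>s. \<bar>s\<bar> \<le> s0 \<Longrightarrow> \<gamma> (- s) \<in> D \<and> norm (nu (\<gamma> (- s)) + s *\<^sub>R \<xi>) \<le> 1 / 8 * \<bar>s\<bar>"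
  proof -
    assume *: "velocity (\<lambda>s. \<gamma> (- 1 * s)) (- 1 *\<^sub>R \<xi>)"
    show thesis using *[unfolded velocity_def, rule_format, of "1 / 8"] that by auto
  qed
  have "\<forall>\<^sub>F n in sequentially. dist ((1 / \<epsilon> n) *\<^sub>R nu (w n)) \<xi> < 1 / 8 \<and> \<epsilon> n < s0 \<and> \<epsilon> n < r / 2"
    using tendstoD[OF wX, of "1 / 8"] order_tendstoD(2)[OF \<epsilon>(2) s0(1)] order_tendstoD(2)[OF \<epsilon>(2), of "r / 2"] r(1)
    by (simp add: eventually_conj_iff)
  then obtain n where n: "dist ((1 / \<epsilon> n) *\<^sub>R nu (w n)) \<xi> < 1 / 8" "\<epsilon> n < s0" "\<epsilon> n < r / 2"
    by (metis (no_types, lifting) eventually_happens sequentially_bot)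
  let ?s = "\<epsilon> n" and ?k = "\<gamma> (- \<epsilon> n)"
  have k: "?k \<in> D" "norm (nu ?k + ?s *\<^sub>R \<xi>) \<le> 1 / 8 * ?s" using s0(2)[of ?s] n(2) \<epsilon>(1)[of n] by auto
  have "nu (w n) - ?s *\<^sub>R \<xi> = ?s *\<^sub>R ((1 / ?s) *\<^sub>R nu (w n) - \<xi>)"
    using \<epsilon>(1)[of n] by (simp add: scaleR_diff_right)
  then have wn: "norm (nu (w n) - ?s *\<^sub>R \<xi>) \<le> 1 / 8 * ?s"
    using n(1) \<epsilon>(1)[of n] mult_left_mono[of "norm ((1 / ?s) *\<^sub>R nu (w n) - \<xi>)" "1 / 8" ?s]
    by (simp add: dist_norm)
  have "norm (nu ?k) \<le> norm (nu ?k + ?s *\<^sub>R \<xi>) + norm (?s *\<^sub>R \<xi>)"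
    using norm_triangle_ineq4[of "nu ?k + ?s *\<^sub>R \<xi>" "?s *\<^sub>R \<xi>"] by simp
  then have nk: "norm (nu ?k) \<le> 9 / 8 * ?s" using k(2) \<xi>(1) \<epsilon>(1)[of n] by simp
  have nw: "norm (nu (w n)) = ?s" by (simp add: \<epsilon>_def)
  have wD: "w n \<in> D" by (simp add: w_def yD)
  have "norm (nu ?k) < r" "norm (nu (w n)) < r" using nk nw n(3) r(1) by linarith+
  then have m: "w n \<otimes> ?k \<in> D" "norm (nu (w n \<otimes> ?k) - nu (w n) - nu ?k) \<le> 1 / 2 * norm (nu ?k)"
    using r(2)[OF wD k(1)] by auto
  have "nu (w n \<otimes> ?k) = (nu (w n \<otimes> ?k) - nu (w n) - nu ?k) + ((nu (w n) - ?s *\<^sub>R \<xi>) + (nu ?k + ?s *\<^sub>R \<xi>))"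
    by simp
  then have "norm (nu (w n \<otimes> ?k)) \<le> 1 / 2 * norm (nu ?k) + (1 / 8 * ?s + 1 / 8 * ?s)"
    using m(2) wn k(2) norm_triangle_mono by metis
  also have "\<dots> < ?s" using nk \<epsilon>(1)[of n] by linarith
  finally have "norm (nu (w n \<otimes> ?k)) < norm (nu (w n))" using nw by simp
  moreover have "norm (nu (w n)) \<le> norm (nu (w n \<otimes> ?k))"
    using ymin[OF one_param_in_K[OF \<gamma>], of "\<sigma> n"] m(1) by (simp add: w_def)
  ultimately show False by simp
qed

text \<open>A subgroup containing a neighbourhood of the identity is open; \<open>K\<close> is also
  closed, and \<open>T\<close> is connected.\<close>

lemma K_eq_T: "K = T"
proof -
  interpret K: subgroup K G by (rule K_subgroup)
  interpret T: subgroup T G by (rule torus(1))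
  have KT: "K \<subseteq> T" by (auto simp: K_def)
  obtain r where r: "r > 0" "\<And>a. a \<in> T \<Longrightarrow> a \<in> D \<Longrightarrow> norm (nu a) < r \<Longrightarrow> a \<in> K"
    using K_contains_nhd by blast
  have "openin (top_of_set D) (D \<inter> \<phi> -` ball e r)"
    by (rule continuous_openin_preimage_gen[OF chart_facts(6)[OF chart] open_ball])
  then have "openin (top_of_set (carrier G)) (D \<inter> \<phi> -` ball e r)"
    using chart_facts(1)[OF chart] openin_trans by blast
  then obtain O1 where O1: "open O1" "D \<inter> \<phi> -` ball e r = carrier G \<inter> O1" by (auto simp: openin_open)
  have one: "\<one> \<in> O1" using O1(2) one_in_D r(1) by force
  have "openin (top_of_set T) K"
  proof (subst openin_subopen, intro ballI)
    fix a assume a: "a \<in> K"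
    have ac: "a \<in> carrier G" using a K.subset by blast
    have "continuous_on T (\<lambda>k. (\<lambda>(x, y). x \<otimes> y) (inv a, k))"
      by (rule continuous_on_compose2[OF continuous_mult])
        (use ac T.subset in \<open>auto intro!: continuous_intros\<close>)
    then have c: "continuous_on T (\<lambda>k. inv a \<otimes> k)" by simp
    have op: "openin (top_of_set T) (T \<inter> (\<lambda>k. inv a \<otimes> k) -` O1)"
      by (rule continuous_openin_preimage_gen[OF c O1(1)])
    moreover have "a \<in> T \<inter> (\<lambda>k. inv a \<otimes> k) -` O1" using a KT ac one by auto
    moreover have "T \<inter> (\<lambda>k. inv a \<otimes> k) -` O1 \<subseteq> K"
    proof
      fix b assume b: "b \<in> T \<inter> (\<lambda>k. inv a \<otimes> k) -` O1"
      have bc: "b \<in> carrier G" using b T.subset by blast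
      have ab: "inv a \<otimes> b \<in> T" using a b KT by auto
      have "inv a \<otimes> b \<in> D \<inter> \<phi> -` ball e r" unfolding O1(2) using b ac bc by auto
      then have "inv a \<otimes> b \<in> D" "norm (nu (inv a \<otimes> b)) < r"
        by (auto simp: nu_def dist_norm norm_minus_commute)
      then have "inv a \<otimes> b \<in> K" using r(2) ab by blast
      then have "a \<otimes> (inv a \<otimes> b) \<in> K" using a by blast
      then show "b \<in> K" using ac bc by (simp add: m_assoc[symmetric])
    qed
    ultimately show "\<exists>S. openin (top_of_set T) S \<and> a \<in> S \<and> S \<subseteq> K" by blast
  qed
  moreover have "closedin (top_of_set T) K"
    using compact_imp_closed[OF K_compact] KT by (simp add: closed_subset)
  ultimately show ?thesis using torus(3) K.one_closed unfolding connected_clopen by blast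
qed

text \<open>An element fixed by \<open>Ad T\<close> generates a one-parameter group commuting with \<open>T\<close>, and maximality of
  \<open>T\<close> applies to the closure of the group generated by both.\<close>

lemma centralizer_t: assumes X: "\<And>H. H \<in> t \<Longrightarrow> br H X = 0" shows "X \<in> t"
proof -
  interpret T: subgroup T G by (rule torus(1))
  have Tc: "a \<in> carrier G" if "a \<in> T" for a using that T.subset by blast
  have "X \<in> zt" using X by (simp add: zt_def)
  then have fixed: "Ad a X = X" if "a \<in> T" for a using that K_eq_T by (auto simp: K_def)
  obtain \<gamma> where \<gamma>: "one_param (carrier G) \<gamma> X" using exp_exists by blast
  note f = one_param_facts[OF \<gamma> subset_refl]
  \<comment> \<open>Conjugating \<gamma> by a gives the one-parameter subgroup with velocity Ad a X
    = X, so uniqueness identifies it with \<gamma>.\<close>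
  have comm: "a \<otimes> \<gamma> s = \<gamma> s \<otimes> a" if a: "a \<in> T" for a s
  proof -
    have "one_param (carrier G) (\<lambda>s. a \<otimes> \<gamma> s \<otimes> inv a) X"
      using conj_one_param[OF \<gamma> Tc[OF a]] fixed[OF a] by simp
    from one_param_unique[OF this \<gamma>] have "a \<otimes> \<gamma> s \<otimes> inv a = \<gamma> s" .
    then have "a \<otimes> \<gamma> s \<otimes> inv a \<otimes> a = \<gamma> s \<otimes> a" by simp
    then show ?thesis using Tc[OF a] f(3) by (simp add: m_assoc)
  qed
  define H where "H = (\<lambda>(a, s). a \<otimes> \<gamma> s) ` (T \<times> (UNIV :: real set))"
  have Hc: "H \<subseteq> carrier G" using Tc f(3) by (auto simp: H_def)
  have Hmult: "x \<otimes> y \<in> H \<and> x \<otimes> y = y \<otimes> x" if xy: "x \<in> H" "y \<in> H" for x y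
  proof -
    obtain a s b r where *: "a \<in> T" "x = a \<otimes> \<gamma> s" "b \<in> T" "y = b \<otimes> \<gamma> r" using xy by (auto simp: H_def)
    have mul: "(a \<otimes> \<gamma> s) \<otimes> (b \<otimes> \<gamma> r) = (a \<otimes> b) \<otimes> \<gamma> (s + r)" if "a \<in> T" "b \<in> T" for a b s r
    proof -
      have "a \<otimes> (\<gamma> s \<otimes> b) \<otimes> \<gamma> r = a \<otimes> (b \<otimes> \<gamma> s) \<otimes> \<gamma> r" using comm[OF that(2)] by simp
      then show ?thesis using that Tc f(3) by (simp add: m_assoc f(4))
    qed
    have "x \<otimes> y = (a \<otimes> b) \<otimes> \<gamma> (s + r)" "y \<otimes> x = (b \<otimes> a) \<otimes> \<gamma> (r + s)" using mul * by auto
    moreover have "(a \<otimes> b) \<otimes> \<gamma> (s + r) \<in> H" using *(1,3) by (auto simp: H_def)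
    ultimately show ?thesis using T_comm[OF *(1,3)] by (simp add: add.commute)
  qed
  have Hinv: "inv x \<in> H" if x: "x \<in> H" for x
  proof -
    obtain a s where *: "a \<in> T" "x = a \<otimes> \<gamma> s" using x by (auto simp: H_def)
    have "inv a \<otimes> \<gamma> (- s) \<otimes> x = inv a \<otimes> (\<gamma> (- s) \<otimes> a) \<otimes> \<gamma> s" using * Tc f(3) by (simp add: m_assoc)
    also have "\<dots> = inv a \<otimes> (a \<otimes> \<gamma> (- s)) \<otimes> \<gamma> s" using comm[OF *(1)] by simp
    also have "\<dots> = \<gamma> (- s + s)" unfolding f(4) using * Tc f(3) by (simp add: m_assoc[symmetric])
    finally have "inv a \<otimes> \<gamma> (- s) \<otimes> x = \<one>" using f(5) by simp
    then have "inv x = inv a \<otimes> \<gamma> (- s)" using * Tc f(3) by (intro inv_equality) auto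
    moreover have "inv a \<otimes> \<gamma> (- s) \<in> H" using * by (auto simp: H_def)
    ultimately show ?thesis by simp
  qed
  have T_H: "T \<subseteq> H"
  proof
    fix a assume "a \<in> T"
    then have "a \<otimes> \<gamma> 0 \<in> H" by (auto simp: H_def)
    then show "a \<in> H" using f(5) Tc[OF \<open>a \<in> T\<close>] by simp
  qed
  have cG: "closed (carrier G)" using compact_carrier compact_imp_closed by blast
  let ?T' = "closure H"
  have T'c: "?T' \<subseteq> carrier G" using Hc cG by (rule closure_minimal)
  have cm: "continuous_on (closure (H \<times> H)) (\<lambda>(x, y). x \<otimes> y)"
    by (rule continuous_on_subset[OF continuous_mult]) (use T'c in \<open>auto simp: closure_Times\<close>)
  have cm': "continuous_on (closure (H \<times> H)) (\<lambda>(x, y). y \<otimes> x)"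
  proof -
    have "continuous_on (closure (H \<times> H)) (\<lambda>p. (\<lambda>(x, y). x \<otimes> y) (snd p, fst p))"
      by (rule continuous_on_compose2[OF continuous_mult])
        (use T'c in \<open>auto simp: closure_Times intro!: continuous_intros\<close>)
    then show ?thesis by (simp add: case_prod_unfold)
  qed
  have "torus_in G ?T'"
    unfolding torus_in_def
  proof (intro conjI ballI)
    show "subgroup ?T' G"
    proof
      show "?T' \<subseteq> carrier G" by (rule T'c)
      show "\<one> \<in> ?T'" using T_H closure_subset[of H] T.one_closed by blast
    next
      fix x y assume "x \<in> ?T'" "y \<in> ?T'"
      moreover have "(\<lambda>(x, y). x \<otimes> y) ` closure (H \<times> H) \<subseteq> closure H"
        by (rule image_closure_subset[OF cm closed_closure]) (use Hmult closure_subset[of H] in auto)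
      ultimately show "x \<otimes> y \<in> ?T'" by (auto simp: closure_Times)
    next
      fix x assume x: "x \<in> ?T'"
      have "(\<lambda>x. inv x) ` closure H \<subseteq> closure H"
        by (rule image_closure_subset[OF continuous_on_subset[OF continuous_inv T'c] closed_closure])
          (use Hinv closure_subset[of H] in auto)
      then show "inv x \<in> ?T'" using x by blast
    qed
    have "compact (carrier G \<inter> ?T')" by (rule compact_Int_closed[OF compact_carrier closed_closure])
    then show "compact ?T'" using T'c by (simp add: Int_absorb1)
    have "continuous_on (T \<times> (UNIV::real set)) (\<lambda>p. (\<lambda>(x, y). x \<otimes> y) (fst p, \<gamma> (snd p)))"
      by (rule continuous_on_compose2[OF continuous_mult])
        (use \<gamma> Tc f(3) in \<open>auto simp: one_param_def intro!: continuous_intros continuous_on_compose2[of UNIV \<gamma>]\<close>)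
    then have "connected ((\<lambda>p. fst p \<otimes> \<gamma> (snd p)) ` (T \<times> (UNIV::real set)))"
      by (intro connected_continuous_image connected_Times torus(3) connected_UNIV) simp
    then have "connected H" by (simp add: H_def case_prod_unfold)
    then show "connected ?T'" by (rule connected_imp_connected_closure)
    fix x y assume "x \<in> ?T'" "y \<in> ?T'"
    \<comment> \<open>Commutativity passes to the closure because the diagonal of a Hausdorff space
      is closed.\<close>
    moreover have "(\<lambda>p. ((\<lambda>(x, y). x \<otimes> y) p, (\<lambda>(x, y). y \<otimes> x) p)) ` closure (H \<times> H) \<subseteq> {y. \<exists>x. y = (x, x)}"
      by (rule image_closure_subset[OF continuous_on_Pair[OF cm cm'] closed_diagonal]) (use Hmult in auto)
    ultimately have "(x \<otimes> y, y \<otimes> x) \<in> {y. \<exists>x. y = (x, x)}"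
      unfolding closure_Times by (auto dest!: subsetD[OF _ imageI[of "(x, y)"]])
    then show "x \<otimes> y = y \<otimes> x" by simp
  qed
  moreover have "T \<subseteq> ?T'" using T_H closure_subset by blast
  ultimately have "?T' = T" using max_torus by (auto simp: maximal_torus_def)
  have gT: "\<gamma> s \<in> T" for s
  proof -
    have "\<one> \<otimes> \<gamma> s \<in> H" using T.one_closed by (force simp: H_def)
    then show ?thesis using f(3) closure_subset[of H] \<open>?T' = T\<close> by auto
  qed
  have "one_param T \<gamma> X" by (rule one_paramI[OF f(1) T.subset gT f(4)])
  then show ?thesis using t_iff by blast
qed

end

section \<open>Negative definiteness of the Killing form\<close>

context compact_lie_group
begin

text \<open>Along the one-parameter subgroup of \<open>X\<close> the operators Ad (\<gamma> h) have
  generator ad X. Their powers are again of the form Ad a, hence bounded by one constant, and the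
  resulting \<open>c\<close> does not depend on \<open>X\<close>.\<close>

lemma tr_br_square:
  obtains c where "c > 0" "\<And>X. tr (\<lambda>v. br X (br X v)) \<le> - c * (\<Sum>b\<in>Basis. (norm (br X b))\<^sup>2)"
proof -
  obtain C where C: "C > 0" "\<And>a v. a \<in> carrier G \<Longrightarrow> norm (Ad a v) \<le> C * norm v" using Ad_bounded by blast
  have pow: "(Ad a ^^ k) v = Ad (a [^] k) v" if a: "a \<in> carrier G" for a k v
  proof (induction k arbitrary: v)
    case 0 then show ?case by (simp add: Ad_one)
  next
    case (Suc k) then show ?case using a by (simp add: Ad_mult funpow_Suc_right del: funpow.simps)
  qed
  have "tr (\<lambda>v. br X (br X v)) \<le> - (\<Sum>b\<in>Basis. (norm (br X b))\<^sup>2) / C ^ 8" for X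
  proof -
    obtain \<gamma> where \<gamma>: "one_param (carrier G) \<gamma> X" using exp_exists by blast
    note f = one_param_facts[OF \<gamma> subset_refl]
    define h where "h n = 1 / real (Suc n)" for n
    have h: "h n > 0" for n by (simp add: h_def)
    have hlim: "h \<longlonglongrightarrow> 0" unfolding h_def by (rule LIMSEQ_Suc[OF lim_const_over_n])
    show ?thesis
    proof (rule tr_square_generator[of "\<lambda>n. Ad (\<gamma> (h n))" "\<lambda>n. Ad (inv (\<gamma> (h n)))" _ C h])
      fix n k v
      show "linear (Ad (\<gamma> (h n)))" "linear (Ad (inv \<gamma> (h n)))" using f(3) by (simp_all add: linear_Ad)
      show "linear (br X)" by (rule linear_br_right)
      show "Ad (\<gamma> (h n)) (Ad (inv \<gamma> (h n)) v) = v" "Ad (inv \<gamma> (h n)) (Ad (\<gamma> (h n)) v) = v"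
        using Ad_inv[OF f(3)] by auto
      show "norm ((Ad (\<gamma> (h n)) ^^ k) v) \<le> C * norm v" "norm ((Ad (inv \<gamma> (h n)) ^^ k) v) \<le> C * norm v"
        using f(3) C(2) by (simp_all add: pow)
      show "C > 0" "h n > 0" "h \<longlonglongrightarrow> 0" using C h hlim by auto
      have "((\<lambda>s. (1 / s) *\<^sub>R (Ad (\<gamma> s) v - v)) \<longlongrightarrow> br X v) (at 0)"
      proof -
        have "((\<lambda>s. norm ((Ad (\<gamma> s) v - Ad (\<gamma> 0) v) - (s - 0) *\<^sub>R br X v) / norm (s - 0)) \<longlongrightarrow> 0) (at 0)"
          using Ad_along[OF f(1), of v] unfolding has_vector_derivative_def has_derivative_iff_norm by blast
        then have 0: "((\<lambda>s. norm ((Ad (\<gamma> s) v - v) - s *\<^sub>R br X v) / \<bar>s\<bar>) \<longlongrightarrow> 0) (at 0)"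
          by (simp add: f(5) Ad_one)
        have "norm ((1 / s) *\<^sub>R (Ad (\<gamma> s) v - v) - br X v) \<le> norm ((Ad (\<gamma> s) v - v) - s *\<^sub>R br X v) / \<bar>s\<bar>"
          if "s \<noteq> 0" for s
        proof -
          have "(1 / s) *\<^sub>R (Ad (\<gamma> s) v - v) - br X v = (1 / s) *\<^sub>R ((Ad (\<gamma> s) v - v) - s *\<^sub>R br X v)"
            using that by (simp add: scaleR_diff_right)
          then show ?thesis using that by simp
        qed
        then have "\<forall>\<^sub>F s in at 0. norm ((1 / s) *\<^sub>R (Ad (\<gamma> s) v - v) - br X v)
            \<le> norm ((Ad (\<gamma> s) v - v) - s *\<^sub>R br X v) / \<bar>s\<bar>"
          by (auto simp: eventually_at_filter)
        from Lim_null_comparison[OF this 0] show ?thesis by (simp add: LIM_zero_iff)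
      qed
      moreover have "filterlim h (at 0) sequentially"
        using hlim h by (auto simp: filterlim_at less_imp_neq[symmetric] intro!: always_eventually)
      ultimately show "(\<lambda>n. (1 / h n) *\<^sub>R (Ad (\<gamma> (h n)) v - v)) \<longlonglongrightarrow> br X v"
        by (rule filterlim_compose)
    qed
  qed
  then show ?thesis using that[of "1 / C ^ 8"] C(1) by (simp add: divide_inverse mult.commute)
qed

text \<open>If B X X were nonnegative, the trace bound would force ad X = 0. Such \<open>X\<close>
  form the centre, an abelian ideal, which semisimplicity makes zero.\<close>

lemma killing_negative_definite:
  assumes ss: "semisimple br" and X: "X \<noteq> 0"
  shows "killing br X X < 0"
proof (rule ccontr)
  assume neg: "\<not> ?thesis"
  obtain c where c: "c > 0" "\<And>X. tr (\<lambda>v. br X (br X v)) \<le> - c * (\<Sum>b\<in>Basis. (norm (br X b))\<^sup>2)"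
    using tr_br_square by blast
  have "killing br X X = tr (\<lambda>v. br X (br X v))" by (simp add: killing_def tr_def)
  then have "c * (\<Sum>b\<in>Basis. (norm (br X b))\<^sup>2) \<le> 0" using neg c(2)[of X] by simp
  then have "(\<Sum>b\<in>Basis. (norm (br X b))\<^sup>2) \<le> 0" using c(1) by (simp add: mult_le_0_iff)
  then have "(\<Sum>b\<in>Basis. (norm (br X b))\<^sup>2) = 0" by (intro antisym sum_nonneg) auto
  then have b0: "br X b = 0" if "b \<in> Basis" for b
    using that by (subst (asm) sum_nonneg_eq_0_iff) auto
  have X0: "br X v = 0" for v
    using linear_sum_Basis[OF linear_br_right, of X v] b0 by simp
  define I where "I = {X. \<forall>v. br X v = 0}"
  have sub: "subspace I"
    using linear_0[OF linear_br_left] linear_add[OF linear_br_left] linear_scale[OF linear_br_left]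
    by (auto simp: subspace_def I_def)
  have I2: "br v Y = 0" if "Y \<in> I" for v Y using that br_antisym[of v Y] by (simp add: I_def)
  have "lie_ideal br I" using sub subspace_0[OF sub] I2 by (simp add: lie_ideal_def)
  moreover have "derived_series br I 1 = {0}"
  proof -
    have "br 0 0 = 0" using I2[OF subspace_0[OF sub]] .
    then have "{br X Y |X Y. X \<in> I \<and> Y \<in> I} = {0}" using subspace_0[OF sub] I2 by force
    then show ?thesis by simp
  qed
  ultimately have "I = {0}" using ss unfolding semisimple_def by blast
  moreover have "X \<in> I" using X0 by (simp add: I_def)
  ultimately show False using X by simp
qed

end

section \<open>Commuting symmetric maps\<close>

text \<open>The inner product of the type is not adapted to the bracket. The locale makes spectral
  theory available for -B and for the form that it induces on the complexification.\<close>

locale inner_form =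
  fixes q :: "'v::euclidean_space \<Rightarrow> 'v \<Rightarrow> real"
  assumes bilinear_q: "bilinear q" and q_sym: "q x y = q y x" and q_pos: "x \<noteq> 0 \<Longrightarrow> q x x > 0"
begin

lemma q_simps:
  "q (x + y) z = q x z + q y z" "q z (x + y) = q z x + q z y"
  "q (x - y) z = q x z - q y z" "q z (x - y) = q z x - q z y"
  "q (c *\<^sub>R x) z = c * q x z" "q z (c *\<^sub>R x) = c * q z x"
  "q 0 z = 0" "q z 0 = 0" "q (- x) z = - q x z" "q z (- x) = - q z x"
  using bilinear_q
  by (simp_all add: bilinear_ladd bilinear_radd bilinear_lsub bilinear_rsub bilinear_lmul bilinear_rmul
      bilinear_lzero bilinear_rzero bilinear_lneg bilinear_rneg)

lemma q_eq_0: "q x x = 0 \<longleftrightarrow> x = 0" using q_pos[of x] q_simps(7) by fastforce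

lemma perp_span:
  assumes "\<And>s. s \<in> F \<Longrightarrow> q y s = 0" "s \<in> span F" shows "q y s = 0"
  using assms(2) by (induction rule: span_induct_alt) (auto simp: q_simps assms(1))

text \<open>Gram-Schmidt: the new vector is first made orthogonal to the span of \<open>F\<close>,
  so that correcting along it does not disturb the orthogonality to \<open>F\<close>.\<close>

lemma projection_span_exists:
  assumes "finite F" shows "\<exists>p\<in>span F. \<forall>s\<in>F. q (x - p) s = 0"
  using assms
proof (induction F arbitrary: x)
  case empty
  then show ?case by simp
next
  case (insert a F)
  obtain p where p: "p \<in> span F" "\<forall>s\<in>F. q (a - p) s = 0" using insert.IH by blast
  obtain p' where p': "p' \<in> span F" "\<forall>s\<in>F. q (x - p') s = 0" using insert.IH by blast
  define a' where "a' = a - p"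
  show ?case
  proof (cases "a' = 0")
    case True
    then have "a \<in> span F" using p(1) by (simp add: a'_def)
    have "q (x - p') s = 0" if "s \<in> span F" for s
      by (rule perp_span[OF _ that]) (use p'(2) in blast)
    then show ?thesis using p' \<open>a \<in> span F\<close> span_mono[of F "insert a F"] by blast
  next
    case False
    then have q0: "q a' a' \<noteq> 0" by (simp add: q_eq_0)
    define r where "r = p' + (q (x - p') a' / q a' a') *\<^sub>R a'"
    have "p \<in> span (insert a F)" "p' \<in> span (insert a F)" "a \<in> span (insert a F)"
      using p p' span_mono[of F "insert a F"] by (auto intro: span_base)
    then have "r \<in> span (insert a F)" unfolding r_def a'_def by (intro span_add span_scale span_diff)
    moreover have F: "q (x - r) s = 0" if "s \<in> F" for s
      using p(2) p'(2) that by (simp add: r_def a'_def q_simps)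
    moreover have "q (x - r) a = 0"
    proof -
      have "q (x - r) s = 0" if "s \<in> span F" for s
        by (rule perp_span[OF F that])
      then have "q (x - r) p = 0" using p(1) by blast
      moreover have "q (x - r) a' = 0" using q0 by (simp add: r_def q_simps)
      ultimately show ?thesis by (simp add: a'_def q_simps)
    qed
    ultimately show ?thesis by blast
  qed
qed

lemma projection_exists:
  assumes "subspace S" shows "\<exists>p\<in>S. \<forall>s\<in>S. q (x - p) s = 0"
proof -
  obtain F where F: "F \<subseteq> S" "independent F" "S \<subseteq> span F" by (metis basis_exists)
  then have S: "span F = S" using assms span_subspace by blast
  obtain p where p: "p \<in> span F" "\<forall>s\<in>F. q (x - p) s = 0"
    using projection_span_exists independent_imp_finite[OF F(2)] by blast
  have "q (x - p) s = 0" if "s \<in> span F" for s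
    by (rule perp_span[OF _ that]) (use p(2) in blast)
  then show ?thesis using p S by blast
qed

lemma continuous_q: "continuous_on S (\<lambda>x. q (f x) (h x))" if "continuous_on S f" "continuous_on S h"
  using bilinear_q bilinear_conv_bounded_bilinear bounded_bilinear.continuous_on that by blast

text \<open>A maximum of the Rayleigh quotient on \<open>W\<close> is an eigenvector: moving
  \<open>v\<close> against the residual d = \<mu> v - A v would otherwise increase the quotient to
  first order.\<close>

lemma symmetric_eigenvector:
  assumes W: "subspace W" "W \<noteq> {0}" and A: "linear A" "\<And>x. x \<in> W \<Longrightarrow> A x \<in> W"
    and sym: "\<And>x y. q (A x) y = q x (A y)"
  obtains v \<mu> where "v \<in> W" "v \<noteq> 0" "A v = \<mu> *\<^sub>R v"
proof -
  let ?S = "sphere 0 1 \<inter> W"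
  obtain w where w: "w \<in> W" "w \<noteq> 0" using W subspace_0 by blast
  then have "(1 / norm w) *\<^sub>R w \<in> ?S" using W(1) by (simp add: subspace_scale)
  moreover have "compact ?S" by (intro compact_Int_closed compact_sphere closed_subspace W)
  moreover have "continuous_on ?S (\<lambda>x. q (A x) x / q x x)"
    using linear_continuous_on[OF linear_conv_bounded_linear[THEN iffD1, OF A(1)]]
    by (intro continuous_intros continuous_q) (auto simp: q_eq_0)
  ultimately obtain v where v: "v \<in> ?S" and max: "\<And>y. y \<in> ?S \<Longrightarrow> q (A y) y / q y y \<le> q (A v) v / q v v"
    using continuous_attains_sup[of ?S "\<lambda>x. q (A x) x / q x x"] by blast
  define \<mu> where "\<mu> = q (A v) v / q v v"
  have v0: "v \<noteq> 0" "v \<in> W" using v by auto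
  have le: "q (A y) y \<le> \<mu> * q y y" if y: "y \<in> W" for y
  proof (cases "y = 0")
    case True then show ?thesis by (simp add: q_simps)
  next
    case False
    let ?y = "(1 / norm y) *\<^sub>R y"
    have "?y \<in> ?S" using y False W(1) by (simp add: subspace_scale)
    then have "q (A ?y) ?y / q ?y ?y \<le> \<mu>" using max \<mu>_def by blast
    then have "q (A y) y / q y y \<le> \<mu>" using False by (simp add: linear_scale[OF A(1)] q_simps)
    then show ?thesis using q_pos[OF False] by (simp add: field_simps)
  qed
  have eqv: "q (A v) v = \<mu> * q v v" using q_pos[OF v0(1)] by (simp add: \<mu>_def)
  define d where "d = \<mu> *\<^sub>R v - A v"
  have dW: "d \<in> W" unfolding d_def using v0 A(2) W(1) by (intro subspace_diff subspace_scale)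
  have vd: "q v d = 0" using eqv by (simp add: d_def q_simps q_sym)
  have "q d d = 0"
  proof (rule ccontr)
    assume "q d d \<noteq> 0"
    then have dd: "q d d > 0" using q_pos[of d] q_simps(7) by fastforce
    define a where "a = \<mu> * q d d - q (A d) d"
    have a0: "a \<ge> 0" using le[OF dW] by (simp add: a_def)
    have key: "0 \<le> 2 * s * q d d + s * s * a" for s
    proof -
      have "v + s *\<^sub>R d \<in> W" using v0 dW W(1) by (simp add: subspace_add subspace_scale)
      from le[OF this] have "q (A (v + s *\<^sub>R d)) (v + s *\<^sub>R d) \<le> \<mu> * q (v + s *\<^sub>R d) (v + s *\<^sub>R d)" .
      moreover have "q (A (v + s *\<^sub>R d)) (v + s *\<^sub>R d) =
          q (A v) v + 2 * s * q (A v) d + s * s * q (A d) d"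
        using sym[of d v] q_sym[of d "A v"]
        by (simp add: linear_add[OF A(1)] linear_scale[OF A(1)] q_simps algebra_simps)
      moreover have m: "\<mu> * q v d = q d d + q (A v) d"
        by (simp add: d_def q_simps q_sym[of v "A v"] algebra_simps)
      have "\<mu> * q (v + s *\<^sub>R d) (v + s *\<^sub>R d) = \<mu> * q v v + 2 * s * (\<mu> * q v d) + s * s * (\<mu> * q d d)"
        using q_sym[of d v] by (simp add: q_simps algebra_simps)
      then have "\<mu> * q (v + s *\<^sub>R d) (v + s *\<^sub>R d) =
          \<mu> * q v v + 2 * s * (q d d + q (A v) d) + s * s * (\<mu> * q d d)" by (simp only: m)
      ultimately have "q (A v) v + 2 * s * q (A v) d + s * s * q (A d) d
          \<le> \<mu> * q v v + 2 * s * (q d d + q (A v) d) + s * s * (\<mu> * q d d)" by simp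
      then show ?thesis using eqv by (simp add: a_def algebra_simps)
    qed
    \<comment> \<open>Negative, and so small that |s| a \<le> q d d, which is half of the competing
      term 2 q d d.\<close>
    define s where "s = - (q d d / (a + 1))"
    have "s < 0" using dd a0 by (simp add: s_def)
    have "0 \<le> s * (2 * q d d + s * a)" using key[of s] by (simp add: algebra_simps)
    then have "2 * q d d + s * a \<le> 0" using \<open>s < 0\<close> by (simp add: zero_le_mult_iff)
    moreover have "- (s * a) \<le> q d d"
    proof -
      have "q d d * a \<le> q d d * (a + 1)" using dd by simp
      then show ?thesis using a0 by (simp add: s_def field_simps)
    qed
    ultimately show False using dd by linarith
  qed
  then have "A v = \<mu> *\<^sub>R v" by (simp add: q_eq_0 d_def)
  then show ?thesis using that v0 by blast
qed

text \<open>In an invariant subspace of least positive dimension every member of the family is scalar, since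
  an eigenspace of one member is invariant under all others.\<close>

lemma common_eigenvector:
  assumes lin: "\<And>A. A \<in> \<A> \<Longrightarrow> linear A" and sym: "\<And>A x y. A \<in> \<A> \<Longrightarrow> q (A x) y = q x (A y)"
    and comm: "\<And>A B x. A \<in> \<A> \<Longrightarrow> B \<in> \<A> \<Longrightarrow> A (B x) = B (A x)"
    and W: "subspace W" "W \<noteq> {0}" "\<And>A x. A \<in> \<A> \<Longrightarrow> x \<in> W \<Longrightarrow> A x \<in> W"
  shows "\<exists>v\<in>W. v \<noteq> 0 \<and> (\<forall>A\<in>\<A>. \<exists>\<mu>. A v = \<mu> *\<^sub>R v)"
  using W
proof (induction "dim W" arbitrary: W rule: less_induct)
  case less
  show ?case
  proof (cases "\<forall>A\<in>\<A>. \<exists>\<mu>. \<forall>v\<in>W. A v = \<mu> *\<^sub>R v")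
    case True
    obtain w where "w \<in> W" "w \<noteq> 0" using less.prems subspace_0 by blast
    then show ?thesis using True by blast
  next
    case False
    then obtain A where A: "A \<in> \<A>" "\<And>\<mu>. \<exists>v\<in>W. A v \<noteq> \<mu> *\<^sub>R v" by blast
    obtain v \<mu> where v: "v \<in> W" "v \<noteq> 0" "A v = \<mu> *\<^sub>R v"
      using symmetric_eigenvector[OF less.prems(1,2) lin[OF A(1)]] less.prems(3) sym A(1) by metis
    define W' where "W' = {x \<in> W. A x = \<mu> *\<^sub>R x}"
    have sub: "subspace W'"
      unfolding subspace_def W'_def using less.prems(1) lin[OF A(1)]
      by (auto simp: subspace_0 subspace_add subspace_scale linear_0 linear_add linear_scale scaleR_add_right)
    have "W' \<subset> W" using A(2)[of \<mu>] by (auto simp: W'_def)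
    then have "dim W' < dim W" using sub less.prems(1) by (metis dim_psubset span_eq_iff)
    moreover have "W' \<noteq> {0}" using v by (auto simp: W'_def)
    moreover have "B x \<in> W'" if "B \<in> \<A>" "x \<in> W'" for B x
      using that less.prems(3)[OF that(1)] comm[OF A(1) that(1)] linear_scale[OF lin[OF that(1)]]
      by (auto simp: W'_def)
    ultimately show ?thesis using less.hyps[of W'] sub by (auto simp: W'_def)
  qed
qed

text \<open>The orthogonal complement of the common eigenvectors is invariant under the family. Were
  it nonzero, it would contain a common eigenvector, which would then be orthogonal to
  itself.\<close>

lemma common_eigenvectors_span:
  assumes lin: "\<And>A. A \<in> \<A> \<Longrightarrow> linear A" and sym: "\<And>A x y. A \<in> \<A> \<Longrightarrow> q (A x) y = q x (A y)"
    and comm: "\<And>A B x. A \<in> \<A> \<Longrightarrow> B \<in> \<A> \<Longrightarrow> A (B x) = B (A x)"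
  shows "span {v. \<forall>A\<in>\<A>. \<exists>\<mu>. A v = \<mu> *\<^sub>R v} = UNIV" (is "span ?E = UNIV")
proof (rule ccontr)
  define E where "E = ?E"
  assume "span ?E \<noteq> UNIV"
  then obtain x where x: "x \<notin> span E" unfolding E_def by blast
  obtain p where p: "p \<in> span E" "\<forall>s\<in>span E. q (x - p) s = 0"
    using projection_exists[OF subspace_span[of E], of x] by blast
  define W where "W = {y. \<forall>s\<in>E. q y s = 0}"
  have W_iff: "y \<in> W \<longleftrightarrow> (\<forall>s\<in>E. q y s = 0)" for y by (simp add: W_def)
  have sub: "subspace W" by (auto simp: subspace_def W_iff q_simps)
  have "\<forall>s\<in>E. q (x - p) s = 0" using p(2) span_base[of _ E] by blast
  then have xp: "x - p \<in> W" by (simp only: W_iff)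
  have "x - p \<noteq> 0" using x p(1) by (metis eq_iff_diff_eq_0)
  with xp have nontriv: "W \<noteq> {0}" by blast
  have inv: "A y \<in> W" if A: "A \<in> \<A>" and y: "y \<in> W" for A y
    unfolding W_iff
  proof
    fix s assume s: "s \<in> E"
    then obtain \<mu> where "A s = \<mu> *\<^sub>R s" using A unfolding E_def by blast
    moreover have "q y s = 0" using y s by (simp add: W_iff)
    ultimately show "q (A y) s = 0" using sym[OF A] by (simp add: q_simps)
  qed
  have "\<exists>v\<in>W. v \<noteq> 0 \<and> (\<forall>A\<in>\<A>. \<exists>\<mu>. A v = \<mu> *\<^sub>R v)"
    by (rule common_eigenvector) (fact lin sym comm sub nontriv inv)+
  then obtain v where v: "v \<in> W" "v \<noteq> 0" "\<forall>A\<in>\<A>. \<exists>\<mu>. A v = \<mu> *\<^sub>R v" by blast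
  then have "v \<in> E" by (simp add: E_def)
  then have "q v v = 0" using v(1) by (simp add: W_iff)
  then show False using v(2) q_eq_0 by blast
qed

end

section \<open>The root decomposition\<close>

lemma fst_cscale [simp]: "fst (cscale z P) = Re z *\<^sub>R fst P - Im z *\<^sub>R snd P"
  and snd_cscale [simp]: "snd (cscale z P) = Re z *\<^sub>R snd P + Im z *\<^sub>R fst P"
  by (simp_all add: cscale_def)

lemma fst_cbracket [simp]: "fst (cbracket L P Q) = L (fst P) (fst Q) - L (snd P) (snd Q)"
  and snd_cbracket [simp]: "snd (cbracket L P Q) = L (fst P) (snd Q) + L (snd P) (fst Q)"
  by (simp_all add: cbracket_def)

lemma cscale_simps:
  "cscale z (P + Q) = cscale z P + cscale z Q" "cscale (z + w) P = cscale z P + cscale w P"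
  "cscale z (cscale w P) = cscale (z * w) P" "cscale 0 P = 0" "cscale z 0 = 0"
  "cscale (complex_of_real r) P = r *\<^sub>R P"
  by (simp_all add: prod_eq_iff algebra_simps)

text \<open>The interface between group and algebra: what follows works with these properties of the
  bracket and of \<open>t\<close> alone. \<open>t_centralizer\<close> is what maximality of the
  torus becomes on the Lie algebra.\<close>

locale compact_cartan =
  fixes L :: "'e::euclidean_space \<Rightarrow> 'e \<Rightarrow> 'e" and t :: "'e set"
  assumes bil: "bilinear L" and antisym: "L X Y = - L Y X"
    and jacobi: "L X (L Y Z) = L (L X Y) Z + L Y (L X Z)"
    and negdef: "X \<noteq> 0 \<Longrightarrow> killing L X X < 0"
    and subspace_t: "subspace t"
    and t_abelian: "H \<in> t \<Longrightarrow> K \<in> t \<Longrightarrow> L H K = 0"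
    and t_centralizer: "(\<And>H. H \<in> t \<Longrightarrow> L H X = 0) \<Longrightarrow> X \<in> t"
begin

abbreviation "B \<equiv> killing L"
abbreviation cb :: "'e cplx \<Rightarrow> 'e cplx \<Rightarrow> 'e cplx" where "cb \<equiv> cbracket L"
abbreviation "R \<equiv> roots L t"
abbreviation "rs \<equiv> root_space L t"
abbreviation "m \<equiv> m_space L t"

lemma L_simps:
  "L (x + y) z = L x z + L y z" "L z (x + y) = L z x + L z y"
  "L (x - y) z = L x z - L y z" "L z (x - y) = L z x - L z y"
  "L (c *\<^sub>R x) z = c *\<^sub>R L x z" "L z (c *\<^sub>R x) = c *\<^sub>R L z x"
  "L 0 z = 0" "L z 0 = 0" "L (- x) z = - L x z" "L z (- x) = - L z x"
  using bil
  by (simp_all add: bilinear_ladd bilinear_radd bilinear_lsub bilinear_rsub bilinear_lmul bilinear_rmul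
      bilinear_lzero bilinear_rzero bilinear_lneg bilinear_rneg)

lemma linear_L: "linear (L x)" using bil by (simp add: bilinear_def)

lemma B_tr: "B X Y = tr (\<lambda>v. L X (L Y v))" by (simp add: killing_def tr_def)

lemma B_sym: "B X Y = B Y X" unfolding B_tr by (rule tr_commute[OF linear_L linear_L])

lemma B_simps:
  "B (x + y) z = B x z + B y z" "B z (x + y) = B z x + B z y"
  "B (x - y) z = B x z - B y z" "B z (x - y) = B z x - B z y"
  "B (c *\<^sub>R x) z = c * B x z" "B z (c *\<^sub>R x) = c * B z x"
  "B 0 z = 0" "B z 0 = 0" "B (- x) z = - B x z" "B z (- x) = - B z x"
  by (simp_all add: killing_def L_simps inner_add_left inner_diff_left sum.distrib sum_subtractf
      sum_distrib_left sum_negf)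

lemma bilinear_B: "bilinear (\<lambda>X Y. - B X Y)"
  by (simp add: bilinear_def linear_iff B_simps)

lemma B_invariant: "B (L X Y) Z = B X (L Y Z)"
proof -
  have l2: "linear (\<lambda>v. L x (L y v))" for x y
    using linear_compose[OF linear_L linear_L] by (simp add: o_def)
  have "L (L X Y) v = L X (L Y v) - L Y (L X v)" for X Y v using jacobi[of X Y v] by simp
  then have "B (L X Y) Z = tr (\<lambda>v. L X (L Y (L Z v)) - L Y (L X (L Z v)))"
    "B X (L Y Z) = tr (\<lambda>v. L X (L Y (L Z v)) - L X (L Z (L Y v)))"
    by (simp_all add: B_tr L_simps)
  moreover have "tr (\<lambda>v. L Y (L X (L Z v))) = tr (\<lambda>v. L X (L Z (L Y v)))"
    by (rule tr_commute[OF linear_L l2])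
  ultimately show ?thesis by (simp add: tr_diff)
qed

sublocale q: inner_form "\<lambda>X Y. - B X Y"
  by unfold_locales (use bilinear_B B_sym negdef in auto)

text \<open>The real part of the Hermitian form extending -B; in terms of the bilinear extension
  below, minus the real part of BC of \<open>P\<close> and the conjugate of
  \<open>Q\<close>.\<close>

definition qq :: "'e cplx \<Rightarrow> 'e cplx \<Rightarrow> real" where
  "qq P Q = - B (fst P) (fst Q) - B (snd P) (snd Q)"

sublocale qq: inner_form qq
proof
  show "bilinear qq" by (simp add: bilinear_def linear_iff qq_def B_simps algebra_simps)
  show "qq x y = qq y x" for x y by (simp add: qq_def B_sym)
  fix P :: "'e cplx" assume "P \<noteq> 0"
  then have "fst P \<noteq> 0 \<or> snd P \<noteq> 0" by (auto simp: prod_eq_iff)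
  then show "qq P P > 0"
    using negdef[of "fst P"] negdef[of "snd P"] by (cases "fst P = 0"; cases "snd P = 0") (auto simp: qq_def B_simps)
qed

lemma cb_simps:
  "cb (P + Q) S = cb P S + cb Q S" "cb S (P + Q) = cb S P + cb S Q"
  "cb (P - Q) S = cb P S - cb Q S" "cb S (P - Q) = cb S P - cb S Q"
  "cb (cscale z P) S = cscale z (cb P S)" "cb S (cscale z P) = cscale z (cb S P)"
  "cb (r *\<^sub>R P) S = r *\<^sub>R cb P S" "cb S (r *\<^sub>R P) = r *\<^sub>R cb S P"
  "cb 0 S = 0" "cb S 0 = 0" "cb (- P) S = - cb P S" "cb S (- P) = - cb S P"
  by (simp_all add: prod_eq_iff L_simps algebra_simps)

lemma cb_antisym: "cb P Q = - cb Q P"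
  using antisym[of "fst P" "fst Q"] antisym[of "snd P" "snd Q"] antisym[of "fst P" "snd Q"] antisym[of "snd P" "fst Q"]
  by (simp add: prod_eq_iff)

lemma cb_jacobi: "cb P (cb Q S) = cb (cb P Q) S + cb Q (cb P S)"
  by (simp add: prod_eq_iff L_simps jacobi[of "fst P"] jacobi[of "snd P"])

lemma cb_sum: "cb (\<Sum>i\<in>I. f i) S = (\<Sum>i\<in>I. cb (f i) S)" "cb S (\<Sum>i\<in>I. f i) = (\<Sum>i\<in>I. cb S (f i))"
  by (induction I rule: infinite_finite_induct) (simp_all add: cb_simps)

section \<open>The complex bilinear extension of the Killing form\<close>

definition BC :: "'e cplx \<Rightarrow> 'e cplx \<Rightarrow> complex" where
  "BC P Q = Complex (B (fst P) (fst Q) - B (snd P) (snd Q)) (B (fst P) (snd Q) + B (snd P) (fst Q))"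

lemma BC_simps:
  "BC (P + Q) S = BC P S + BC Q S" "BC S (P + Q) = BC S P + BC S Q"
  "BC (P - Q) S = BC P S - BC Q S" "BC S (P - Q) = BC S P - BC S Q"
  "BC (cscale z P) S = z * BC P S" "BC S (cscale z P) = z * BC S P"
  "BC (r *\<^sub>R P) S = of_real r * BC P S" "BC S (r *\<^sub>R P) = of_real r * BC S P"
  "BC 0 S = 0" "BC S 0 = 0" "BC (- P) S = - BC P S" "BC S (- P) = - BC S P"
  by (simp_all add: BC_def B_simps complex_eq_iff algebra_simps)

lemma BC_sym: "BC P Q = BC Q P"
  by (simp add: BC_def B_sym[of "fst P"] B_sym[of "snd P"])

lemma BC_sum: "BC (\<Sum>i\<in>I. f i) S = (\<Sum>i\<in>I. BC (f i) S)" "BC S (\<Sum>i\<in>I. f i) = (\<Sum>i\<in>I. BC S (f i))"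
  by (induction I rule: infinite_finite_induct) (simp_all add: BC_simps)

lemma BC_invariant: "BC (cb P Q) S = BC P (cb Q S)"
  by (simp add: BC_def B_simps B_invariant)

lemma BC_real: "BC (X, 0) (Y, 0) = of_real (B X Y)"
  by (simp add: BC_def B_simps complex_eq_iff)

lemma BC_nondegenerate: assumes "\<And>Q. BC P Q = 0" shows "P = 0"
proof -
  have "BC P (fst P, - snd P) = 0" by (rule assms)
  then have "qq P P = 0" by (simp add: BC_def qq_def B_simps complex_eq_iff)
  then show ?thesis by (simp add: qq.q_eq_0)
qed

section \<open>Weight spaces and roots\<close>

lemma rs_closed:
  "0 \<in> rs \<alpha>" "P \<in> rs \<alpha> \<Longrightarrow> Q \<in> rs \<alpha> \<Longrightarrow> P + Q \<in> rs \<alpha>" "P \<in> rs \<alpha> \<Longrightarrow> r *\<^sub>R P \<in> rs \<alpha>"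
  "P \<in> rs \<alpha> \<Longrightarrow> - P \<in> rs \<alpha>" "P \<in> rs \<alpha> \<Longrightarrow> Q \<in> rs \<alpha> \<Longrightarrow> P - Q \<in> rs \<alpha>"
proof -
  show 0: "0 \<in> rs \<alpha>" by (simp add: root_space_def cb_simps cscale_simps)
  show a: "P \<in> rs \<alpha> \<Longrightarrow> Q \<in> rs \<alpha> \<Longrightarrow> P + Q \<in> rs \<alpha>" for P Q by (simp add: root_space_def cb_simps cscale_simps)
  show s: "P \<in> rs \<alpha> \<Longrightarrow> r *\<^sub>R P \<in> rs \<alpha>" for P r
    by (simp add: root_space_def cb_simps) (simp add: prod_eq_iff algebra_simps)
  show n: "P \<in> rs \<alpha> \<Longrightarrow> - P \<in> rs \<alpha>" for P using s[of P "-1"] by simp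
  show "P \<in> rs \<alpha> \<Longrightarrow> Q \<in> rs \<alpha> \<Longrightarrow> P - Q \<in> rs \<alpha>" using a[OF _ n] by simp
qed

lemma rs_sum: "(\<And>i. i \<in> I \<Longrightarrow> f i \<in> rs \<alpha>) \<Longrightarrow> (\<Sum>i\<in>I. f i) \<in> rs \<alpha>"
  by (induction I rule: infinite_finite_induct) (simp_all add: rs_closed)

lemma rs_0: "rs 0 = t \<times> t"
proof (intro subset_antisym subsetI)
  fix P assume P: "P \<in> rs 0"
  have "L H (fst P) = 0 \<and> L H (snd P) = 0" if "H \<in> t" for H
  proof -
    have "(H, 0) \<in> t \<times> t" using that subspace_0[OF subspace_t] by simp
    then have "cb (H, 0) P = 0" using P by (auto simp: root_space_def cscale_simps)
    then show ?thesis by (simp add: prod_eq_iff L_simps)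
  qed
  then show "P \<in> t \<times> t" using t_centralizer by (simp add: mem_Times_iff)
next
  fix P assume "P \<in> t \<times> t"
  then show "P \<in> rs 0" by (auto simp: root_space_def cscale_simps prod_eq_iff t_abelian)
qed

lemma rsD: "P \<in> rs \<alpha> \<Longrightarrow> H \<in> t \<times> t \<Longrightarrow> cb H P = cscale (\<alpha> H) P"
  by (simp only: root_space_def mem_Collect_eq)

lemma cb_rs: assumes "P \<in> rs \<alpha>" "Q \<in> rs \<beta>" shows "cb P Q \<in> rs (\<alpha> + \<beta>)"
proof -
  have "cb H (cb P Q) = cscale ((\<alpha> + \<beta>) H) (cb P Q)" if "H \<in> t \<times> t" for H
    using rsD[OF assms(1) that] rsD[OF assms(2) that] by (simp add: cb_jacobi[of H] cb_simps cscale_simps(2))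
  then show ?thesis by (simp add: root_space_def)
qed

lemma cartan_dualD:
  assumes "\<alpha> \<in> cartan_dual t"
  shows "H \<in> t \<times> t \<Longrightarrow> K \<in> t \<times> t \<Longrightarrow> \<alpha> (H + K) = \<alpha> H + \<alpha> K"
    "H \<in> t \<times> t \<Longrightarrow> \<alpha> (cscale z H) = z * \<alpha> H" "H \<notin> t \<times> t \<Longrightarrow> \<alpha> H = 0"
proof -
  note c = assms[unfolded cartan_dual_def mem_Collect_eq]
  note * = conjunct1[OF c] conjunct1[OF conjunct2[OF c]] conjunct2[OF conjunct2[OF c]]
  show "H \<in> t \<times> t \<Longrightarrow> K \<in> t \<times> t \<Longrightarrow> \<alpha> (H + K) = \<alpha> H + \<alpha> K"
    using *(1) by blast
  show "H \<in> t \<times> t \<Longrightarrow> \<alpha> (cscale z H) = z * \<alpha> H" using *(2) by blast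
  show "H \<notin> t \<times> t \<Longrightarrow> \<alpha> H = 0" using *(3) by blast
qed

lemma cartan_dual_eqI:
  assumes "\<alpha> \<in> cartan_dual t" "\<beta> \<in> cartan_dual t" "\<And>H. H \<in> t \<times> t \<Longrightarrow> \<alpha> H = \<beta> H" shows "\<alpha> = \<beta>"
proof
  fix H show "\<alpha> H = \<beta> H"
    using assms(3)[of H] cartan_dualD(3)[OF assms(1), of H] cartan_dualD(3)[OF assms(2), of H]
    by (cases "H \<in> t \<times> t") simp_all
qed

lemma cartan_dual_closed:
  "0 \<in> cartan_dual t" "\<alpha> \<in> cartan_dual t \<Longrightarrow> - \<alpha> \<in> cartan_dual t"
  "\<alpha> \<in> cartan_dual t \<Longrightarrow> \<beta> \<in> cartan_dual t \<Longrightarrow> \<alpha> + \<beta> \<in> cartan_dual t"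
  by (auto simp: cartan_dual_def algebra_simps)

text \<open>Invariance gives (\<alpha> H + \<beta> H) BC P Q = 0, and some H makes the first factor
  nonzero.\<close>

lemma rs_orthogonal:
  assumes "\<alpha> \<in> cartan_dual t" "\<beta> \<in> cartan_dual t" "\<alpha> + \<beta> \<noteq> 0" "P \<in> rs \<alpha>" "Q \<in> rs \<beta>"
  shows "BC P Q = 0"
proof -
  obtain H where H: "H \<in> t \<times> t" "\<alpha> H + \<beta> H \<noteq> 0"
    using cartan_dual_eqI[OF cartan_dual_closed(3)[OF assms(1,2)] cartan_dual_closed(1)] assms(3) by fastforce
  have "\<alpha> H * BC P Q = BC (cb H P) Q" using rsD[OF assms(4) H(1)] by (simp add: BC_simps)
  also have "\<dots> = - BC (cb P H) Q" using cb_antisym[of H P] by (simp add: BC_simps)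
  also have "\<dots> = - BC P (cb H Q)" by (simp add: BC_invariant)
  also have "\<dots> = - \<beta> H * BC P Q" using rsD[OF assms(5) H(1)] by (simp add: BC_simps)
  finally have "(\<alpha> H + \<beta> H) * BC P Q = 0" by (simp add: algebra_simps)
  then show ?thesis using H(2) by simp
qed

text \<open>ad H is skew for the definite form -B, so it has imaginary eigenvalues. Pairing real and
  imaginary parts of [H, P] with those of \<open>P\<close> isolates the real part of the
  eigenvalue.\<close>

lemma rs_imaginary:
  assumes \<alpha>: "\<alpha> \<in> cartan_dual t" and P: "P \<in> rs \<alpha>" "P \<noteq> 0" and H: "H \<in> t"
  shows "Re (\<alpha> (H, 0)) = 0"
proof -
  have "(H, 0) \<in> t \<times> t" using H subspace_0[OF subspace_t] by simp
  then have "cb (H, 0) P = cscale (\<alpha> (H, 0)) P" using P(1) by (simp add: root_space_def)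
  then have 1: "L H (fst P) = Re (\<alpha> (H, 0)) *\<^sub>R fst P - Im (\<alpha> (H, 0)) *\<^sub>R snd P"
    "L H (snd P) = Re (\<alpha> (H, 0)) *\<^sub>R snd P + Im (\<alpha> (H, 0)) *\<^sub>R fst P"
    by (simp_all add: prod_eq_iff L_simps)
  have sk: "B (L H x) x = 0" for x
  proof -
    have "B (L H x) x = - B (L x H) x" using antisym[of H x] by (simp add: B_simps)
    also have "\<dots> = - B (L H x) x" using B_invariant[of x H x] B_sym[of x "L H x"] by simp
    finally show ?thesis by simp
  qed
  have "0 = B (L H (fst P)) (fst P) + B (L H (snd P)) (snd P)" by (simp add: sk)
  also have "\<dots> = - Re (\<alpha> (H, 0)) * qq P P"
    unfolding 1 qq_def B_simps using B_sym[of "fst P" "snd P"] by (simp add: algebra_simps)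
  finally have "Re (\<alpha> (H, 0)) * qq P P = 0" by simp
  then show ?thesis using P(2) by (simp add: qq.q_eq_0)
qed

section \<open>Complex conjugation and the finiteness of the set of roots\<close>

definition cnjp :: "'e cplx \<Rightarrow> 'e cplx" where "cnjp P = (fst P, - snd P)"

lemma cnjp_simps: "cnjp (cnjp P) = P" "cnjp (P + Q) = cnjp P + cnjp Q" "cnjp (X, 0) = (X, 0)" "cnjp 0 = 0"
  "P + cnjp P = (2 *\<^sub>R fst P, 0)" "cnjp P = 0 \<longleftrightarrow> P = 0"
  by (auto simp: cnjp_def prod_eq_iff scaleR_2)

lemma cnjp_sum: "cnjp (\<Sum>i\<in>I. f i) = (\<Sum>i\<in>I. cnjp (f i))"
  by (induction I rule: infinite_finite_induct) (simp_all add: cnjp_simps)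

text \<open>A weight with a nonzero vector is imaginary on \<open>t\<close>. Conjugating that vector
  replaces the eigenvalue of a real H by its conjugate, which is therefore its negative.\<close>

lemma cnjp_rs:
  assumes \<alpha>: "\<alpha> \<in> cartan_dual t" and P: "P \<in> rs \<alpha>"
  shows "cnjp P \<in> rs (- \<alpha>)"
proof (cases "P = 0")
  case True then show ?thesis by (simp add: cnjp_simps rs_closed)
next
  case False
  have cnj: "\<alpha> (fst H, - snd H) = - cnj (\<alpha> H)" if H: "H \<in> t \<times> t" for H
  proof -
    have in1: "(fst H, 0) \<in> t \<times> t" "(snd H, 0) \<in> t \<times> t"
      using H subspace_0[OF subspace_t] by (auto simp: mem_Times_iff)
    have in2: "cscale z (snd H, 0) \<in> t \<times> t" for z
      using H subspace_scale[OF subspace_t] by (auto simp: mem_Times_iff)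
    have add: "\<alpha> ((fst H, 0) + cscale z (snd H, 0)) = \<alpha> (fst H, 0) + z * \<alpha> (snd H, 0)" for z
    proof -
      have "\<alpha> ((fst H, 0) + cscale z (snd H, 0)) = \<alpha> (fst H, 0) + \<alpha> (cscale z (snd H, 0))"
        by (rule cartan_dualD(1)[OF \<alpha> in1(1) in2])
      moreover have "\<alpha> (cscale z (snd H, 0)) = z * \<alpha> (snd H, 0)"
        by (rule cartan_dualD(2)[OF \<alpha> in1(2)])
      ultimately show ?thesis by simp
    qed
    have "\<alpha> H = \<alpha> (fst H, 0) + \<i> * \<alpha> (snd H, 0)"
      using add[of \<i>] by (simp add: cscale_def)
    moreover have "\<alpha> (fst H, - snd H) = \<alpha> (fst H, 0) - \<i> * \<alpha> (snd H, 0)"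
      using add[of "- \<i>"] by (simp add: cscale_def)
    moreover have "Re (\<alpha> (fst H, 0)) = 0" "Re (\<alpha> (snd H, 0)) = 0"
      using rs_imaginary[OF \<alpha> P False] H by auto
    ultimately show ?thesis by (simp add: complex_eq_iff)
  qed
  have "cb H (cnjp P) = cscale ((- \<alpha>) H) (cnjp P)" if H: "H \<in> t \<times> t" for H
  proof -
    have H': "(fst H, - snd H) \<in> t \<times> t" using H subspace_neg[OF subspace_t] by auto
    have "cb H (cnjp P) = cnjp (cb (fst H, - snd H) P)"
      by (simp add: cnjp_def prod_eq_iff L_simps)
    also have "\<dots> = cnjp (cscale (\<alpha> (fst H, - snd H)) P)" using P H' by (simp add: root_space_def)
    also have "\<dots> = cscale (cnj (\<alpha> (fst H, - snd H))) (cnjp P)"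
      by (simp add: cnjp_def prod_eq_iff algebra_simps)
    also have "\<dots> = cscale ((- \<alpha>) H) (cnjp P)" using cnj[OF H] by simp
    finally show ?thesis .
  qed
  then show ?thesis by (simp add: root_space_def)
qed

lemma R_dual: "\<alpha> \<in> R \<Longrightarrow> \<alpha> \<in> cartan_dual t" "\<alpha> \<in> R \<Longrightarrow> \<alpha> \<noteq> 0"
  by (auto simp: roots_def)

lemma uminus_R: assumes "\<alpha> \<in> R" shows "- \<alpha> \<in> R"
proof -
  obtain P where P: "P \<in> rs \<alpha>" "P \<noteq> 0" using assms rs_closed(1)[of \<alpha>] by (auto simp: roots_def)
  have "cnjp P \<in> rs (- \<alpha>)" "cnjp P \<noteq> 0" using cnjp_rs[OF R_dual(1)[OF assms] P(1)] P(2) by (auto simp: cnjp_simps)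
  then show ?thesis using assms cartan_dual_closed(2) by (auto simp: roots_def)
qed

lemma rs_trivial: assumes "\<alpha> \<in> cartan_dual t" "\<alpha> \<notin> R" "\<alpha> \<noteq> 0" "P \<in> rs \<alpha>" shows "P = 0"
  using assms rs_closed(1)[of \<alpha>] by (auto simp: roots_def)

text \<open>Conjugation turns \<open>qq\<close> into the real part of \<open>-BC\<close> between the
  spaces of \<alpha> and -\<beta>, so root vectors of distinct roots are
  \<open>qq\<close>-orthogonal and hence independent. The real dimension of the complexification
  bounds their number.\<close>

lemma finite_R: "finite R"
proof (rule ccontr)
  assume "infinite R"
  then obtain F where F: "F \<subseteq> R" "finite F" "card F = Suc (DIM('e cplx))"
    using infinite_arbitrarily_large by blast
  have "\<forall>\<alpha>\<in>R. \<exists>P\<in>rs \<alpha>. P \<noteq> 0" using rs_closed(1) by (auto simp: roots_def)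
  then obtain v where v: "\<And>\<alpha>. \<alpha> \<in> R \<Longrightarrow> v \<alpha> \<in> rs \<alpha> \<and> v \<alpha> \<noteq> 0" by metis
  have orth: "qq (v \<alpha>) (v \<beta>) = 0" if "\<alpha> \<in> R" "\<beta> \<in> R" "\<alpha> \<noteq> \<beta>" for \<alpha> \<beta>
  proof -
    have "\<alpha> + - \<beta> \<noteq> 0" using that(3) by simp
    then have "BC (v \<alpha>) (cnjp (v \<beta>)) = 0"
      using rs_orthogonal[OF _ _ _ _ cnjp_rs] cartan_dual_closed(2) R_dual(1) v that by blast
    then show ?thesis by (simp add: BC_def qq_def cnjp_def B_simps complex_eq_iff)
  qed
  have inj: "inj_on v F"
  proof (rule inj_onI)
    fix \<alpha> \<beta> assume "\<alpha> \<in> F" "\<beta> \<in> F" "v \<alpha> = v \<beta>"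
    then have ab: "\<alpha> \<in> R" "\<beta> \<in> R" "v \<alpha> = v \<beta>" using F by auto
    show "\<alpha> = \<beta>"
    proof (rule ccontr)
      assume "\<alpha> \<noteq> \<beta>"
      then have "qq (v \<beta>) (v \<beta>) = 0" using orth[OF ab(1,2)] ab(3) by simp
      then show False using v[OF ab(2)] by (simp add: qq.q_eq_0)
    qed
  qed
  have "independent (v ` F)"
  proof (rule independent_if_scalars_zero)
    show "finite (v ` F)" using F by simp
    fix f x assume s: "(\<Sum>x\<in>v ` F. f x *\<^sub>R x) = 0" and x: "x \<in> v ` F"
    have qs: "qq (\<Sum>x\<in>I. f x *\<^sub>R x) y = (\<Sum>x\<in>I. f x * qq x y)" for I y
      by (induction I rule: infinite_finite_induct) (simp_all add: qq.q_simps)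
    have "0 = qq (\<Sum>x\<in>v ` F. f x *\<^sub>R x) x" by (simp add: s qq.q_simps)
    also have "\<dots> = (\<Sum>y\<in>v ` F. f y * qq y x)" by (rule qs)
    also have "\<dots> = (\<Sum>y\<in>v ` F. if y = x then f x * qq x x else 0)"
    proof (rule sum.cong[OF refl])
      fix y assume y: "y \<in> v ` F"
      obtain \<alpha> \<beta> where ab: "\<alpha> \<in> F" "y = v \<alpha>" "\<beta> \<in> F" "x = v \<beta>" using x y by blast
      have "qq y x = 0" if "y \<noteq> x"
      proof -
        have "\<alpha> \<noteq> \<beta>" using that ab by blast
        then show ?thesis using orth[of \<alpha> \<beta>] ab F(1) by blast
      qed
      then show "f y * qq y x = (if y = x then f x * qq x x else 0)" by simp
    qed
    also have "\<dots> = f x * qq x x" using x F by (simp add: sum.delta)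
    finally show "f x = 0" using x v F by (auto simp: qq.q_eq_0 subset_iff)
  qed
  then have "card (v ` F) \<le> DIM('e cplx)" using independent_bound by blast
  then show False using F inj by (simp add: card_image)
qed

text \<open>The pair in the hypothesis is \<i> [H, P]. A real eigenvalue \<mu> of \<i> ad H is the
  eigenvalue -\<i> \<mu> of ad H, and linearity of \<mu> in H follows from \<open>P\<close> being
  nonzero.\<close>

lemma eigenvector_root_space:
  assumes P: "P \<noteq> 0" and eig: "\<And>H. H \<in> t \<Longrightarrow> \<exists>\<mu>. (- L H (snd P), L H (fst P)) = \<mu> *\<^sub>R P"
  obtains \<alpha> where "\<alpha> \<in> cartan_dual t" "P \<in> rs \<alpha>"
proof -
  obtain \<mu> where \<mu>: "\<And>H. H \<in> t \<Longrightarrow> (- L H (snd P), L H (fst P)) = \<mu> H *\<^sub>R P" using eig by metis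
  have e: "L H (snd P) = - \<mu> H *\<^sub>R fst P" "L H (fst P) = \<mu> H *\<^sub>R snd P" if "H \<in> t" for H
    using \<mu>[OF that] by (auto simp: prod_eq_iff neg_equal_iff_equal[of "L H (snd P)", symmetric])
  have lin: "\<mu> (a *\<^sub>R H + b *\<^sub>R K) = a * \<mu> H + b * \<mu> K" if "H \<in> t" "K \<in> t" for a b H K
  proof -
    have "a *\<^sub>R H + b *\<^sub>R K \<in> t" using that subspace_t by (simp add: subspace_add subspace_scale)
    from e[OF this] e[OF that(1)] e[OF that(2)]
    have "\<mu> (a *\<^sub>R H + b *\<^sub>R K) *\<^sub>R P = (a * \<mu> H + b * \<mu> K) *\<^sub>R P"
      by (simp add: prod_eq_iff L_simps algebra_simps)
    then show ?thesis using P by simp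
  qed
  \<comment> \<open>The complex linear extension of H \<mapsto> -\<i> \<mu> H: at H1 + \<i> H2 its
    value is \<mu> H2 - \<i> \<mu> H1. Off \<open>t \<times> t\<close> it is 0, as
    \<open>cartan_dual\<close> requires.\<close>
  define \<alpha> where "\<alpha> H = (if H \<in> t \<times> t then Complex (\<mu> (snd H)) (- \<mu> (fst H)) else 0)" for H
  have "\<alpha> \<in> cartan_dual t"
    unfolding cartan_dual_def
  proof (intro CollectI conjI ballI allI impI)
    fix H K :: "'e cplx" assume H: "H \<in> t \<times> t" and K: "K \<in> t \<times> t"
    then have "H + K \<in> t \<times> t" using subspace_t by (auto simp: mem_Times_iff subspace_add)
    moreover have "\<mu> (fst H + fst K) = \<mu> (fst H) + \<mu> (fst K)" "\<mu> (snd H + snd K) = \<mu> (snd H) + \<mu> (snd K)"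
      using lin[of "fst H" "fst K" 1 1] lin[of "snd H" "snd K" 1 1] H K by (auto simp: mem_Times_iff)
    ultimately show "\<alpha> (H + K) = \<alpha> H + \<alpha> K" using H K by (simp add: \<alpha>_def complex_eq_iff)
  next
    fix z and H :: "'e cplx" assume H: "H \<in> t \<times> t"
    then have "cscale z H \<in> t \<times> t"
      using subspace_t by (auto simp: mem_Times_iff subspace_add subspace_diff subspace_scale)
    moreover have "\<mu> (Re z *\<^sub>R fst H - Im z *\<^sub>R snd H) = Re z * \<mu> (fst H) - Im z * \<mu> (snd H)"
      "\<mu> (Re z *\<^sub>R snd H + Im z *\<^sub>R fst H) = Re z * \<mu> (snd H) + Im z * \<mu> (fst H)"
      using lin[of "fst H" "snd H" "Re z" "- Im z"] lin[of "snd H" "fst H" "Re z" "Im z"] H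
      by (auto simp: mem_Times_iff)
    ultimately show "\<alpha> (cscale z H) = z * \<alpha> H" using H by (simp add: \<alpha>_def complex_eq_iff algebra_simps)
  qed (simp add: \<alpha>_def)
  moreover have "P \<in> rs \<alpha>"
    using e by (auto simp: root_space_def \<alpha>_def prod_eq_iff algebra_simps)
  ultimately show ?thesis using that by blast
qed

section \<open>Existence and uniqueness of root components\<close>

definition mC :: "'e cplx set" where "mC = {V. \<forall>H\<in>t \<times> t. BC V H = 0}"

lemma mCD: "V \<in> mC \<Longrightarrow> H \<in> t \<times> t \<Longrightarrow> BC V H = 0"
  unfolding mC_def by blast

lemma mC_closed: "V \<in> mC \<Longrightarrow> W \<in> mC \<Longrightarrow> V + W \<in> mC" "V \<in> mC \<Longrightarrow> W \<in> mC \<Longrightarrow> V - W \<in> mC" "0 \<in> mC"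
  "V \<in> mC \<Longrightarrow> r *\<^sub>R V \<in> mC"
  by (auto simp: mC_def BC_simps)

lemma mC_sum: "(\<And>i. i \<in> I \<Longrightarrow> f i \<in> mC) \<Longrightarrow> (\<Sum>i\<in>I. f i) \<in> mC"
  by (induction I rule: infinite_finite_induct) (simp_all add: mC_closed)

lemma mC_iff: "V \<in> mC \<longleftrightarrow> fst V \<in> m \<and> snd V \<in> m"
proof
  assume V: "V \<in> mC"
  have "BC V (H, 0) = 0" if "H \<in> t" for H using V that subspace_0[OF subspace_t] by (auto simp: mC_def)
  then show "fst V \<in> m \<and> snd V \<in> m" by (auto simp: m_space_def BC_def B_simps complex_eq_iff)
next
  assume "fst V \<in> m \<and> snd V \<in> m"
  then show "V \<in> mC" by (auto simp: mC_def m_space_def BC_def complex_eq_iff)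
qed

lemma rs_mC: assumes "\<alpha> \<in> R" "P \<in> rs \<alpha>" shows "P \<in> mC"
  unfolding mC_def
proof (intro CollectI ballI)
  fix H :: "'e cplx" assume "H \<in> t \<times> t"
  then have "H \<in> rs 0" by (simp add: rs_0)
  then show "BC P H = 0"
    using rs_orthogonal[OF R_dual(1)[OF assms(1)] cartan_dual_closed(1) _ assms(2)] R_dual(2)[OF assms(1)] by simp
qed

lemma mC_t: assumes "V \<in> mC" "V \<in> t \<times> t" shows "V = 0"
proof -
  have "fst V \<in> m" "fst V \<in> t" "snd V \<in> m" "snd V \<in> t" using assms mC_iff by (auto simp: mem_Times_iff)
  then have "B (fst V) (fst V) = 0" "B (snd V) (snd V) = 0" by (auto simp: m_space_def)
  then show ?thesis using negdef[of "fst V"] negdef[of "snd V"] by (auto simp: prod_eq_iff)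
qed

text \<open>The operators \<i> ad H with H in \<open>t\<close> commute and are symmetric for
  \<open>qq\<close>, so their common eigenvectors span the complexification over the reals. Each
  nonzero one is a weight vector, whose weight is a root or else 0, in which case it lies in
  \<open>t \<times> t\<close>.\<close>

lemma full_decomposition:
  "\<exists>V0 f. V0 \<in> t \<times> t \<and> (\<forall>\<alpha>\<in>R. f \<alpha> \<in> rs \<alpha>) \<and> V = V0 + (\<Sum>\<alpha>\<in>R. f \<alpha>)"
proof -
  define S where "S = {V. \<exists>V0 f. V0 \<in> t \<times> t \<and> (\<forall>\<alpha>\<in>R. f \<alpha> \<in> rs \<alpha>) \<and> V = V0 + (\<Sum>\<alpha>\<in>R. f \<alpha>)}"
  have subtt: "subspace (t \<times> t)" using subspace_Times[OF subspace_t subspace_t] .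
  have "subspace S"
  proof (rule subspaceI)
    show "0 \<in> S" unfolding S_def
      by (intro CollectI exI[of _ 0] exI[of _ "\<lambda>_. 0"] conjI subspace_0[OF subtt]) (simp_all add: rs_closed)
  next
    fix V W assume "V \<in> S" "W \<in> S"
    then obtain V0 f W0 h where *: "V0 \<in> t \<times> t" "\<forall>\<alpha>\<in>R. f \<alpha> \<in> rs \<alpha>" "V = V0 + (\<Sum>\<alpha>\<in>R. f \<alpha>)"
      "W0 \<in> t \<times> t" "\<forall>\<alpha>\<in>R. h \<alpha> \<in> rs \<alpha>" "W = W0 + (\<Sum>\<alpha>\<in>R. h \<alpha>)" unfolding S_def by blast
    show "V + W \<in> S" unfolding S_def
      by (intro CollectI exI[of _ "V0 + W0"] exI[of _ "\<lambda>\<alpha>. f \<alpha> + h \<alpha>"])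
        (use * subspace_add[OF subtt] in \<open>simp add: rs_closed sum.distrib\<close>)
  next
    fix r V assume "V \<in> S"
    then obtain V0 f where *: "V0 \<in> t \<times> t" "\<forall>\<alpha>\<in>R. f \<alpha> \<in> rs \<alpha>" "V = V0 + (\<Sum>\<alpha>\<in>R. f \<alpha>)" unfolding S_def by blast
    show "r *\<^sub>R V \<in> S" unfolding S_def
      by (intro CollectI exI[of _ "r *\<^sub>R V0"] exI[of _ "\<lambda>\<alpha>. r *\<^sub>R f \<alpha>"])
        (use * subspace_scale[OF subtt] in \<open>simp add: rs_closed scaleR_add_right scaleR_sum_right\<close>)
  qed
  define M where "M H P = (- L H (snd P), L H (fst P))" for H :: 'e and P :: "'e cplx"
  have sk: "B (L H x) y = - B x (L H y)" for H x y
    using antisym[of H x] by (simp add: B_simps B_invariant)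
  have span: "span {v. \<forall>A\<in>M ` t. \<exists>\<mu>. A v = \<mu> *\<^sub>R v} = UNIV"
  proof (rule qq.common_eigenvectors_span)
    fix A assume "A \<in> M ` t"
    then obtain H where H: "A = M H" by blast
    show "linear A" unfolding H M_def by (rule linearI) (simp_all add: prod_eq_iff L_simps)
    show "qq (A x) y = qq x (A y)" for x y
      unfolding H M_def by (simp add: qq_def B_simps sk)
    fix C x assume "A \<in> M ` t" "C \<in> M ` t"
    then obtain H K where HK: "A = M H" "C = M K" "H \<in> t" "K \<in> t" by blast
    have "L H (L K x) = L K (L H x)" for x
      using jacobi[of H K x] t_abelian[OF HK(3,4)] by (simp add: L_simps)
    then show "A (C x) = C (A x)" by (simp add: HK M_def L_simps)
  qed
  have "v \<in> S" if v: "v \<in> {v. \<forall>A\<in>M ` t. \<exists>\<mu>. A v = \<mu> *\<^sub>R v}" for v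
  proof (cases "v = 0")
    case True then show ?thesis using subspace_0[OF \<open>subspace S\<close>] by simp
  next
    case False
    have "\<exists>\<mu>. (- L H (snd v), L H (fst v)) = \<mu> *\<^sub>R v" if "H \<in> t" for H
    proof -
      have "\<exists>\<mu>. M H v = \<mu> *\<^sub>R v" using v that by blast
      then show ?thesis by (simp only: M_def)
    qed
    then obtain \<alpha> where \<alpha>: "\<alpha> \<in> cartan_dual t" "v \<in> rs \<alpha>"
      using eigenvector_root_space[OF False] by blast
    show ?thesis
    proof (cases "\<alpha> \<in> R")
      case True
      have "v = 0 + (\<Sum>\<beta>\<in>R. if \<beta> = \<alpha> then v else 0)" using True finite_R by simp
      then show ?thesis unfolding S_def using \<alpha> subspace_0[OF subtt]
        by (intro CollectI exI[of _ 0] exI[of _ "\<lambda>\<beta>. if \<beta> = \<alpha> then v else 0"]) (auto simp: rs_closed)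
    next
      case no: False
      then have "\<alpha> = 0" using rs_trivial[OF \<alpha>(1) _ _ \<alpha>(2)] False by blast
      then have "v \<in> t \<times> t" using \<alpha>(2) by (simp add: rs_0)
      then show ?thesis unfolding S_def
        by (intro CollectI exI[of _ v] exI[of _ "\<lambda>_. 0"]) (auto simp: rs_closed)
    qed
  qed
  then have "span {v. \<forall>A\<in>M ` t. \<exists>\<mu>. A v = \<mu> *\<^sub>R v} \<subseteq> S"
    using \<open>subspace S\<close> by (intro span_minimal) auto
  then have "V \<in> S" using span by auto
  then show ?thesis unfolding S_def by blast
qed

text \<open>\<open>BC\<close> pairs the space of \<alpha> nontrivially only with that of -\<alpha>.
  Pairing the difference of the two sums with vectors there isolates the component at \<alpha>, and
  nondegeneracy makes it vanish.\<close>

lemma root_sum_unique: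
  assumes f: "\<And>\<alpha>. \<alpha> \<in> R \<Longrightarrow> f \<alpha> \<in> rs \<alpha>" and h: "\<And>\<alpha>. \<alpha> \<in> R \<Longrightarrow> h \<alpha> \<in> rs \<alpha>"
    and eq: "(\<Sum>\<alpha>\<in>R. f \<alpha>) = (\<Sum>\<alpha>\<in>R. h \<alpha>)" and \<alpha>: "\<alpha> \<in> R"
  shows "f \<alpha> = h \<alpha>"
proof -
  define d where "d \<beta> = f \<beta> - h \<beta>" for \<beta>
  have d: "d \<beta> \<in> rs \<beta>" if "\<beta> \<in> R" for \<beta> using f h that by (simp add: d_def rs_closed)
  have s: "(\<Sum>\<alpha>\<in>R. d \<alpha>) = 0" using eq by (simp add: d_def sum_subtractf)
  have ortho: "BC (d \<alpha>) Q = 0" if \<beta>: "\<beta> \<in> R" and Q: "Q \<in> rs \<beta>" for \<beta> Q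
  proof (cases "\<alpha> + \<beta> = 0")
    case False
    then show ?thesis using rs_orthogonal[OF R_dual(1)[OF \<alpha>] R_dual(1)[OF \<beta>]] d[OF \<alpha>] Q by blast
  next
    case True
    have "0 = BC (\<Sum>\<alpha>\<in>R. d \<alpha>) Q" by (simp add: s BC_simps)
    also have "\<dots> = (\<Sum>\<gamma>\<in>R. BC (d \<gamma>) Q)" by (rule BC_sum)
    also have "\<dots> = (\<Sum>\<gamma>\<in>R. if \<gamma> = \<alpha> then BC (d \<alpha>) Q else 0)"
    proof (rule sum.cong[OF refl])
      fix \<gamma> assume \<gamma>: "\<gamma> \<in> R"
      have "\<gamma> + \<beta> \<noteq> 0" if "\<gamma> \<noteq> \<alpha>" using that True by (metis add_right_cancel)
      then show "BC (d \<gamma>) Q = (if \<gamma> = \<alpha> then BC (d \<alpha>) Q else 0)"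
        using rs_orthogonal[OF R_dual(1)[OF \<gamma>] R_dual(1)[OF \<beta>] _ d[OF \<gamma>] Q] by auto
    qed
    also have "\<dots> = BC (d \<alpha>) Q" using \<alpha> finite_R by simp
    finally show ?thesis by simp
  qed
  have "BC (d \<alpha>) Q = 0" for Q
  proof -
    obtain Q0 k where Q: "Q0 \<in> t \<times> t" "\<forall>\<alpha>\<in>R. k \<alpha> \<in> rs \<alpha>" "Q = Q0 + (\<Sum>\<alpha>\<in>R. k \<alpha>)"
      using full_decomposition[of Q] by blast
    have "BC (d \<alpha>) Q0 = 0" by (rule mCD[OF rs_mC[OF \<alpha> d[OF \<alpha>]] Q(1)])
    then show ?thesis using ortho Q(2) by (simp add: Q(3) BC_simps BC_sum)
  qed
  then have "d \<alpha> = 0" by (rule BC_nondegenerate)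
  then show ?thesis by (simp add: d_def)
qed

lemma mC_decomposition:
  assumes "V \<in> mC" shows "\<exists>f. (\<forall>\<alpha>\<in>R. f \<alpha> \<in> rs \<alpha>) \<and> V = (\<Sum>\<alpha>\<in>R. f \<alpha>)"
proof -
  obtain V0 f where V: "V0 \<in> t \<times> t" "\<forall>\<alpha>\<in>R. f \<alpha> \<in> rs \<alpha>" "V = V0 + (\<Sum>\<alpha>\<in>R. f \<alpha>)"
    using full_decomposition[of V] by blast
  have "(\<Sum>\<alpha>\<in>R. f \<alpha>) \<in> mC" using V(2) rs_mC by (intro mC_sum) blast
  then have "V - (\<Sum>\<alpha>\<in>R. f \<alpha>) \<in> mC" using assms mC_closed by blast
  then have "V0 = 0" using V(1,3) mC_t by simp
  then show ?thesis using V by auto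
qed

lemma root_decomposition_exists: assumes "X \<in> m" shows "\<exists>Xr. root_decomposition L t X Xr"
proof -
  have "(X, 0) \<in> mC" using assms by (auto simp: mC_iff m_space_def B_simps)
  from mC_decomposition[OF this] show ?thesis by (simp only: root_decomposition_def)
qed

lemma root_decompositionD:
  assumes "root_decomposition L t X Xr"
  shows "\<alpha> \<in> R \<Longrightarrow> Xr \<alpha> \<in> rs \<alpha>" "(X, 0) = (\<Sum>\<alpha>\<in>R. Xr \<alpha>)"
proof -
  note * = assms[unfolded root_decomposition_def]
  show "\<alpha> \<in> R \<Longrightarrow> Xr \<alpha> \<in> rs \<alpha>" using bspec[OF conjunct1[OF *]] .
  show "(X, 0) = (\<Sum>\<alpha>\<in>R. Xr \<alpha>)" by (rule conjunct2[OF *])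
qed

text \<open>Conjugation fixes the real vector \<open>X\<close> and exchanges the root spaces of
  \<alpha> and -\<alpha>, so uniqueness of components applies.\<close>

lemma root_decomposition_cnjp:
  assumes dec: "root_decomposition L t X Xr" and \<alpha>: "\<alpha> \<in> R"
  shows "Xr (- \<alpha>) = cnjp (Xr \<alpha>)"
proof -
  note X = root_decompositionD[OF dec]
  have "(\<Sum>\<beta>\<in>R. cnjp (Xr (- \<beta>))) = (\<Sum>\<beta>\<in>R. cnjp (Xr \<beta>))"
    by (rule sum.reindex_bij_witness[of _ uminus uminus]) (auto simp: uminus_R)
  also have "\<dots> = (\<Sum>\<beta>\<in>R. Xr \<beta>)"
    by (simp only: cnjp_sum[symmetric] X(2)[symmetric] cnjp_simps)
  finally have eq: "(\<Sum>\<beta>\<in>R. cnjp (Xr (- \<beta>))) = (\<Sum>\<beta>\<in>R. Xr \<beta>)" .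
  have "cnjp (Xr (- \<alpha>)) = Xr \<alpha>"
  proof (rule root_sum_unique[OF _ X(1) eq \<alpha>])
    fix \<beta> assume "\<beta> \<in> R"
    then have "cnjp (Xr (- \<beta>)) \<in> rs (- (- \<beta>))"
      by (intro cnjp_rs X(1) uminus_R R_dual(1))
    then show "cnjp (Xr (- \<beta>)) \<in> rs \<beta>" by simp
  qed
  then show ?thesis using cnjp_simps(1) by metis
qed

text \<open>Definiteness of -B justifies the definite description: orthogonal projection onto
  \<open>t\<close> gives existence, and m \<inter> t = 0 gives uniqueness.\<close>

lemma m_proj_props: "m_proj L t X \<in> m" "X - m_proj L t X \<in> t"
proof -
  obtain p where p: "p \<in> t" "\<forall>s\<in>t. - B (X - p) s = 0"
    using q.projection_exists[OF subspace_t, of X] by blast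
  have 1: "X - p \<in> m" "X - (X - p) \<in> t" using p by (auto simp: m_space_def)
  have "\<exists>!Y. Y \<in> m \<and> X - Y \<in> t"
  proof (rule ex1I[of _ "X - p"])
    fix Y assume Y: "Y \<in> m \<and> X - Y \<in> t"
    have d: "Y - (X - p) = (X - (X - p)) - (X - Y)" by simp
    have "Y - (X - p) \<in> t" unfolding d by (rule subspace_diff[OF subspace_t 1(2)]) (use Y in blast)
    moreover have "Y - (X - p) \<in> m" using 1 Y by (auto simp: m_space_def B_simps)
    ultimately have "B (Y - (X - p)) (Y - (X - p)) = 0" by (simp add: m_space_def)
    then show "Y = X - p" using negdef[of "Y - (X - p)"] by force
  qed (use 1 in blast)
  from theI'[OF this] show "m_proj L t X \<in> m" "X - m_proj L t X \<in> t" by (simp_all add: m_proj_def)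
qed

end

section \<open>Simple roots, invariant metrics and the formula\<close>

lemma lin_comb_simps:
  "lin_comb \<Delta> (\<lambda>i. r i + s i) = lin_comb \<Delta> r + lin_comb \<Delta> s"
  "lin_comb \<Delta> (\<lambda>i. r i - s i) = lin_comb \<Delta> r - lin_comb \<Delta> s"
  "lin_comb \<Delta> (\<lambda>i. - r i) = - lin_comb \<Delta> r"
  by (simp_all add: lin_comb_def fun_eq_iff sum.distrib sum_subtractf sum_negf algebra_simps)

lemma lin_comb_cong: "(\<And>i. i < length \<Delta> \<Longrightarrow> r i = s i) \<Longrightarrow> lin_comb \<Delta> r = lin_comb \<Delta> s"
  by (simp add: lin_comb_def)

lemma sum_split_filter:
  assumes "finite A" shows "sum f A = sum f {x \<in> A. P x} + sum f {x \<in> A. \<not> P x}"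
proof -
  have "sum f A = sum f ({x \<in> A. P x} \<union> {x \<in> A. \<not> P x})" by (rule sum.cong) auto
  also have "\<dots> = sum f {x \<in> A. P x} + sum f {x \<in> A. \<not> P x}"
    by (rule sum.union_disjoint) (use assms in auto)
  finally show ?thesis .
qed

locale compact_cartan_roots = compact_cartan L t for L :: "'e::euclidean_space \<Rightarrow> 'e \<Rightarrow> 'e" and t +
  fixes \<Delta> :: "'e functional list"
  assumes simple: "simple_roots L t \<Delta>"
begin

section \<open>Positive roots and their order\<close>

abbreviation "Rp \<equiv> positive_roots L t \<Delta>"

lemma lin_comb_inj:
  assumes "lin_comb \<Delta> r = lin_comb \<Delta> s" "i < length \<Delta>" shows "r i = s i"
proof -
  have "lin_comb \<Delta> (\<lambda>i. r i - s i) = 0" using assms(1) by (simp add: lin_comb_simps)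
  then have "r i - s i = 0" using simple assms(2) unfolding simple_roots_def by blast
  then show ?thesis by simp
qed

lemma Rp_R: "\<alpha> \<in> Rp \<Longrightarrow> \<alpha> \<in> R" by (simp add: positive_roots_def)

lemma Rp_cases: assumes "\<alpha> \<in> R" shows "\<alpha> \<in> Rp \<or> - \<alpha> \<in> Rp"
proof -
  obtain n :: "nat \<Rightarrow> nat" where "\<alpha> = lin_comb \<Delta> (\<lambda>i. real (n i)) \<or> \<alpha> = lin_comb \<Delta> (\<lambda>i. - real (n i))"
    using simple assms unfolding simple_roots_def by blast
  then show ?thesis using assms uminus_R[OF assms] by (auto simp: positive_roots_def lin_comb_simps)
qed

lemma Rp_add: assumes "\<alpha> \<in> Rp" "\<beta> \<in> Rp" "\<alpha> + \<beta> \<in> R" shows "\<alpha> + \<beta> \<in> Rp"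
proof -
  obtain n k :: "nat \<Rightarrow> nat" where "\<alpha> = lin_comb \<Delta> (\<lambda>i. real (n i))" "\<beta> = lin_comb \<Delta> (\<lambda>i. real (k i))"
    using assms by (auto simp: positive_roots_def)
  then have "\<alpha> + \<beta> = lin_comb \<Delta> (\<lambda>i. real (n i + k i))" by (simp add: lin_comb_simps)
  then have "\<exists>n::nat \<Rightarrow> nat. \<alpha> + \<beta> = lin_comb \<Delta> (\<lambda>i. real (n i))"
    by (rule exI[of _ "\<lambda>i. n i + k i"])
  then show ?thesis using assms(3) by (simp only: positive_roots_def mem_Collect_eq simp_thms)
qed

text \<open>Coefficients with respect to the simple roots are unique, so those of \<alpha> would be
  both nonnegative and nonpositive, and \<alpha> would be 0.\<close>

lemma Rp_uminus: assumes "\<alpha> \<in> Rp" shows "- \<alpha> \<notin> Rp"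
proof
  assume "- \<alpha> \<in> Rp"
  then obtain k :: "nat \<Rightarrow> nat" where k: "- \<alpha> = lin_comb \<Delta> (\<lambda>i. real (k i))"
    by (auto simp: positive_roots_def)
  obtain n :: "nat \<Rightarrow> nat" where n: "\<alpha> = lin_comb \<Delta> (\<lambda>i. real (n i))"
    using assms by (auto simp: positive_roots_def)
  have "lin_comb \<Delta> (\<lambda>i. real (n i)) = lin_comb \<Delta> (\<lambda>i. - real (k i))"
    unfolding lin_comb_simps k[symmetric] n[symmetric] by simp
  from lin_comb_inj[OF this] have "n i = 0" if "i < length \<Delta>" for i using that by fastforce
  then have "\<alpha> = 0" unfolding n by (simp add: lin_comb_def fun_eq_iff)
  then show False using R_dual(2)[OF Rp_R[OF assms]] by simp
qed

lemma finite_Rp: "finite Rp" using finite_R by (rule rev_finite_subset) (auto intro: Rp_R)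

lemma sum_R_Rp: "(\<Sum>\<alpha>\<in>R. h \<alpha>) = (\<Sum>\<alpha>\<in>Rp. h \<alpha> + h (- \<alpha>))" for h :: "_ \<Rightarrow> 'b::ab_group_add"
proof -
  have "(\<Sum>\<alpha>\<in>R. h \<alpha>) = (\<Sum>\<alpha>\<in>{\<alpha> \<in> R. \<alpha> \<in> Rp}. h \<alpha>) + (\<Sum>\<alpha>\<in>{\<alpha> \<in> R. \<alpha> \<notin> Rp}. h \<alpha>)"
    by (rule sum_split_filter[OF finite_R])
  moreover have "{\<alpha> \<in> R. \<alpha> \<in> Rp} = Rp" using Rp_R by blast
  moreover have "(\<Sum>\<alpha>\<in>{\<alpha> \<in> R. \<alpha> \<notin> Rp}. h \<alpha>) = (\<Sum>\<alpha>\<in>Rp. h (- \<alpha>))"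
    by (rule sum.reindex_bij_witness[of _ uminus uminus])
      (use Rp_cases Rp_R uminus_R Rp_uminus in auto)
  ultimately show ?thesis by (simp add: sum.distrib)
qed

lemma root_less_total:
  assumes "\<alpha> \<in> Rp" "\<beta> \<in> Rp" "\<alpha> \<noteq> \<beta>" shows "root_less \<Delta> \<alpha> \<beta> \<or> root_less \<Delta> \<beta> \<alpha>"
proof -
  obtain a b :: "nat \<Rightarrow> nat" where ab: "\<alpha> = lin_comb \<Delta> (\<lambda>i. real (a i))" "\<beta> = lin_comb \<Delta> (\<lambda>i. real (b i))"
    using assms by (auto simp: positive_roots_def)
  have ex: "\<exists>i. i < length \<Delta> \<and> a i \<noteq> b i"
    using assms(3) lin_comb_cong[of \<Delta> "\<lambda>i. real (a i)" "\<lambda>i. real (b i)"] ab by auto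
  define k where "k = (LEAST i. i < length \<Delta> \<and> a i \<noteq> b i)"
  have k: "k < length \<Delta>" "a k \<noteq> b k" using LeastI_ex[OF ex] by (simp_all add: k_def)
  have eq: "real (a i) = real (b i)" if "i < k" for i
    using not_less_Least[OF that[unfolded k_def]] that k(1) by auto
  show ?thesis
  proof (cases "a k < b k")
    case True
    then have "root_less \<Delta> \<alpha> \<beta>" unfolding root_less_def
      by (intro exI[of _ "\<lambda>i. real (a i)"] exI[of _ "\<lambda>i. real (b i)"] conjI ab exI[of _ k]) (use k eq in auto)
    then show ?thesis ..
  next
    case False
    then have "root_less \<Delta> \<beta> \<alpha>" unfolding root_less_def
      by (intro exI[of _ "\<lambda>i. real (b i)"] exI[of _ "\<lambda>i. real (a i)"] conjI ab exI[of _ k]) (use k eq in auto)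
    then show ?thesis ..
  qed
qed

text \<open>\<open>root_less\<close> quantifies over coefficient functions, which the roots
  determine only at indices below \<open>length \<Delta>\<close>. Agreement there suffices to
  compare the first indices at which the roots differ.\<close>

lemma root_less_asym: assumes "root_less \<Delta> \<alpha> \<beta>" shows "\<not> root_less \<Delta> \<beta> \<alpha>"
proof
  assume "root_less \<Delta> \<beta> \<alpha>"
  then obtain b' a' k' where l1: "\<beta> = lin_comb \<Delta> b'" "\<alpha> = lin_comb \<Delta> a'" "k' < length \<Delta>"
    "\<forall>i<k'. a' i - b' i = 0" "a' k' - b' k' > 0" unfolding root_less_def by blast
  obtain a b k where l2: "\<alpha> = lin_comb \<Delta> a" "\<beta> = lin_comb \<Delta> b" "k < length \<Delta>"
    "\<forall>i<k. b i - a i = 0" "b k - a k > 0" using assms unfolding root_less_def by blast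
  have e: "a i = a' i" "b i = b' i" if "i < length \<Delta>" for i
    using lin_comb_inj[of a a'] lin_comb_inj[of b b'] l1 l2 that by auto
  consider "k < k'" | "k' < k" | "k = k'" by linarith
  then show False
  proof cases
    case 1 then show False using l1(4) l2(5) e[OF l2(3)] by force
  next
    case 2 then show False using l2(4) l1(5) e[OF l1(3)] by force
  next
    case 3 then show False using l1(5) l2(5) e[OF l2(3)] by force
  qed
qed

lemma BC_rs_real:
  assumes "\<alpha> \<in> R" "P \<in> rs \<alpha>" and Z: "root_decomposition L t Z Zr"
  shows "BC P (Z, 0) = BC P (Zr (- \<alpha>))"
proof -
  note Z = root_decompositionD[OF Z]
  have "BC P (Z, 0) = (\<Sum>\<beta>\<in>R. BC P (Zr \<beta>))" unfolding Z(2) by (rule BC_sum)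
  also have "\<dots> = (\<Sum>\<beta>\<in>R. if \<beta> = - \<alpha> then BC P (Zr (- \<alpha>)) else 0)"
  proof (rule sum.cong[OF refl])
    fix \<beta> assume \<beta>: "\<beta> \<in> R"
    show "BC P (Zr \<beta>) = (if \<beta> = - \<alpha> then BC P (Zr (- \<alpha>)) else 0)"
    proof (cases "\<beta> = - \<alpha>")
      case False
      then have "\<alpha> + \<beta> \<noteq> 0" by (simp add: add_eq_0_iff)
      then show ?thesis
        using rs_orthogonal[OF R_dual(1)[OF assms(1)] R_dual(1)[OF \<beta>] _ assms(2) Z(1)[OF \<beta>]] False by simp
    qed simp
  qed
  also have "\<dots> = BC P (Zr (- \<alpha>))" using finite_R uminus_R[OF assms(1)] by simp
  finally show ?thesis .
qed

text \<open>For real \<open>X\<close> the components at \<alpha> and -\<alpha> are conjugate, so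
  their sum is twice the real part of the component at \<alpha>.\<close>

lemma m_component_eq:
  assumes X: "X \<in> m" and dec: "root_decomposition L t X Xr"
  shows "m_component L t \<Delta> X = (\<lambda>\<alpha>. if \<alpha> \<in> Rp then 2 *\<^sub>R fst (Xr \<alpha>) else 0)"
proof -
  note Xr = root_decompositionD[OF dec]
  define f where "f = (\<lambda>\<alpha>. if \<alpha> \<in> Rp then 2 *\<^sub>R fst (Xr \<alpha>) else 0)"
  have fX: "(f \<alpha>, 0) = Xr \<alpha> + Xr (- \<alpha>)" if "\<alpha> \<in> Rp" for \<alpha>
    using that by (simp add: f_def root_decomposition_cnjp[OF dec Rp_R] cnjp_simps)
  have pair_sum: "(\<Sum>\<alpha>\<in>I. (h \<alpha>, 0)) = ((\<Sum>\<alpha>\<in>I. h \<alpha>), 0)" for I :: "'e functional set" and h :: "_ \<Rightarrow> 'e"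
    by (simp add: prod_eq_iff fst_sum snd_sum)
  have "f \<alpha> \<in> m_root_space L t \<alpha>" if a: "\<alpha> \<in> Rp" for \<alpha>
  proof -
    have r: "Xr \<alpha> \<in> rs \<alpha>" "Xr (- \<alpha>) \<in> rs (- \<alpha>)" using Xr(1) Rp_R[OF a] uminus_R by auto
    then have "(f \<alpha>, 0) \<in> mC" unfolding fX[OF a]
      using rs_mC Rp_R[OF a] uminus_R mC_closed(1) by blast
    then have "f \<alpha> \<in> m" by (simp add: mC_iff)
    then show ?thesis using fX[OF a] r by (auto simp: m_root_space_def)
  qed
  moreover have "X = (\<Sum>\<alpha>\<in>Rp. f \<alpha>)"
  proof -
    have "(X, 0) = (\<Sum>\<alpha>\<in>Rp. Xr \<alpha> + Xr (- \<alpha>))" unfolding Xr(2) by (rule sum_R_Rp)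
    also have "\<dots> = (\<Sum>\<alpha>\<in>Rp. (f \<alpha>, 0))" using fX by simp
    finally show ?thesis by (simp add: pair_sum)
  qed
  \<comment> \<open>A competing family splits into root vectors and so yields a second root
    decomposition of \<open>X\<close>, which must agree with \<open>Xr\<close>.\<close>
  moreover have "h = f" if h: "\<forall>\<alpha>\<in>Rp. h \<alpha> \<in> m_root_space L t \<alpha>" "\<forall>\<alpha>. \<alpha> \<notin> Rp \<longrightarrow> h \<alpha> = 0" "X = (\<Sum>\<alpha>\<in>Rp. h \<alpha>)" for h
  proof -
    have "\<forall>\<alpha>\<in>Rp. \<exists>P Q. P \<in> rs \<alpha> \<and> Q \<in> rs (- \<alpha>) \<and> (h \<alpha>, 0) = P + Q"
      using h(1) unfolding m_root_space_def by blast
    then obtain P Q where PQ: "\<And>\<alpha>. \<alpha> \<in> Rp \<Longrightarrow> P \<alpha> \<in> rs \<alpha>" "\<And>\<alpha>. \<alpha> \<in> Rp \<Longrightarrow> Q \<alpha> \<in> rs (- \<alpha>)"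
      "\<And>\<alpha>. \<alpha> \<in> Rp \<Longrightarrow> (h \<alpha>, 0) = P \<alpha> + Q \<alpha>" by metis
    define Yr where "Yr \<alpha> = (if \<alpha> \<in> Rp then P \<alpha> else Q (- \<alpha>))" for \<alpha>
    have Y: "Yr \<alpha> \<in> rs \<alpha>" if "\<alpha> \<in> R" for \<alpha>
      using PQ(1)[of \<alpha>] PQ(2)[of "- \<alpha>"] Rp_cases[OF that] by (auto simp: Yr_def)
    have YR: "Yr \<alpha> + Yr (- \<alpha>) = (h \<alpha>, 0)" if "\<alpha> \<in> Rp" for \<alpha>
      using that PQ(3)[OF that] Rp_uminus[OF that] by (simp add: Yr_def)
    have "(\<Sum>\<alpha>\<in>R. Yr \<alpha>) = (\<Sum>\<alpha>\<in>Rp. (h \<alpha>, 0))" unfolding sum_R_Rp using YR by simp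
    also have "\<dots> = (X, 0)" by (simp add: pair_sum h(3))
    finally have eq: "(\<Sum>\<alpha>\<in>R. Yr \<alpha>) = (\<Sum>\<alpha>\<in>R. Xr \<alpha>)" using Xr(2) by simp
    have YX: "Yr \<alpha> = Xr \<alpha>" if "\<alpha> \<in> R" for \<alpha> by (rule root_sum_unique[OF Y Xr(1) eq that])
    have "h \<alpha> = f \<alpha>" for \<alpha>
    proof (cases "\<alpha> \<in> Rp")
      case True
      then have "(h \<alpha>, 0) = (f \<alpha>, 0)"
        using YR[OF True] YX[OF Rp_R[OF True]] YX[OF uminus_R[OF Rp_R[OF True]]] fX[OF True] by simp
      then show ?thesis by simp
    qed (simp add: f_def h(2))
    then show ?thesis by blast
  qed
  ultimately have "m_component L t \<Delta> X = f"
    unfolding m_component_def by (intro the_equality) (auto simp: f_def)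
  then show ?thesis by (simp add: f_def)
qed

section \<open>Invariant metrics and the equation for U\<close>

context
  fixes c :: "'e functional \<Rightarrow> real"
  assumes c_pos: "\<forall>\<alpha>\<in>Rp. c \<alpha> > 0"
begin

definition cc :: "'e functional \<Rightarrow> real" where "cc \<alpha> = (if \<alpha> \<in> Rp then c \<alpha> else c (- \<alpha>))"

lemma cc_uminus: "\<alpha> \<in> R \<Longrightarrow> cc (- \<alpha>) = cc \<alpha>"
  using Rp_cases[of \<alpha>] Rp_uminus[of \<alpha>] by (auto simp: cc_def)

lemma cc_pos: "\<alpha> \<in> R \<Longrightarrow> cc \<alpha> > 0"
  using Rp_cases[of \<alpha>] c_pos by (auto simp: cc_def)

abbreviation "g \<equiv> invariant_metric L t \<Delta> c"

lemma g_sym: "g X Y = g Y X"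
  unfolding invariant_metric_def by (intro sum.cong refl) (simp add: B_sym)

definition Lam :: "('e functional \<Rightarrow> 'e cplx) \<Rightarrow> 'e cplx" where
  "Lam Xr = (\<Sum>\<alpha>\<in>R. cc \<alpha> *\<^sub>R Xr \<alpha>)"

lemma Lam_mC: assumes "root_decomposition L t X Xr" shows "Lam Xr \<in> mC"
  unfolding Lam_def
  by (intro mC_sum mC_closed(4) rs_mC) (use root_decompositionD[OF assms] in auto)

text \<open>Only opposite root components pair nontrivially. For each positive root the Killing form
  of the two components thus splits into one contribution of \<alpha> and one of -\<alpha>, both
  with the same constant, and the sum over all roots is the pairing with
  \<open>Lam Xr\<close>.\<close>

lemma g_eq_BC:
  assumes X: "X \<in> m" "root_decomposition L t X Xr" and Z: "Z \<in> m"
  shows "of_real (g X Z) = - BC (Lam Xr) (Z, 0)"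
proof -
  obtain Zr where Zr: "root_decomposition L t Z Zr" using root_decomposition_exists[OF Z] by blast
  note X' = root_decompositionD[OF X(2)] and Z' = root_decompositionD[OF Zr]
  have 1: "of_real (B (m_component L t \<Delta> X \<alpha>) (m_component L t \<Delta> Z \<alpha>)) =
      BC (Xr \<alpha>) (Z, 0) + BC (Xr (- \<alpha>)) (Z, 0)" if a: "\<alpha> \<in> Rp" for \<alpha>
  proof -
    have aR: "\<alpha> \<in> R" "- \<alpha> \<in> R" using Rp_R[OF a] uminus_R by auto
    have c: "(m_component L t \<Delta> X \<alpha>, 0) = Xr \<alpha> + Xr (- \<alpha>)" "(m_component L t \<Delta> Z \<alpha>, 0) = Zr \<alpha> + Zr (- \<alpha>)"
      unfolding m_component_eq[OF X] m_component_eq[OF Z Zr]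
      using a by (simp_all add: root_decomposition_cnjp[OF X(2) aR(1)] root_decomposition_cnjp[OF Zr aR(1)] cnjp_simps)
    have ne: "\<alpha> + \<alpha> \<noteq> 0" "- \<alpha> + - \<alpha> \<noteq> 0"
      using R_dual(2)[OF aR(1)] by (auto simp: fun_eq_iff)
    have z: "BC (Xr \<alpha>) (Zr \<alpha>) = 0" "BC (Xr (- \<alpha>)) (Zr (- \<alpha>)) = 0"
      using rs_orthogonal[OF R_dual(1)[OF aR(1)] R_dual(1)[OF aR(1)] ne(1) X'(1)[OF aR(1)] Z'(1)[OF aR(1)]]
        rs_orthogonal[OF R_dual(1)[OF aR(2)] R_dual(1)[OF aR(2)] ne(2) X'(1)[OF aR(2)] Z'(1)[OF aR(2)]]
      by auto
    have "of_real (B (m_component L t \<Delta> X \<alpha>) (m_component L t \<Delta> Z \<alpha>)) =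
        BC (Xr \<alpha> + Xr (- \<alpha>)) (Zr \<alpha> + Zr (- \<alpha>))"
      unfolding c[symmetric] by (rule BC_real[symmetric])
    also have "\<dots> = BC (Xr \<alpha>) (Zr (- \<alpha>)) + BC (Xr (- \<alpha>)) (Zr \<alpha>)" by (simp add: BC_simps z)
    also have "\<dots> = BC (Xr \<alpha>) (Z, 0) + BC (Xr (- \<alpha>)) (Z, 0)"
      using BC_rs_real[OF aR(1) X'(1)[OF aR(1)] Zr] BC_rs_real[OF aR(2) X'(1)[OF aR(2)] Zr] by simp
    finally show ?thesis .
  qed
  have "of_real (g X Z) = - (\<Sum>\<alpha>\<in>Rp. of_real (c \<alpha>) * (BC (Xr \<alpha>) (Z, 0) + BC (Xr (- \<alpha>)) (Z, 0)))"
    unfolding invariant_metric_def of_real_sum sum_negf[symmetric]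
    by (intro sum.cong refl) (simp add: 1)
  also have "(\<Sum>\<alpha>\<in>Rp. of_real (c \<alpha>) * (BC (Xr \<alpha>) (Z, 0) + BC (Xr (- \<alpha>)) (Z, 0))) =
      (\<Sum>\<alpha>\<in>Rp. of_real (cc \<alpha>) * BC (Xr \<alpha>) (Z, 0) + of_real (cc (- \<alpha>)) * BC (Xr (- \<alpha>)) (Z, 0))"
    by (intro sum.cong refl) (simp add: cc_uminus[OF Rp_R], simp add: cc_def algebra_simps)
  also have "\<dots> = (\<Sum>\<alpha>\<in>R. of_real (cc \<alpha>) * BC (Xr \<alpha>) (Z, 0))"
    by (rule sum_R_Rp[of "\<lambda>\<alpha>. of_real (cc \<alpha>) * BC (Xr \<alpha>) (Z, 0)", symmetric])
  also have "\<dots> = BC (Lam Xr) (Z, 0)" by (simp add: Lam_def BC_sum BC_simps)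
  finally show ?thesis .
qed

definition root_pairs :: "('e functional \<times> 'e functional) set" where
  "root_pairs = {p \<in> R \<times> R. fst p + snd p \<in> R}"

lemma finite_root_pairs: "finite root_pairs" using finite_R by (simp add: root_pairs_def)

text \<open>The part of [Z, Y] in \<open>t\<close> is orthogonal to \<open>Lam Xr\<close>, so the
  projection may be dropped; invariance and symmetry of the form then move the bracket with
  \<open>Y\<close> onto \<open>Lam Xr\<close>.\<close>

lemma g_m_proj:
  assumes "X \<in> m" "root_decomposition L t X Xr"
  shows "of_real (g X (m_proj L t (L Z Y))) = - BC (cb (Y, 0) (Lam Xr)) (Z, 0)"
proof -
  have "(L Z Y - m_proj L t (L Z Y), 0) \<in> t \<times> t"
    using m_proj_props(2) subspace_0[OF subspace_t] by blast
  then have "BC (Lam Xr) (L Z Y - m_proj L t (L Z Y), 0) = 0" by (rule mCD[OF Lam_mC[OF assms(2)]])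
  moreover have "(L Z Y, 0::'e) = (L Z Y - m_proj L t (L Z Y), 0) + (m_proj L t (L Z Y), 0)"
    by simp
  ultimately have "BC (Lam Xr) (m_proj L t (L Z Y), 0) = BC (Lam Xr) (L Z Y, 0)"
    by (simp only: BC_simps add_0)
  also have "(L Z Y, 0) = cb (Z, 0) (Y, 0)" by (simp add: prod_eq_iff L_simps)
  also have "BC (Lam Xr) (cb (Z, 0) (Y, 0)) = BC (cb (Y, 0) (Lam Xr)) (Z, 0)"
    by (metis BC_invariant BC_sym)
  finally show ?thesis using g_eq_BC[OF assms m_proj_props(1)] by simp
qed

text \<open>In the expansion of [Y, \<Lambda> X] + [X, \<Lambda> Y] over ordered pairs the constant
  of \<delta> stands before S \<delta> \<epsilon>. The component at \<gamma> collects the pairs with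
  sum \<gamma>, and 2 \<Lambda> is inverted by dividing by twice the constant of \<gamma>.\<close>

lemma U_root_formula:
  assumes X: "X \<in> m" "root_decomposition L t X Xr" and Y: "Y \<in> m" "root_decomposition L t Y Yr"
    and V: "V \<in> m"
    and eq: "\<And>Z. Z \<in> m \<Longrightarrow> 2 * g V Z = g X (m_proj L t (L Z Y)) + g (m_proj L t (L Z X)) Y"
  defines "S \<equiv> \<lambda>\<delta> \<epsilon>. cb (Yr \<epsilon>) (Xr \<delta>) + cb (Xr \<epsilon>) (Yr \<delta>)"
  shows "(V, 0) = (\<Sum>(\<delta>, \<epsilon>)\<in>root_pairs. (cc \<delta> / (2 * cc (\<delta> + \<epsilon>))) *\<^sub>R S \<delta> \<epsilon>)"
proof -
  note X' = root_decompositionD[OF X(2)] and Y' = root_decompositionD[OF Y(2)]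
  obtain Vr where Vr: "root_decomposition L t V Vr" using root_decomposition_exists[OF V] by blast
  note V' = root_decompositionD[OF Vr]
  define k where "k p = cc (fst p) *\<^sub>R S (fst p) (snd p)" for p
  have S: "S \<delta> \<epsilon> \<in> rs (\<delta> + \<epsilon>)" if "\<delta> \<in> R" "\<epsilon> \<in> R" for \<delta> \<epsilon>
    using cb_rs[OF Y'(1)[OF that(2)] X'(1)[OF that(1)]] cb_rs[OF X'(1)[OF that(2)] Y'(1)[OF that(1)]]
    by (simp add: S_def rs_closed add.commute)
  have krs: "k p \<in> rs (fst p + snd p)" if "p \<in> R \<times> R" for p
    using S[of "fst p" "snd p"] that by (auto simp: k_def rs_closed)
  define T where "T = cb (Y, 0) (Lam Xr) + cb (X, 0) (Lam Yr)"
  have T: "T = (\<Sum>p\<in>R \<times> R. k p)"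
  proof -
    have "T = (\<Sum>\<delta>\<in>R. \<Sum>\<epsilon>\<in>R. cc \<delta> *\<^sub>R S \<delta> \<epsilon>)"
      unfolding T_def Lam_def X'(2) Y'(2)
      by (simp add: cb_sum cb_simps S_def scaleR_add_right sum.distrib scaleR_sum_right)
    then show ?thesis by (simp add: sum.cartesian_product k_def case_prod_unfold)
  qed
  \<comment> \<open>A bracket of weight \<delta> + \<epsilon> that is not a root vanishes, unless
    the weight is 0 and the bracket lies in \<open>t \<times> t\<close>. Such terms are orthogonal
    to \<open>m\<close>.\<close>
  have rest: "(\<Sum>p\<in>{p \<in> R \<times> R. fst p + snd p \<notin> R}. k p) \<in> t \<times> t"
  proof (rule subspace_sum[OF subspace_Times[OF subspace_t subspace_t]])
    fix p assume p: "p \<in> {p \<in> R \<times> R. fst p + snd p \<notin> R}"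
    then have kp: "k p \<in> rs (fst p + snd p)" using krs by blast
    have cd: "fst p + snd p \<in> cartan_dual t"
      using p R_dual(1) cartan_dual_closed(3) by (auto simp: mem_Times_iff)
    show "k p \<in> t \<times> t"
    proof (cases "fst p + snd p = 0")
      case True then show ?thesis using kp by (simp add: rs_0)
    next
      case False
      have "k p = 0" by (rule rs_trivial[OF cd _ False kp]) (use p in blast)
      then show ?thesis using subspace_0[OF subspace_Times[OF subspace_t subspace_t]] by metis
    qed
  qed
  have Tsplit: "T = (\<Sum>p\<in>root_pairs. k p) + (\<Sum>p\<in>{p \<in> R \<times> R. fst p + snd p \<notin> R}. k p)"
    unfolding T root_pairs_def by (rule sum_split_filter) (use finite_R in simp)
  \<comment> \<open>The defect lies in \<open>mC\<close> and will be orthogonal to all of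
    \<open>m\<close>, in particular to its own real and imaginary parts; definiteness then makes it
    0.\<close>
  define E where "E = 2 *\<^sub>R Lam Vr - (\<Sum>p\<in>root_pairs. k p)"
  have EmC: "E \<in> mC" unfolding E_def
  proof (intro mC_closed(2) mC_closed(4) Lam_mC[OF Vr] mC_sum)
    fix p assume "p \<in> root_pairs"
    then have "fst p + snd p \<in> R" "p \<in> R \<times> R" unfolding root_pairs_def by blast+
    then show "k p \<in> mC" using krs rs_mC by blast
  qed
  have EZ: "BC E (Z, 0) = 0" if Z: "Z \<in> m" for Z
  proof -
    have "complex_of_real (2 * g V Z) = of_real (g X (m_proj L t (L Z Y)) + g Y (m_proj L t (L Z X)))"
      using eq[OF Z] g_sym by simp
    then have "- (2 * BC (Lam Vr) (Z, 0)) = - BC (cb (Y, 0) (Lam Xr)) (Z, 0) - BC (cb (X, 0) (Lam Yr)) (Z, 0)"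
      using g_eq_BC[OF V Vr Z] g_m_proj[OF X, of Z Y] g_m_proj[OF Y, of Z X] by simp
    moreover have "2 * x = a + b" if "- (2 * x) = - a - b" for x a b :: complex
    proof -
      have "2 * x + (- a - b) = 0" unfolding that[symmetric] by simp
      then show ?thesis by (simp add: algebra_simps)
    qed
    ultimately have "2 * BC (Lam Vr) (Z, 0) = BC T (Z, 0)" unfolding T_def BC_simps by blast
    moreover have "BC (\<Sum>p\<in>{p \<in> R \<times> R. fst p + snd p \<notin> R}. k p) (Z, 0) = 0"
    proof -
      have "(Z, 0) \<in> mC" using Z by (simp add: mC_iff m_space_def B_simps)
      from mCD[OF this rest] show ?thesis by (simp only: BC_sym)
    qed
    ultimately show ?thesis by (simp add: E_def Tsplit BC_simps)
  qed
  have "E = 0"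
  proof -
    have "BC E (fst E, 0) = 0" "BC E (snd E, 0) = 0" using EZ EmC mC_iff by blast+
    then have "B (fst E) (fst E) = 0" "B (snd E) (snd E) = 0" by (auto simp: BC_def B_simps complex_eq_iff)
    then show ?thesis using negdef[of "fst E"] negdef[of "snd E"] by (auto simp: prod_eq_iff)
  qed
  then have LV: "2 *\<^sub>R Lam Vr = (\<Sum>p\<in>root_pairs. k p)" by (simp add: E_def)
  have grp: "(\<Sum>\<gamma>\<in>R. \<Sum>p\<in>{p \<in> root_pairs. fst p + snd p = \<gamma>}. h p) = (\<Sum>p\<in>root_pairs. h p)"
    for h :: "_ \<Rightarrow> 'e cplx"
    by (rule sum.group[OF finite_root_pairs finite_R]) (auto simp: root_pairs_def)
  have comp: "(2 * cc \<gamma>) *\<^sub>R Vr \<gamma> = (\<Sum>p\<in>{p \<in> root_pairs. fst p + snd p = \<gamma>}. k p)" if \<gamma>: "\<gamma> \<in> R" for \<gamma>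
  proof (rule root_sum_unique[OF _ _ _ \<gamma>, of "\<lambda>\<gamma>. (2 * cc \<gamma>) *\<^sub>R Vr \<gamma>"])
    show "(\<Sum>\<gamma>\<in>R. (2 * cc \<gamma>) *\<^sub>R Vr \<gamma>) = (\<Sum>\<gamma>\<in>R. \<Sum>p\<in>{p \<in> root_pairs. fst p + snd p = \<gamma>}. k p)"
      unfolding grp LV[symmetric] by (simp add: Lam_def scaleR_sum_right)
    fix \<alpha> assume \<alpha>: "\<alpha> \<in> R"
    show "(2 * cc \<alpha>) *\<^sub>R Vr \<alpha> \<in> rs \<alpha>" using V'(1)[OF \<alpha>] by (rule rs_closed)
    show "(\<Sum>p\<in>{p \<in> root_pairs. fst p + snd p = \<alpha>}. k p) \<in> rs \<alpha>"
      by (rule rs_sum) (use krs in \<open>auto simp: root_pairs_def\<close>)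
  qed
  have Vg: "Vr \<gamma> = (\<Sum>p\<in>{p \<in> root_pairs. fst p + snd p = \<gamma>}. (cc (fst p) / (2 * cc (fst p + snd p))) *\<^sub>R S (fst p) (snd p))"
    if \<gamma>: "\<gamma> \<in> R" for \<gamma>
  proof -
    have "Vr \<gamma> = (1 / (2 * cc \<gamma>)) *\<^sub>R ((2 * cc \<gamma>) *\<^sub>R Vr \<gamma>)" using cc_pos[OF \<gamma>] by simp
    also have "\<dots> = (\<Sum>p\<in>{p \<in> root_pairs. fst p + snd p = \<gamma>}. (1 / (2 * cc \<gamma>)) *\<^sub>R k p)"
      unfolding comp[OF \<gamma>] by (rule scaleR_sum_right)
    also have "\<dots> = (\<Sum>p\<in>{p \<in> root_pairs. fst p + snd p = \<gamma>}. (cc (fst p) / (2 * cc (fst p + snd p))) *\<^sub>R S (fst p) (snd p))"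
      by (rule sum.cong[OF refl]) (auto simp: k_def)
    finally show ?thesis .
  qed
  have "(V, 0) = (\<Sum>p\<in>root_pairs. (cc (fst p) / (2 * cc (fst p + snd p))) *\<^sub>R S (fst p) (snd p))"
    unfolding V'(2) grp[symmetric] by (rule sum.cong[OF refl Vg])
  then show ?thesis by (simp add: case_prod_unfold)
qed

section \<open>Sums over pairs of roots and the final formula\<close>

definition "Ps = {p. fst p \<in> Rp \<and> snd p \<in> Rp \<and> fst p + snd p \<in> Rp}"
definition "Pd = {p. fst p \<in> Rp \<and> snd p \<in> Rp \<and> snd p - fst p \<in> Rp}"

text \<open>Pairs are sorted by the signs of their members. Equal signs give (\<alpha>, \<beta>) and
  (-\<alpha>, -\<beta>) over \<open>Ps\<close>. Mixed signs are split further by the sign of the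
  sum, and each of the four cases is parametrized by \<open>Pd\<close>.\<close>

lemma sum_root_pairs:
  fixes w :: "'e functional \<times> 'e functional \<Rightarrow> 'b::ab_group_add"
  shows "(\<Sum>p\<in>root_pairs. w p) = (\<Sum>(\<alpha>, \<beta>)\<in>Ps. w (\<alpha>, \<beta>) + w (- \<alpha>, - \<beta>)) +
    (\<Sum>(\<alpha>, \<beta>)\<in>Pd. w (- \<alpha>, \<beta>) + w (\<beta>, - \<alpha>) + (w (\<alpha>, - \<beta>) + w (- \<beta>, \<alpha>)))"
proof -
  note fin = finite_root_pairs
  have neg: "- \<alpha> \<in> Rp" if "\<alpha> \<in> R" "\<alpha> \<notin> Rp" for \<alpha> using Rp_cases that by blast
  have negR: "- \<alpha> \<in> R" "- \<alpha> \<notin> Rp" "\<alpha> \<in> R" if "\<alpha> \<in> Rp" for \<alpha> using Rp_R uminus_R Rp_uminus that by blast+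
  have neg2: "\<beta> - \<alpha> \<in> Rp" if "\<alpha> - \<beta> \<in> R" "\<alpha> - \<beta> \<notin> Rp" for \<alpha> \<beta> using neg[OF that] by simp
  have negR2: "\<alpha> - \<beta> \<in> R" "\<alpha> - \<beta> \<notin> Rp" if "\<beta> - \<alpha> \<in> Rp" for \<alpha> \<beta> using negR[OF that] by simp_all
  let ?P = "\<lambda>p. fst p \<in> Rp" and ?Q = "\<lambda>p. snd p \<in> Rp" and ?S = "\<lambda>p. fst p + snd p \<in> Rp"
  have 1: "(\<Sum>p\<in>{p \<in> {p \<in> root_pairs. ?P p}. ?Q p}. w p) = (\<Sum>(\<alpha>, \<beta>)\<in>Ps. w (\<alpha>, \<beta>))"
  proof (rule sum.cong)
    show "{p \<in> {p \<in> root_pairs. ?P p}. ?Q p} = Ps"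
    proof (intro subset_antisym subsetI)
      fix p assume p: "p \<in> {p \<in> {p \<in> root_pairs. ?P p}. ?Q p}"
      then have "fst p \<in> Rp" "snd p \<in> Rp" "fst p + snd p \<in> R" by (simp_all add: root_pairs_def)
      then show "p \<in> Ps" using Rp_add by (simp add: Ps_def)
    next
      fix p assume "p \<in> Ps"
      then show "p \<in> {p \<in> {p \<in> root_pairs. ?P p}. ?Q p}"
        by (simp add: Ps_def root_pairs_def Rp_R mem_Times_iff)
    qed
  qed auto
  have 2: "(\<Sum>p\<in>{p \<in> {p \<in> root_pairs. \<not> ?P p}. \<not> ?Q p}. w p) = (\<Sum>(\<alpha>, \<beta>)\<in>Ps. w (- \<alpha>, - \<beta>))"
  proof (rule sum.reindex_bij_witness[of _ "\<lambda>p. (- fst p, - snd p)" "\<lambda>p. (- fst p, - snd p)"])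
    fix p assume p: "p \<in> {p \<in> {p \<in> root_pairs. \<not> ?P p}. \<not> ?Q p}"
    then have a: "- fst p \<in> Rp" "- snd p \<in> Rp" using neg by (auto simp: root_pairs_def)
    have "- (fst p + snd p) \<in> R" by (rule uminus_R) (use p in \<open>simp add: root_pairs_def\<close>)
    then have "- fst p + - snd p \<in> R" by simp
    then show "(- fst p, - snd p) \<in> Ps" using a Rp_add[OF a] by (simp add: Ps_def)
  next
    fix p assume p: "p \<in> Ps"
    have "- (fst p + snd p) \<in> R" by (rule negR(1)) (use p in \<open>simp add: Ps_def\<close>)
    then have "- fst p + - snd p \<in> R" by simp
    then show "(- fst p, - snd p) \<in> {p \<in> {p \<in> root_pairs. \<not> ?P p}. \<not> ?Q p}"
      using p negR by (simp add: Ps_def root_pairs_def)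
  qed (auto simp: case_prod_unfold)
  \<comment> \<open>Positive first entry, negative second entry, positive sum: (\<beta>, -\<alpha>).
    The other three cases arise from this one by swapping the entries, negating both, or doing
    both.\<close>
  have 3: "(\<Sum>p\<in>{p \<in> {p \<in> {p \<in> root_pairs. ?P p}. \<not> ?Q p}. ?S p}. w p) = (\<Sum>(\<alpha>, \<beta>)\<in>Pd. w (\<beta>, - \<alpha>))"
    by (rule sum.reindex_bij_witness[of _ "\<lambda>p. (snd p, - fst p)" "\<lambda>p. (- snd p, fst p)"])
      (auto simp: root_pairs_def Pd_def neg negR)
  have 4: "(\<Sum>p\<in>{p \<in> {p \<in> {p \<in> root_pairs. ?P p}. \<not> ?Q p}. \<not> ?S p}. w p) = (\<Sum>(\<alpha>, \<beta>)\<in>Pd. w (\<alpha>, - \<beta>))"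
  proof (rule sum.reindex_bij_witness[of _ "\<lambda>p. (fst p, - snd p)" "\<lambda>p. (fst p, - snd p)"])
    fix p assume p: "p \<in> {p \<in> {p \<in> {p \<in> root_pairs. ?P p}. \<not> ?Q p}. \<not> ?S p}"
    then have "- (fst p + snd p) \<in> Rp" by (intro neg) (auto simp: root_pairs_def)
    moreover have "- (fst p + snd p) = - snd p - fst p" by simp
    ultimately have "- snd p - fst p \<in> Rp" by (simp only:)
    then show "(fst p, - snd p) \<in> Pd" using p neg by (simp add: root_pairs_def Pd_def mem_Times_iff)
  qed (auto simp: root_pairs_def Pd_def negR negR2)
  have 5: "(\<Sum>p\<in>{p \<in> {p \<in> {p \<in> root_pairs. \<not> ?P p}. ?Q p}. ?S p}. w p) = (\<Sum>(\<alpha>, \<beta>)\<in>Pd. w (- \<alpha>, \<beta>))"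
    by (rule sum.reindex_bij_witness[of _ "\<lambda>p. (- fst p, snd p)" "\<lambda>p. (- fst p, snd p)"])
      (auto simp: root_pairs_def Pd_def neg negR add.commute)
  have 6: "(\<Sum>p\<in>{p \<in> {p \<in> {p \<in> root_pairs. \<not> ?P p}. ?Q p}. \<not> ?S p}. w p) = (\<Sum>(\<alpha>, \<beta>)\<in>Pd. w (- \<beta>, \<alpha>))"
  proof (rule sum.reindex_bij_witness[of _ "\<lambda>p. (- snd p, fst p)" "\<lambda>p. (snd p, - fst p)"])
    fix p assume p: "p \<in> {p \<in> {p \<in> {p \<in> root_pairs. \<not> ?P p}. ?Q p}. \<not> ?S p}"
    then have "- (fst p + snd p) \<in> Rp" by (intro neg) (auto simp: root_pairs_def)
    moreover have "- (fst p + snd p) = - fst p - snd p" by simp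
    ultimately have "- fst p - snd p \<in> Rp" by (simp only:)
    then show "(snd p, - fst p) \<in> Pd" using p neg by (simp add: root_pairs_def Pd_def mem_Times_iff)
  next
    fix p assume p: "p \<in> Pd"
    then show "(- snd p, fst p) \<in> {p \<in> {p \<in> {p \<in> root_pairs. \<not> ?P p}. ?Q p}. \<not> ?S p}"
      using negR[of "fst p"] negR[of "snd p"] negR2[of "snd p" "fst p"] by (auto simp: root_pairs_def Pd_def)
  qed (auto simp: case_prod_unfold)
  have "(\<Sum>p\<in>root_pairs. w p) =
      (\<Sum>p\<in>{p \<in> root_pairs. ?P p}. w p) + (\<Sum>p\<in>{p \<in> root_pairs. \<not> ?P p}. w p)"
    by (rule sum_split_filter[OF fin])
  moreover have "(\<Sum>p\<in>{p \<in> root_pairs. ?P p}. w p) =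
      (\<Sum>p\<in>{p \<in> {p \<in> root_pairs. ?P p}. ?Q p}. w p) + (\<Sum>p\<in>{p \<in> {p \<in> root_pairs. ?P p}. \<not> ?Q p}. w p)"
    by (rule sum_split_filter) (use fin in simp)
  moreover have "(\<Sum>p\<in>{p \<in> root_pairs. \<not> ?P p}. w p) =
      (\<Sum>p\<in>{p \<in> {p \<in> root_pairs. \<not> ?P p}. ?Q p}. w p) + (\<Sum>p\<in>{p \<in> {p \<in> root_pairs. \<not> ?P p}. \<not> ?Q p}. w p)"
    by (rule sum_split_filter) (use fin in simp)
  moreover have "(\<Sum>p\<in>{p \<in> {p \<in> root_pairs. ?P p}. \<not> ?Q p}. w p) =
      (\<Sum>p\<in>{p \<in> {p \<in> {p \<in> root_pairs. ?P p}. \<not> ?Q p}. ?S p}. w p) +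
      (\<Sum>p\<in>{p \<in> {p \<in> {p \<in> root_pairs. ?P p}. \<not> ?Q p}. \<not> ?S p}. w p)"
    by (rule sum_split_filter) (use fin in simp)
  moreover have "(\<Sum>p\<in>{p \<in> {p \<in> root_pairs. \<not> ?P p}. ?Q p}. w p) =
      (\<Sum>p\<in>{p \<in> {p \<in> {p \<in> root_pairs. \<not> ?P p}. ?Q p}. ?S p}. w p) +
      (\<Sum>p\<in>{p \<in> {p \<in> {p \<in> root_pairs. \<not> ?P p}. ?Q p}. \<not> ?S p}. w p)"
    by (rule sum_split_filter) (use fin in simp)
  ultimately show ?thesis
    unfolding 1 2 3 4 5 6 by (simp add: case_prod_unfold sum.distrib algebra_simps)
qed

text \<open>A pair and its negative have the same coefficient, because the constants are even in the
  root, and together they form one Z. Exchanging the members of a pair reverses the sign, whence the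
  differences of constants.\<close>

lemma U_formula:
  assumes X: "X \<in> m" "root_decomposition L t X Xr" and Y: "Y \<in> m" "root_decomposition L t Y Yr"
    and V: "V \<in> m"
    and eq: "\<And>Z. Z \<in> m \<Longrightarrow> 2 * g V Z = g X (m_proj L t (L Z Y)) + g (m_proj L t (L Z X)) Y"
  shows "(V, 0) =
      (\<Sum>(\<alpha>, \<beta>) \<in> {(\<alpha>, \<beta>). \<alpha> \<in> Rp \<and> \<beta> \<in> Rp \<and> \<alpha> + \<beta> \<in> Rp \<and> root_less \<Delta> \<alpha> \<beta>}.
         ((c \<alpha> - c \<beta>) / (2 * c (\<alpha> + \<beta>))) *\<^sub>R Z_term L Xr Yr \<alpha> \<beta>)
    + (\<Sum>(\<alpha>, \<beta>) \<in> {(\<alpha>, \<beta>). \<alpha> \<in> Rp \<and> \<beta> \<in> Rp \<and> \<beta> - \<alpha> \<in> Rp}.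
         ((c \<alpha> - c \<beta>) / (2 * c (\<beta> - \<alpha>))) *\<^sub>R Z_term L Xr Yr (- \<alpha>) \<beta>)"
proof -
  define S where "S \<delta> \<epsilon> = cb (Yr \<epsilon>) (Xr \<delta>) + cb (Xr \<epsilon>) (Yr \<delta>)" for \<delta> \<epsilon>
  define w where "w p = (cc (fst p) / (2 * cc (fst p + snd p))) *\<^sub>R S (fst p) (snd p)" for p
  have S_anti: "S \<epsilon> \<delta> = - S \<delta> \<epsilon>" for \<delta> \<epsilon>
    using cb_antisym[of "Yr \<epsilon>" "Xr \<delta>"] cb_antisym[of "Xr \<epsilon>" "Yr \<delta>"] by (simp add: S_def)
  have Z_S: "Z_term L Xr Yr \<alpha> \<beta> = S \<alpha> \<beta> + S (- \<alpha>) (- \<beta>)" for \<alpha> \<beta>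
    by (simp add: Z_term_def S_def)
  have ccRp: "cc \<alpha> = c \<alpha>" "cc (- \<alpha>) = c \<alpha>" if "\<alpha> \<in> Rp" for \<alpha>
    using that cc_uminus[OF Rp_R[OF that]] by (simp_all add: cc_def)
  have fin: "finite (Rp \<times> Rp)" using finite_Rp by simp
  have finP: "finite Ps" by (rule finite_subset[OF _ fin]) (auto simp: Ps_def)
  have Vw: "(V, 0) = (\<Sum>p\<in>root_pairs. w p)"
    using U_root_formula[OF X Y V eq] by (simp add: w_def S_def case_prod_unfold)
  have w1: "w (\<alpha>, \<beta>) + w (- \<alpha>, - \<beta>) = (c \<alpha> / (2 * c (\<alpha> + \<beta>))) *\<^sub>R Z_term L Xr Yr \<alpha> \<beta>"
    if "(\<alpha>, \<beta>) \<in> Ps" for \<alpha> \<beta>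
  proof -
    have "- \<alpha> + - \<beta> = - (\<alpha> + \<beta>)" by simp
    then show ?thesis using that ccRp[of \<alpha>] ccRp[of "\<alpha> + \<beta>"]
      by (simp only: w_def Z_S Ps_def mem_Collect_eq fst_conv snd_conv scaleR_add_right)
  qed
  \<comment> \<open>All four pairs have sum \<beta> - \<alpha> or its negative, hence the same
    denominator. Swapping the entries reverses \<open>S\<close>, so the constant of \<alpha> enters
    with a plus and that of \<beta> with a minus sign.\<close>
  have w2: "w (- \<alpha>, \<beta>) + w (\<beta>, - \<alpha>) + (w (\<alpha>, - \<beta>) + w (- \<beta>, \<alpha>)) =
      ((c \<alpha> - c \<beta>) / (2 * c (\<beta> - \<alpha>))) *\<^sub>R Z_term L Xr Yr (- \<alpha>) \<beta>"
    if p: "(\<alpha>, \<beta>) \<in> Pd" for \<alpha> \<beta>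
  proof -
    have e: "- \<alpha> + \<beta> = \<beta> - \<alpha>" "\<beta> + - \<alpha> = \<beta> - \<alpha>" "\<alpha> + - \<beta> = - (\<beta> - \<alpha>)" "- \<beta> + \<alpha> = - (\<beta> - \<alpha>)"
      by simp_all
    have p': "\<alpha> \<in> Rp" "\<beta> \<in> Rp" "\<beta> - \<alpha> \<in> Rp" using p by (simp_all add: Pd_def)
    define r where "r = 1 / (2 * c (\<beta> - \<alpha>))"
    have ws: "w (- \<alpha>, \<beta>) = (c \<alpha> * r) *\<^sub>R S (- \<alpha>) \<beta>" "w (\<beta>, - \<alpha>) = - ((c \<beta> * r) *\<^sub>R S (- \<alpha>) \<beta>)"
      "w (\<alpha>, - \<beta>) = (c \<alpha> * r) *\<^sub>R S \<alpha> (- \<beta>)" "w (- \<beta>, \<alpha>) = - ((c \<beta> * r) *\<^sub>R S \<alpha> (- \<beta>))"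
      unfolding w_def fst_conv snd_conv e ccRp[OF p'(1)] ccRp[OF p'(2)] ccRp[OF p'(3)] r_def
        S_anti[of \<beta> "- \<alpha>"] S_anti[of "- \<beta>" \<alpha>]
      by simp_all
    have req: "(c \<alpha> - c \<beta>) / (2 * c (\<beta> - \<alpha>)) = c \<alpha> * r - c \<beta> * r"
      by (simp add: r_def diff_divide_distrib)
    show ?thesis unfolding ws req Z_S by (simp add: algebra_simps)
  qed
  define k where "k \<alpha> \<beta> = (c \<alpha> / (2 * c (\<alpha> + \<beta>))) *\<^sub>R Z_term L Xr Yr \<alpha> \<beta>" for \<alpha> \<beta>
  have Z_anti: "Z_term L Xr Yr \<beta> \<alpha> = - Z_term L Xr Yr \<alpha> \<beta>" for \<alpha> \<beta>
    using S_anti[of \<alpha> \<beta>] S_anti[of "- \<alpha>" "- \<beta>"] by (simp add: Z_S)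
  let ?less = "\<lambda>p. root_less \<Delta> (fst p) (snd p)"
  have irrefl: "\<not> root_less \<Delta> \<alpha> \<alpha>" for \<alpha> using root_less_asym by blast
  have "(\<Sum>p\<in>Ps. k (fst p) (snd p)) = (\<Sum>p\<in>{p \<in> Ps. ?less p}. k (fst p) (snd p)) + (\<Sum>p\<in>{p \<in> Ps. \<not> ?less p}. k (fst p) (snd p))"
    by (rule sum_split_filter[OF finP])
  \<comment> \<open>By totality the complement of \<open>?less\<close> is the reverse order together
    with the diagonal, where Z vanishes by antisymmetry.\<close>
  also have "(\<Sum>p\<in>{p \<in> Ps. \<not> ?less p}. k (fst p) (snd p)) = (\<Sum>p\<in>{p \<in> Ps. root_less \<Delta> (snd p) (fst p)}. k (fst p) (snd p))"
  proof (rule sum.mono_neutral_right)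
    show "finite {p \<in> Ps. \<not> ?less p}" using finP by simp
    show "{p \<in> Ps. root_less \<Delta> (snd p) (fst p)} \<subseteq> {p \<in> Ps. \<not> ?less p}" using root_less_asym by blast
    have diag: "k \<alpha> \<alpha> = 0" for \<alpha>
    proof -
      have "Z_term L Xr Yr \<alpha> \<alpha> + Z_term L Xr Yr \<alpha> \<alpha> = 0" using Z_anti[of \<alpha> \<alpha>] by (metis add.right_inverse)
      then have "2 *\<^sub>R Z_term L Xr Yr \<alpha> \<alpha> = 0" by (simp only: scaleR_2)
      then show ?thesis by (simp add: k_def)
    qed
    have eq: "fst p = snd p" if "p \<in> {p \<in> Ps. \<not> ?less p} - {p \<in> Ps. root_less \<Delta> (snd p) (fst p)}" for p
      using that root_less_total[of "fst p" "snd p"] unfolding Ps_def by blast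
    show "\<forall>p\<in>{p \<in> Ps. \<not> ?less p} - {p \<in> Ps. root_less \<Delta> (snd p) (fst p)}. k (fst p) (snd p) = 0"
    proof
      fix p assume "p \<in> {p \<in> Ps. \<not> ?less p} - {p \<in> Ps. root_less \<Delta> (snd p) (fst p)}"
      from eq[OF this] show "k (fst p) (snd p) = 0" by (simp only: diag)
    qed
  qed
  \<comment> \<open>Swapping returns to pairs with \<alpha> < \<beta>, where antisymmetry of Z turns
    the second constant into a subtrahend.\<close>
  also have "\<dots> = (\<Sum>p\<in>{p \<in> Ps. ?less p}. k (snd p) (fst p))"
    by (rule sum.reindex_bij_witness[of _ prod.swap prod.swap]) (auto simp: Ps_def add.commute)
  also have "(\<Sum>p\<in>{p \<in> Ps. ?less p}. k (fst p) (snd p)) + (\<Sum>p\<in>{p \<in> Ps. ?less p}. k (snd p) (fst p)) =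
      (\<Sum>p\<in>{p \<in> Ps. ?less p}. ((c (fst p) - c (snd p)) / (2 * c (fst p + snd p))) *\<^sub>R Z_term L Xr Yr (fst p) (snd p))"
    unfolding sum.distrib[symmetric]
  proof (rule sum.cong[OF refl])
    fix p
    show "k (fst p) (snd p) + k (snd p) (fst p) =
        ((c (fst p) - c (snd p)) / (2 * c (fst p + snd p))) *\<^sub>R Z_term L Xr Yr (fst p) (snd p)"
      unfolding k_def Z_anti[of "snd p" "fst p"] add.commute[of "snd p"]
      by (simp add: diff_divide_distrib scaleR_diff_left)
  qed
  finally have first: "(\<Sum>p\<in>Ps. k (fst p) (snd p)) =
    (\<Sum>p\<in>{p \<in> Ps. ?less p}. ((c (fst p) - c (snd p)) / (2 * c (fst p + snd p))) *\<^sub>R Z_term L Xr Yr (fst p) (snd p))" .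
  have "(V, 0) = (\<Sum>(\<alpha>, \<beta>)\<in>Ps. w (\<alpha>, \<beta>) + w (- \<alpha>, - \<beta>)) +
    (\<Sum>(\<alpha>, \<beta>)\<in>Pd. w (- \<alpha>, \<beta>) + w (\<beta>, - \<alpha>) + (w (\<alpha>, - \<beta>) + w (- \<beta>, \<alpha>)))"
    unfolding Vw by (rule sum_root_pairs)
  also have "(\<Sum>(\<alpha>, \<beta>)\<in>Ps. w (\<alpha>, \<beta>) + w (- \<alpha>, - \<beta>)) = (\<Sum>p\<in>Ps. k (fst p) (snd p))"
    by (rule sum.cong[OF refl]) (auto simp: k_def w1)
  also have "\<dots> = (\<Sum>(\<alpha>, \<beta>) \<in> {(\<alpha>, \<beta>). \<alpha> \<in> Rp \<and> \<beta> \<in> Rp \<and> \<alpha> + \<beta> \<in> Rp \<and> root_less \<Delta> \<alpha> \<beta>}.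
         ((c \<alpha> - c \<beta>) / (2 * c (\<alpha> + \<beta>))) *\<^sub>R Z_term L Xr Yr \<alpha> \<beta>)"
    unfolding first by (rule sum.cong) (auto simp: Ps_def)
  also have "(\<Sum>(\<alpha>, \<beta>)\<in>Pd. w (- \<alpha>, \<beta>) + w (\<beta>, - \<alpha>) + (w (\<alpha>, - \<beta>) + w (- \<beta>, \<alpha>))) =
      (\<Sum>(\<alpha>, \<beta>) \<in> {(\<alpha>, \<beta>). \<alpha> \<in> Rp \<and> \<beta> \<in> Rp \<and> \<beta> - \<alpha> \<in> Rp}.
         ((c \<alpha> - c \<beta>) / (2 * c (\<beta> - \<alpha>))) *\<^sub>R Z_term L Xr Yr (- \<alpha>) \<beta>)"
  proof (rule sum.cong)
    show "Pd = {(\<alpha>, \<beta>). \<alpha> \<in> Rp \<and> \<beta> \<in> Rp \<and> \<beta> - \<alpha> \<in> Rp}" by (auto simp: Pd_def)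
    fix p assume "p \<in> {(\<alpha>, \<beta>). \<alpha> \<in> Rp \<and> \<beta> \<in> Rp \<and> \<beta> - \<alpha> \<in> Rp}"
    then have "p \<in> Pd" by (auto simp: Pd_def)
    then show "(case p of (\<alpha>, \<beta>) \<Rightarrow> w (- \<alpha>, \<beta>) + w (\<beta>, - \<alpha>) + (w (\<alpha>, - \<beta>) + w (- \<beta>, \<alpha>))) =
        (case p of (\<alpha>, \<beta>) \<Rightarrow> ((c \<alpha> - c \<beta>) / (2 * c (\<beta> - \<alpha>))) *\<^sub>R Z_term L Xr Yr (- \<alpha>) \<beta>)"
      using w2[of "fst p" "snd p"] by (simp only: case_prod_unfold prod.collapse)
  qed
  finally show ?thesis .
qed

end

end

theorem theorem2:
  fixes G :: "('g::{t2_space,second_countable_topology}, 'm) monoid_scheme"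
    and A :: "('g, 'e::euclidean_space) chart set"
    and D :: "'g set" and \<phi> :: "'g \<Rightarrow> 'e"
    and T :: "'g set"
    and L :: "'e \<Rightarrow> 'e \<Rightarrow> 'e" and t m :: "'e set"
    and \<Delta> :: "'e functional list" and Rp :: "'e functional set"
    and c :: "'e functional \<Rightarrow> real"
    and g :: "'e \<Rightarrow> 'e \<Rightarrow> real"
    and U :: "'e \<Rightarrow> 'e \<Rightarrow> 'e"
    and X Y :: 'e
    and Xr Yr :: "'e functional \<Rightarrow> 'e cplx"
  assumes "lie_group G A" and "compact (carrier G)"
    and "(D, \<phi>) \<in> A" and "\<one>\<^bsub>G\<^esub> \<in> D"
    and "L = lie_bracket G (D, \<phi>)" and "semisimple L"
    and "maximal_torus G T"
    and "t = subgroup_lie_algebra G (D, \<phi>) T" and "m = m_space L t"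
    and "simple_roots L t \<Delta>" and "Rp = positive_roots L t \<Delta>"
    and "\<forall>\<alpha>\<in>Rp. c \<alpha> > 0" and "g = invariant_metric L t \<Delta> c"
    and "symmetric_bilinear_map_on m U"
    and "\<forall>X\<in>m. \<forall>Y\<in>m. \<forall>Z\<in>m.
           2 * g (U X Y) Z = g X (m_proj L t (L Z Y)) + g (m_proj L t (L Z X)) Y"
    and "X \<in> m" and "Y \<in> m"
    and "root_decomposition L t X Xr" and "root_decomposition L t Y Yr"
  shows "(U X Y, 0) =
      (\<Sum>(\<alpha>, \<beta>) \<in> {(\<alpha>, \<beta>). \<alpha> \<in> Rp \<and> \<beta> \<in> Rp \<and> \<alpha> + \<beta> \<in> Rp \<and> root_less \<Delta> \<alpha> \<beta>}.
         ((c \<alpha> - c \<beta>) / (2 * c (\<alpha> + \<beta>))) *\<^sub>R Z_term L Xr Yr \<alpha> \<beta>)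
    + (\<Sum>(\<alpha>, \<beta>) \<in> {(\<alpha>, \<beta>). \<alpha> \<in> Rp \<and> \<beta> \<in> Rp \<and> \<beta> - \<alpha> \<in> Rp}.
         ((c \<alpha> - c \<beta>) / (2 * c (\<beta> - \<alpha>))) *\<^sub>R Z_term L Xr Yr (- \<alpha>) \<beta>)"
proof -
  interpret G: compact_lie_group_torus G A D \<phi> T
  proof -
    have "group G" using assms(1) by (simp add: lie_group_def)
    then show "compact_lie_group_torus G A D \<phi> T"
      using assms by (simp add: compact_lie_group_torus_def compact_lie_group_def
          compact_lie_group_axioms_def compact_lie_group_torus_axioms_def)
  qed
  have L: "L = G.br" and t: "t = G.t" using assms by (simp_all add: G.br_def G.t_def)
  interpret M: compact_cartan_roots L t \<Delta>
  proof
    show "bilinear L" unfolding L by (rule G.bilinear_br)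
    show "L X Y = - L Y X" for X Y unfolding L by (rule G.br_antisym)
    show "L X (L Y Z) = L (L X Y) Z + L Y (L X Z)" for X Y Z unfolding L by (rule G.br_jacobi)
    show "killing L X X < 0" if "X \<noteq> 0" for X
      unfolding L by (rule G.killing_negative_definite[OF _ that]) (use assms L in simp)
    show "subspace t" unfolding t by (rule G.subspace_t)
    show "L H K = 0" if "H \<in> t" "K \<in> t" for H K
      using G.t_abelian that unfolding L t by blast
    show "X \<in> t" if "\<And>H. H \<in> t \<Longrightarrow> L H X = 0" for X
      using G.centralizer_t that unfolding L t by blast
    show "simple_roots L t \<Delta>" by (rule assms)
  qed
  \<comment> \<open>For fixed \<open>X\<close> and \<open>Y\<close> the formula concerns one vector
    of \<open>m\<close>, determined by its metric products with all Z in \<open>m\<close>.\<close>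
  have U: "U X Y \<in> m_space L t" using assms(9,14,16,17) by (simp add: symmetric_bilinear_map_on_def)
  show ?thesis
    unfolding assms(11)
  proof (rule M.U_formula[OF _ _ assms(18) _ assms(19) U])
    show "\<forall>\<alpha>\<in>positive_roots L t \<Delta>. 0 < c \<alpha>" using assms(11,12) by simp
    show "X \<in> m_space L t" "Y \<in> m_space L t" using assms(9,16,17) by simp_all
    fix Z assume "Z \<in> m_space L t"
    then show "2 * invariant_metric L t \<Delta> c (U X Y) Z =
        invariant_metric L t \<Delta> c X (m_proj L t (L Z Y)) + invariant_metric L t \<Delta> c (m_proj L t (L Z X)) Y"
      using assms(15,16,17) unfolding assms(9,13) by blast
  qed
qed

end
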